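(* Let $G$ be a real, connected, compact, semisimple Lie group, and let $\mathcal{X}$ be a linear vector field on $G$ with linear flow $\varphi_t$ and associated derivation $\mathcal{D}$. If $\mathcal{D}$ has only eigenvalues $0$ or $\pm\alpha i$ (for a single $\alpha\in\mathbb{R}$), if $\Omega$ is a nonempty compact $\omega$-limit set for the linear flow $\varphi_t$, and if $\Omega$ does not contain a fixed point of $\varphi_t$, then $\Omega$ is a periodic orbit.
   Context: A vector field $\mathcal{X}$ on a Lie group $G$ is called linear if its flow $(\varphi_t)_{t\in\mathbb{R}}$ is a family of automorphisms of the Lie group $G$; $\varphi_t$ is then called the linear flow. The derivation associated to $\mathcal{X}$ is $\mathcal{D}(Y)=-[\mathcal{X},Y]$ for $Y$ in the Lie algebra $\mathfrak{g}$ of $G$; it satisfies $(d\varphi_t)_e=e^{t\mathcal{D}}$. The $\omega$-limit set of $g\in G$ is the set of limits of sequences $\varphi_{t_n}(g)$ with $t_n\to+\infty$. A periodic orbit is an orbit $\{\varphi_t(g):t\in\mathbb{R}\}$ for which there is $s>0$ with $\varphi_{t+s}(g)=\varphi_t(g)$ for all $t$. *)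

theory Defs
  imports "HOL-Analysis.Analysis" "HOL-Algebra.Group" "HOL-Library.Function_Algebras"
begin

text \<open>Real-valued functions, and functionals on them, form real vector spaces under the pointwise
  operations (addition and multiplication are already provided by \<^theory>\<open>HOL-Library.Function_Algebras\<close>).\<close>

instantiation "fun" :: (type, real_vector) real_vector
begin

definition scaleR_fun :: "real \<Rightarrow> ('a \<Rightarrow> 'b) \<Rightarrow> 'a \<Rightarrow> 'b"
  where "scaleR_fun c f = (\<lambda>x. c *\<^sub>R f x)"

instance
  by standard (auto simp: scaleR_fun_def fun_eq_iff scaleR_add_right scaleR_add_left)

end


section \<open>Smooth manifolds\<close>

text \<open>\<^term>\<open>S\<close> is meant to be open; \<^term>\<open>higher_differentiable_on S f k\<close> is then the usual class
  \<open>C\<^sup>k\<close> on \<^term>\<open>S\<close>.\<close>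

primrec higher_differentiable_on ::
    "'a::euclidean_space set \<Rightarrow> ('a \<Rightarrow> 'b::euclidean_space) \<Rightarrow> nat \<Rightarrow> bool"
  where
    "higher_differentiable_on S f 0 \<longleftrightarrow> continuous_on S f"
  | "higher_differentiable_on S f (Suc k) \<longleftrightarrow>
       (\<forall>x\<in>S. f differentiable (at x)) \<and>
       (\<forall>v. higher_differentiable_on S (\<lambda>x. frechet_derivative f (at x) v) k)"

definition smooth_on :: "'a::euclidean_space set \<Rightarrow> ('a \<Rightarrow> 'b::euclidean_space) \<Rightarrow> bool"
  where "smooth_on S f \<longleftrightarrow> (\<forall>k. higher_differentiable_on S f k)"

text \<open>A chart is given by its domain together with the coordinate map, whose values outside the
  domain are irrelevant.  Atlases need not be maximal.\<close>

type_synonym ('a, 'e) atlas = "('a set \<times> ('a \<Rightarrow> 'e)) set"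

definition is_chart :: "'a topology \<Rightarrow> 'a set \<times> ('a \<Rightarrow> 'e::euclidean_space) \<Rightarrow> bool"
  where "is_chart T = (\<lambda>(U, c). openin T U \<and> open (c ` U) \<and>
           homeomorphic_map (subtopology T U) (top_of_set (c ` U)) c)"

definition smooth_manifold :: "'a topology \<Rightarrow> ('a, 'e::euclidean_space) atlas \<Rightarrow> bool"
  where "smooth_manifold T A \<longleftrightarrow>
    Hausdorff_space T \<and> second_countable T \<and>
    (\<forall>C\<in>A. is_chart T C) \<and> (\<Union>(U, c)\<in>A. U) = topspace T \<and>
    (\<forall>(U, c)\<in>A. \<forall>(V, d)\<in>A. smooth_on (c ` (U \<inter> V)) (d \<circ> inv_into U c))"

definition smooth_map ::
    "'a topology \<Rightarrow> ('a, 'e::euclidean_space) atlas \<Rightarrow>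
     'b topology \<Rightarrow> ('b, 'f::euclidean_space) atlas \<Rightarrow> ('a \<Rightarrow> 'b) \<Rightarrow> bool"
  where "smooth_map T A T' A' F \<longleftrightarrow>
    continuous_map T T' F \<and>
    (\<forall>(U, c)\<in>A. \<forall>(V, d)\<in>A'. smooth_on (c ` (U \<inter> F -` V)) (d \<circ> F \<circ> inv_into U c))"

definition prod_atlas :: "('a, 'e) atlas \<Rightarrow> ('b, 'f) atlas \<Rightarrow> ('a \<times> 'b, 'e \<times> 'f) atlas"
  where "prod_atlas A B = {(U \<times> V, map_prod c d) |U c V d. (U, c) \<in> A \<and> (V, d) \<in> B}"

definition real_atlas :: "(real, real) atlas"
  where "real_atlas = {(UNIV, id)}"

text \<open>Values of a smooth function outside the manifold are arbitrary.  This is harmless: by the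
  Leibniz rule, a tangent vector as defined below does not depend on them.\<close>

definition smooth_functions :: "'a topology \<Rightarrow> ('a, 'e::euclidean_space) atlas \<Rightarrow> ('a \<Rightarrow> real) set"
  where "smooth_functions T A = {f. smooth_map T A euclideanreal real_atlas f}"

text \<open>Tangent vectors at \<^term>\<open>p\<close> are the point derivations of the algebra of smooth functions.
  They are normalised to be \<open>0\<close> on non-smooth functions, and vector fields to be \<open>0\<close>
  outside the manifold, so that HOL equality is equality of vector fields.\<close>

definition tangent_space ::
    "'a topology \<Rightarrow> ('a, 'e::euclidean_space) atlas \<Rightarrow> 'a \<Rightarrow> (('a \<Rightarrow> real) \<Rightarrow> real) set"
  where "tangent_space T A p = {v.
    (\<forall>f\<in>smooth_functions T A. \<forall>g\<in>smooth_functions T A. v (f + g) = v f + v g) \<and>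
    (\<forall>a. \<forall>f\<in>smooth_functions T A. v (a *\<^sub>R f) = a * v f) \<and>
    (\<forall>f\<in>smooth_functions T A. \<forall>g\<in>smooth_functions T A. v (f * g) = f p * v g + g p * v f) \<and>
    (\<forall>f. f \<notin> smooth_functions T A \<longrightarrow> v f = 0)}"

type_synonym 'a vector_field = "'a \<Rightarrow> ('a \<Rightarrow> real) \<Rightarrow> real"

definition vector_fields :: "'a topology \<Rightarrow> ('a, 'e::euclidean_space) atlas \<Rightarrow> 'a vector_field set"
  where "vector_fields T A = {X.
    (\<forall>p\<in>topspace T. X p \<in> tangent_space T A p) \<and>
    (\<forall>p. p \<notin> topspace T \<longrightarrow> X p = 0) \<and>
    (\<forall>f\<in>smooth_functions T A. (\<lambda>p. X p f) \<in> smooth_functions T A)}"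

definition lie_bracket :: "'a vector_field \<Rightarrow> 'a vector_field \<Rightarrow> 'a vector_field"
  where "lie_bracket X Y = (\<lambda>p f. X p (\<lambda>q. Y q f) - Y p (\<lambda>q. X q f))"

definition pushforward ::
    "'a topology \<Rightarrow> ('a, 'e::euclidean_space) atlas \<Rightarrow> ('a \<Rightarrow> 'a) \<Rightarrow>
     (('a \<Rightarrow> real) \<Rightarrow> real) \<Rightarrow> ('a \<Rightarrow> real) \<Rightarrow> real"
  where "pushforward T A F v = (\<lambda>f. if f \<in> smooth_functions T A then v (f \<circ> F) else 0)"

text \<open>The flow of a complete vector field \<^term>\<open>X\<close>: the smooth action of the real line on the
  manifold whose infinitesimal generator is \<^term>\<open>X\<close>.\<close>

definition is_flow_of ::
    "'a topology \<Rightarrow> ('a, 'e::euclidean_space) atlas \<Rightarrow> 'a vector_field \<Rightarrow> (real \<Rightarrow> 'a \<Rightarrow> 'a) \<Rightarrow> bool"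
  where "is_flow_of T A X \<phi> \<longleftrightarrow>
    smooth_map (prod_topology euclideanreal T) (prod_atlas real_atlas A) T A (\<lambda>(t, p). \<phi> t p) \<and>
    (\<forall>p\<in>topspace T. \<phi> 0 p = p) \<and>
    (\<forall>s t. \<forall>p\<in>topspace T. \<phi> (s + t) p = \<phi> s (\<phi> t p)) \<and>
    (\<forall>p\<in>topspace T. \<forall>t. \<forall>f\<in>smooth_functions T A.
       ((\<lambda>s. f (\<phi> s p)) has_real_derivative X (\<phi> t p) f) (at t))"


section \<open>Lie groups and their Lie algebras\<close>

record ('a, 'e) lie_struct = "'a monoid" +
  gtop :: "'a topology"
  charts :: "('a, 'e) atlas"

locale lie_group = group G for G :: "('a, 'e::euclidean_space) lie_struct" (structure) +
  assumes topspace_eq: "topspace (gtop G) = carrier G"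
    and manifold: "smooth_manifold (gtop G) (charts G)"
    and smooth_mult:
      "smooth_map (prod_topology (gtop G) (gtop G)) (prod_atlas (charts G) (charts G))
         (gtop G) (charts G) (\<lambda>(x, y). x \<otimes> y)"
    and smooth_inv:
      "smooth_map (gtop G) (charts G) (gtop G) (charts G) (\<lambda>x. inv x)"

definition lie_automorphism :: "('a, 'e::euclidean_space) lie_struct \<Rightarrow> ('a \<Rightarrow> 'a) \<Rightarrow> bool"
  where "lie_automorphism G F \<longleftrightarrow> F \<in> iso G G \<and>
    smooth_map (gtop G) (charts G) (gtop G) (charts G) F \<and>
    smooth_map (gtop G) (charts G) (gtop G) (charts G) (inv_into (carrier G) F)"

definition lie_algebra :: "('a, 'e::euclidean_space) lie_struct \<Rightarrow> 'a vector_field set"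
  where "lie_algebra G = {X \<in> vector_fields (gtop G) (charts G).
    \<forall>g\<in>carrier G. \<forall>h\<in>carrier G.
      pushforward (gtop G) (charts G) (\<lambda>x. g \<otimes>\<^bsub>G\<^esub> x) (X h) = X (g \<otimes>\<^bsub>G\<^esub> h)}"

definition lie_ideal :: "'a vector_field set \<Rightarrow> 'a vector_field set \<Rightarrow> bool"
  where "lie_ideal I L \<longleftrightarrow> I \<subseteq> L \<and> subspace I \<and> (\<forall>X\<in>L. \<forall>Y\<in>I. lie_bracket X Y \<in> I)"

definition derived_algebra :: "'a vector_field set \<Rightarrow> 'a vector_field set"
  where "derived_algebra L = span {lie_bracket X Y |X Y. X \<in> L \<and> Y \<in> L}"

definition solvable_lie_algebra :: "'a vector_field set \<Rightarrow> bool"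
  where "solvable_lie_algebra L \<longleftrightarrow> (\<exists>n. (derived_algebra ^^ n) L = {0})"

definition semisimple :: "('a, 'e::euclidean_space) lie_struct \<Rightarrow> bool"
  where "semisimple G \<longleftrightarrow> (\<forall>I. lie_ideal I (lie_algebra G) \<and> solvable_lie_algebra I \<longrightarrow> I = {0})"


section \<open>Linear vector fields\<close>

definition linear_vector_field ::
    "('a, 'e::euclidean_space) lie_struct \<Rightarrow> 'a vector_field \<Rightarrow> (real \<Rightarrow> 'a \<Rightarrow> 'a) \<Rightarrow> bool"
  where "linear_vector_field G X \<phi> \<longleftrightarrow>
    X \<in> vector_fields (gtop G) (charts G) \<and> is_flow_of (gtop G) (charts G) X \<phi> \<and>
    (\<forall>t. lie_automorphism G (\<phi> t))"

definition derivation_of :: "'a vector_field \<Rightarrow> 'a vector_field \<Rightarrow> 'a vector_field"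
  where "derivation_of X Y = - lie_bracket X Y"

text \<open>Eigenvalues of a real linear map \<^term>\<open>D\<close> on a real space \<^term>\<open>V\<close> are those of its
  complexification, in which the pair \<open>(Y, Z)\<close> stands for \<open>Y + \<i> Z\<close>.\<close>

definition complexified_scale :: "complex \<Rightarrow> 'v::real_vector \<times> 'v \<Rightarrow> 'v \<times> 'v"
  where "complexified_scale \<mu> = (\<lambda>(Y, Z). (Re \<mu> *\<^sub>R Y - Im \<mu> *\<^sub>R Z, Re \<mu> *\<^sub>R Z + Im \<mu> *\<^sub>R Y))"

definition eigenvalues_on :: "'v::real_vector set \<Rightarrow> ('v \<Rightarrow> 'v) \<Rightarrow> complex set"
  where "eigenvalues_on V D =
    {\<mu>. \<exists>W \<in> V \<times> V. W \<noteq> (0, 0) \<and> map_prod D D W = complexified_scale \<mu> W}"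


section \<open>Dynamics of a flow\<close>

definition omega_limit :: "'a topology \<Rightarrow> (real \<Rightarrow> 'a \<Rightarrow> 'a) \<Rightarrow> 'a \<Rightarrow> 'a set"
  where "omega_limit T \<phi> g =
    {x. \<exists>t :: nat \<Rightarrow> real. filterlim t at_top sequentially \<and>
          limitin T (\<lambda>n. \<phi> (t n) g) x sequentially}"

definition fixed_point :: "(real \<Rightarrow> 'a \<Rightarrow> 'a) \<Rightarrow> 'a \<Rightarrow> bool"
  where "fixed_point \<phi> x \<longleftrightarrow> (\<forall>t. \<phi> t x = x)"

definition periodic_orbit :: "'a topology \<Rightarrow> (real \<Rightarrow> 'a \<Rightarrow> 'a) \<Rightarrow> 'a set \<Rightarrow> bool"
  where "periodic_orbit T \<phi> \<Omega> \<longleftrightarrow>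
    (\<exists>x\<in>topspace T. \<Omega> = range (\<lambda>t. \<phi> t x) \<and> (\<exists>s>0. \<forall>t. \<phi> (t + s) x = \<phi> t x))"

end

theory Submission
  imports Defs
begin

text \<open>Every left invariant vector field is determined by its value at the identity, so, through a
  chart at the identity, the derivation \<open>derivation_of X\<close> becomes the generator \<open>M\<close> of the one-parameter group
  \<open>E t\<close> of differentials of the flow.  Compactness gives an \<open>Ad\<close>-invariant inner product, for which
  every \<open>ad u\<close> is skew; together with semisimplicity this makes the Killing form negative definite.
  It is preserved by all differentials of automorphisms, hence \<open>M\<close> is skew for it, so \<open>M\<close> is
  semisimple with eigenvalues in \<open>{0, \<plusminus> i \<alpha>}\<close> and \<open>E P = id\<close> for some \<open>P > 0\<close>.  Then
  \<open>Ad (\<phi>\<^sub>P g) = Ad g\<close>, and since \<open>Ad\<close> is injective near the identity, the automorphism \<open>\<phi>\<^sub>P\<close> fixes a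
  neighbourhood of the identity, hence all of the connected group.  So every orbit is periodic and
  compact, and an \<open>\<omega>\<close>-limit set is the orbit itself.\<close>

section \<open>Calculus of smooth maps\<close>

text \<open>The \<open>Ad\<close>-invariant inner product cannot itself be used on the flow: it is
  invariant under inner automorphisms, and the linear flow is not assumed to be inner. It only fixes
  the sign of the Killing form, which is canonical, so that every automorphism is an isometry for
  it. Two classical tools are bypassed. The average over Haar measure becomes a minimisation problem
  on symmetric forms. The exponential map of the group never appears:
  \<open>endomorphism_trivial\<close> recognises a group element near the identity by its adjoint
  action, and the exponential of the generator is written in closed form from
  \<open>M^3 = - \<alpha>^2 M\<close>. This also shows the period:
  \<open>2 * pi / \<bar>\<alpha>\<bar>\<close>, or any positive time when \<alpha> = 0, since the
  generator then vanishes. Much of the length is due to tangent vectors being point derivations: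
  they have to be identified with coordinate vectors before any linear algebra applies. Both
  brackets that occur, of two left invariant fields and of \<open>X\<close> with one of them, come
  out of a single product rule, \<open>deriv_moving_vector\<close>.\<close>

lemma higher_differentiable_on_cong:
  assumes "open S" "\<And>x. x \<in> S \<Longrightarrow> f x = g x" "higher_differentiable_on S f k"
  shows "higher_differentiable_on S g k"
  using assms(2,3)
proof (induction k arbitrary: f g)
  case 0
  then show ?case by (simp cong: continuous_on_cong)
next
  case (Suc k)
  have d: "frechet_derivative f (at x) = frechet_derivative g (at x)" "g differentiable (at x)"
    if "x \<in> S" for x
  proof -
    have f: "(f has_derivative frechet_derivative f (at x)) (at x)"
      using Suc that by (simp add: frechet_derivative_works)
    then have "(g has_derivative frechet_derivative f (at x)) (at x)"
      by (rule has_derivative_transform_within_open[OF _ assms(1) that]) (use Suc in auto)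
    then show "frechet_derivative f (at x) = frechet_derivative g (at x)" "g differentiable (at x)"
      by (auto simp: differentiable_def frechet_derivative_at)
  qed
  have "higher_differentiable_on S (\<lambda>x. frechet_derivative g (at x) v) k" for v
    by (rule Suc.IH[of "\<lambda>x. frechet_derivative f (at x) v"]) (use d Suc in auto)
  then show ?case using d by simp
qed

lemma higher_differentiable_on_subset:
  "higher_differentiable_on S f k \<Longrightarrow> T \<subseteq> S \<Longrightarrow> higher_differentiable_on T f k"
  by (induction k arbitrary: f) (auto intro: continuous_on_subset)

lemma higher_differentiable_on_Suc_mono:
  "higher_differentiable_on S f (Suc k) \<Longrightarrow> higher_differentiable_on S f k"
proof (induction k arbitrary: f)
  case 0
  then show ?case
    by (auto intro!: differentiable_imp_continuous_on differentiable_at_imp_differentiable_on)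
next
  case (Suc k)
  then show ?case by (metis higher_differentiable_on.simps(2))
qed

lemma higher_differentiable_on_local:
  assumes "\<And>x. x \<in> S \<Longrightarrow> \<exists>N. open N \<and> x \<in> N \<and> higher_differentiable_on N f k"
  shows "higher_differentiable_on S f k"
  using assms
proof (induction k arbitrary: f)
  case 0
  have "isCont f x" if x: "x \<in> S" for x
    using 0[OF x] by (auto simp: continuous_on_eq_continuous_at)
  then show ?case by (auto intro: continuous_at_imp_continuous_on)
next
  case (Suc k)
  then show ?case by simp metis
qed

lemma higher_differentiable_on_const: "higher_differentiable_on S (\<lambda>x. c) k"
  by (induction k arbitrary: c) auto

lemma higher_differentiable_on_linear:
  assumes "bounded_linear L"
  shows "higher_differentiable_on S L k"
proof (cases k)
  case 0
  then show ?thesis using assms by (simp add: linear_continuous_on)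
next
  case (Suc n)
  have "frechet_derivative L (at x) = L" for x
    using bounded_linear_imp_has_derivative[OF assms] frechet_derivative_at by metis
  moreover have "L differentiable (at x)" for x
    using bounded_linear_imp_has_derivative[OF assms] differentiable_def by blast
  ultimately show ?thesis using Suc by (simp add: higher_differentiable_on_const)
qed

lemma higher_differentiable_on_has_derivative:
  "higher_differentiable_on S f (Suc k) \<Longrightarrow> x \<in> S \<Longrightarrow>
    (f has_derivative frechet_derivative f (at x)) (at x)"
  by (simp add: frechet_derivative_works)

text \<open>By uniqueness of derivatives any explicit derivative may stand in for
  \<open>frechet_derivative\<close>. The closure properties below are inductions on the order that
  hand the usual differentiation formulas to this rule.\<close>

lemma higher_differentiable_on_SucI:
  assumes "open S" "\<And>x. x \<in> S \<Longrightarrow> (f has_derivative D x) (at x)"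
    and "\<And>v. higher_differentiable_on S (\<lambda>x. D x v) k"
  shows "higher_differentiable_on S f (Suc k)"
proof -
  have "frechet_derivative f (at x) = D x" if "x \<in> S" for x
    using assms(2)[OF that] frechet_derivative_at by metis
  then have "higher_differentiable_on S (\<lambda>x. frechet_derivative f (at x) v) k" for v
    by (intro higher_differentiable_on_cong[OF assms(1) _ assms(3)[of v]]) simp
  then show ?thesis using assms(2) by (auto simp: differentiable_def)
qed

lemma higher_differentiable_on_add:
  assumes "open S" "higher_differentiable_on S f k" "higher_differentiable_on S g k"
  shows "higher_differentiable_on S (\<lambda>x. f x + g x) k"
  using assms(2,3)
proof (induction k arbitrary: f g)
  case 0
  then show ?case by (simp add: continuous_on_add)
next
  case (Suc k)
  note d = Suc.prems[THEN higher_differentiable_on_has_derivative]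
  show ?case
    by (rule higher_differentiable_on_SucI[OF assms(1) has_derivative_add[OF d]])
      (use Suc in simp_all)
qed

lemma higher_differentiable_on_sum:
  assumes "open S" "\<And>i. i \<in> I \<Longrightarrow> higher_differentiable_on S (f i) k"
  shows "higher_differentiable_on S (\<lambda>x. \<Sum>i\<in>I. f i x) k"
proof (cases "finite I")
  case True
  then show ?thesis using assms(2)
    by (induction I) (auto intro!: higher_differentiable_on_const higher_differentiable_on_add assms(1))
qed (simp add: higher_differentiable_on_const)

lemma higher_differentiable_on_bilinear:
  assumes "open S" "bounded_bilinear B"
    and "higher_differentiable_on S f k" "higher_differentiable_on S g k"
  shows "higher_differentiable_on S (\<lambda>x. B (f x) (g x)) k"
  using assms(3,4)
proof (induction k arbitrary: f g)
  case 0
  then show ?case by (simp add: bounded_bilinear.continuous_on[OF assms(2)])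
next
  case (Suc k)
  note d = Suc.prems[THEN higher_differentiable_on_has_derivative]
  note lower = Suc.prems[THEN higher_differentiable_on_Suc_mono]
  show ?case
    by (rule higher_differentiable_on_SucI[OF assms(1) bounded_bilinear.FDERIV[OF assms(2) d]])
      (use Suc.prems in \<open>simp_all add: higher_differentiable_on_add assms(1) Suc.IH lower\<close>)
qed

lemma higher_differentiable_on_compose:
  assumes "open S" "open T" "f ` S \<subseteq> T"
    and "higher_differentiable_on T g k" "higher_differentiable_on S f k"
  shows "higher_differentiable_on S (\<lambda>x. g (f x)) k"
  using assms(4,5)
proof (induction k arbitrary: g)
  case 0
  then show ?case using assms(3) by (auto intro: continuous_on_compose2)
next
  case (Suc k)
  note g = higher_differentiable_on_has_derivative[OF Suc.prems(1)]
  note f = higher_differentiable_on_has_derivative[OF Suc.prems(2)]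
  let ?g = "\<lambda>x. frechet_derivative g (at (f x))"
  let ?f = "\<lambda>x. frechet_derivative f (at x)"
  \<comment> \<open>In the chain rule both the linear map and its argument vary with
    \<open>x\<close>. Expanding the argument in the basis gives sums of products in which the outer
    derivative is taken in fixed directions, where the induction hypothesis applies.\<close>
  have expand: "?g x (?f x v) = (\<Sum>b\<in>Basis. (?f x v \<bullet> b) *\<^sub>R ?g x b)" if "x \<in> S" for x v
  proof -
    have lin: "linear (?g x)"
      using g[of "f x"] that assms(3) by (auto dest: has_derivative_linear)
    have "?g x (\<Sum>b\<in>Basis. (w \<bullet> b) *\<^sub>R b) = (\<Sum>b\<in>Basis. (w \<bullet> b) *\<^sub>R ?g x b)" for w
      by (simp only: linear_sum[OF lin] linear_cmul[OF lin])
    from this[of "?f x v"] show ?thesis by (subst (asm) euclidean_representation)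
  qed
  have inner: "higher_differentiable_on S (\<lambda>x. ?f x v \<bullet> b) k" for v b
    by (rule higher_differentiable_on_bilinear[OF assms(1) bounded_bilinear_inner
          _ higher_differentiable_on_const]) (use Suc.prems(2) in simp)
  show ?case
  proof (rule higher_differentiable_on_SucI[OF assms(1), where D="\<lambda>x v. ?g x (?f x v)"])
    show "((\<lambda>x. g (f x)) has_derivative (\<lambda>v. ?g x (?f x v))) (at x)" if "x \<in> S" for x
      using diff_chain_at[OF f[OF that] g[of "f x"]] that assms(3) by (auto simp: o_def)
    have "higher_differentiable_on S (\<lambda>x. \<Sum>b\<in>Basis. (?f x v \<bullet> b) *\<^sub>R ?g x b) k" for v
    proof (intro higher_differentiable_on_sum assms(1)
        higher_differentiable_on_bilinear[OF assms(1) bounded_bilinear_scaleR] inner)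
      show "higher_differentiable_on S (\<lambda>x. ?g x b) k" for b
        by (rule Suc.IH[OF _ higher_differentiable_on_Suc_mono[OF Suc.prems(2)]]) (use Suc.prems in simp)
    qed
    then show "higher_differentiable_on S (\<lambda>x. ?g x (?f x v)) k" for v
      by (rule higher_differentiable_on_cong[OF assms(1), rotated]) (use expand in auto)
  qed
qed

section \<open>Closure properties of infinitely differentiable maps\<close>

lemma smooth_on_cong:
  "open S \<Longrightarrow> (\<And>x. x \<in> S \<Longrightarrow> f x = g x) \<Longrightarrow> smooth_on S f \<Longrightarrow> smooth_on S g"
  unfolding smooth_on_def using higher_differentiable_on_cong by metis

lemma smooth_on_subset: "smooth_on S f \<Longrightarrow> T \<subseteq> S \<Longrightarrow> smooth_on T f"
  unfolding smooth_on_def using higher_differentiable_on_subset by metis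

lemma smooth_on_local:
  "(\<And>x. x \<in> S \<Longrightarrow> \<exists>N. open N \<and> x \<in> N \<and> smooth_on N f) \<Longrightarrow> smooth_on S f"
  unfolding smooth_on_def by (metis higher_differentiable_on_local)

lemma smooth_on_Un: "open S \<Longrightarrow> open T \<Longrightarrow> smooth_on S f \<Longrightarrow> smooth_on T f \<Longrightarrow> smooth_on (S \<union> T) f"
  by (rule smooth_on_local) blast

lemma smooth_on_continuous_on: "smooth_on S f \<Longrightarrow> continuous_on S f"
  unfolding smooth_on_def by (metis higher_differentiable_on.simps(1))

lemma smooth_on_has_derivative:
  "smooth_on S f \<Longrightarrow> x \<in> S \<Longrightarrow> (f has_derivative frechet_derivative f (at x)) (at x)"
  unfolding smooth_on_def using higher_differentiable_on_has_derivative by blast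

lemma smooth_on_linear_derivative:
  "smooth_on S f \<Longrightarrow> x \<in> S \<Longrightarrow> linear (frechet_derivative f (at x))"
  using has_derivative_linear smooth_on_has_derivative by blast

lemma smooth_on_derivative: "smooth_on S f \<Longrightarrow> smooth_on S (\<lambda>x. frechet_derivative f (at x) v)"
  unfolding smooth_on_def by (metis higher_differentiable_on.simps(2))

lemma smooth_on_const: "smooth_on S (\<lambda>x. c)"
  unfolding smooth_on_def by (intro allI higher_differentiable_on_const)

lemma smooth_on_linear: "bounded_linear L \<Longrightarrow> smooth_on S L"
  unfolding smooth_on_def by (intro allI higher_differentiable_on_linear)

lemma smooth_on_add: "open S \<Longrightarrow> smooth_on S f \<Longrightarrow> smooth_on S g \<Longrightarrow> smooth_on S (\<lambda>x. f x + g x)"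
  unfolding smooth_on_def by (intro allI higher_differentiable_on_add) simp_all

lemma smooth_on_sum:
  "open S \<Longrightarrow> (\<And>i. i \<in> I \<Longrightarrow> smooth_on S (f i)) \<Longrightarrow> smooth_on S (\<lambda>x. \<Sum>i\<in>I. f i x)"
  unfolding smooth_on_def by (intro allI higher_differentiable_on_sum) simp_all

lemma smooth_on_bilinear:
  "open S \<Longrightarrow> bounded_bilinear B \<Longrightarrow> smooth_on S f \<Longrightarrow> smooth_on S g \<Longrightarrow> smooth_on S (\<lambda>x. B (f x) (g x))"
  unfolding smooth_on_def by (intro allI higher_differentiable_on_bilinear[where B=B]) simp_all

lemma smooth_on_compose:
  "open S \<Longrightarrow> open T \<Longrightarrow> f ` S \<subseteq> T \<Longrightarrow> smooth_on T g \<Longrightarrow> smooth_on S f \<Longrightarrow> smooth_on S (\<lambda>x. g (f x))"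
  unfolding smooth_on_def
  by (intro allI higher_differentiable_on_compose[where f=f and g=g and T=T]) simp_all

lemma smooth_on_linear_compose:
  "open S \<Longrightarrow> bounded_linear L \<Longrightarrow> smooth_on S f \<Longrightarrow> smooth_on S (\<lambda>x. L (f x))"
  by (rule smooth_on_compose[where T=UNIV]) (auto simp: smooth_on_linear)

lemma smooth_on_Pair:
  assumes "open S" "smooth_on S f" "smooth_on S g"
  shows "smooth_on S (\<lambda>x. (f x, g x))"
proof -
  have "smooth_on S (\<lambda>x. (f x, 0) + (0, g x))"
    by (intro smooth_on_add smooth_on_linear_compose[OF assms(1), of "\<lambda>a. (a, 0)"]
        smooth_on_linear_compose[OF assms(1), of "\<lambda>a. (0, a)"] assms
        bounded_linear_Pair bounded_linear_ident bounded_linear_zero)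
  then show ?thesis by simp
qed

lemma smooth_on_scaleR:
  "open S \<Longrightarrow> smooth_on S f \<Longrightarrow> smooth_on S g \<Longrightarrow> smooth_on S (\<lambda>x. f x *\<^sub>R g x)"
  by (rule smooth_on_bilinear[OF _ bounded_bilinear_scaleR])

lemma smooth_on_mult:
  fixes f g :: "'a::euclidean_space \<Rightarrow> real"
  shows "open S \<Longrightarrow> smooth_on S f \<Longrightarrow> smooth_on S g \<Longrightarrow> smooth_on S (\<lambda>x. f x * g x)"
  by (rule smooth_on_bilinear[OF _ bounded_bilinear_mult])

lemma smooth_on_affine: "bounded_linear L \<Longrightarrow> smooth_on S (\<lambda>x. c + L x)"
  by (rule smooth_on_subset[OF _ subset_UNIV])
    (intro smooth_on_add smooth_on_const smooth_on_linear open_UNIV)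

lemma smooth_on_inner_const: "open S \<Longrightarrow> smooth_on S f \<Longrightarrow> smooth_on S (\<lambda>x. f x \<bullet> b)"
  by (rule smooth_on_linear_compose[OF _ bounded_linear_inner_left])

subsection \<open>Symmetry of second derivatives\<close>

text \<open>The mean value theorem is applied twice: to the difference \<open>?\<phi>\<close> along
  direction \<open>u\<close>, and then to the resulting change of the \<open>u\<close>-derivative
  along direction \<open>v\<close>.\<close>

lemma second_difference_mean_value:
  fixes F :: "'a::euclidean_space \<Rightarrow> real"
  assumes F: "smooth_on S F" and h: "h > 0"
    and S: "\<And>s t. 0 \<le> s \<Longrightarrow> s \<le> h \<Longrightarrow> 0 \<le> t \<Longrightarrow> t \<le> h \<Longrightarrow> x + s *\<^sub>R u + t *\<^sub>R v \<in> S"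
  shows "\<exists>\<xi> \<eta>. 0 < \<xi> \<and> \<xi> < h \<and> 0 < \<eta> \<and> \<eta> < h \<and>
    F (x + h *\<^sub>R u + h *\<^sub>R v) - F (x + h *\<^sub>R u) - F (x + h *\<^sub>R v) + F x =
    h * h * frechet_derivative (\<lambda>y. frechet_derivative F (at y) u) (at (x + \<xi> *\<^sub>R u + \<eta> *\<^sub>R v)) v"
proof -
  let ?D = "\<lambda>y. frechet_derivative F (at y)"
  let ?\<phi> = "\<lambda>s. F (x + s *\<^sub>R u + h *\<^sub>R v) - F (x + s *\<^sub>R u)"
  let ?\<phi>' = "\<lambda>s. ?D (x + s *\<^sub>R u + h *\<^sub>R v) u - ?D (x + s *\<^sub>R u) u"
  have line: "((\<lambda>s. g (y + s *\<^sub>R w)) has_real_derivative frechet_derivative g (at (y + s *\<^sub>R w)) w) (at s)"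
    if g: "smooth_on S g" and y: "y + s *\<^sub>R w \<in> S" for g :: "'a \<Rightarrow> real" and y w s
  proof -
    have lin: "((\<lambda>s. y + s *\<^sub>R w) has_derivative (\<lambda>s. s *\<^sub>R w)) (at s)"
      by (auto intro!: derivative_eq_intros)
    have "((\<lambda>s. g (y + s *\<^sub>R w)) has_derivative
        (\<lambda>s'. frechet_derivative g (at (y + s *\<^sub>R w)) (s' *\<^sub>R w))) (at s)"
      using diff_chain_at[OF lin smooth_on_has_derivative[OF g y]] by (simp add: o_def)
    moreover have "(\<lambda>s'. frechet_derivative g (at (y + s *\<^sub>R w)) (s' *\<^sub>R w)) =
        (*) (frechet_derivative g (at (y + s *\<^sub>R w)) w)"
      by (rule ext) (simp add: linear_cmul[OF smooth_on_linear_derivative[OF g y]])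
    ultimately show ?thesis by (simp add: has_field_derivative_def)
  qed
  have "(?\<phi> has_real_derivative ?\<phi>' s) (at s)" if "0 \<le> s" "s \<le> h" for s
  proof (intro derivative_intros)
    show "((\<lambda>s. F (x + s *\<^sub>R u + h *\<^sub>R v)) has_real_derivative ?D (x + s *\<^sub>R u + h *\<^sub>R v) u) (at s)"
      using line[OF F, of "x + h *\<^sub>R v" s u] S[of s h] h that by (simp add: algebra_simps)
    show "((\<lambda>s. F (x + s *\<^sub>R u)) has_real_derivative ?D (x + s *\<^sub>R u) u) (at s)"
      using line[OF F, of "x" s u] S[of s 0] h that by simp
  qed
  from MVT2[OF h this] obtain \<xi> where \<xi>: "0 < \<xi>" "\<xi> < h" "?\<phi> h - ?\<phi> 0 = h * ?\<phi>' \<xi>"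
    by auto
  have "((\<lambda>t. ?D (x + \<xi> *\<^sub>R u + t *\<^sub>R v) u) has_real_derivative
      frechet_derivative (\<lambda>y. ?D y u) (at (x + \<xi> *\<^sub>R u + t *\<^sub>R v)) v) (at t)" if "0 \<le> t" "t \<le> h" for t
    by (rule line[OF smooth_on_derivative[OF F]]) (use \<xi> that in \<open>auto intro: S\<close>)
  from MVT2[OF h this] obtain \<eta> where "0 < \<eta>" "\<eta> < h" "?\<phi>' \<xi> =
      h * frechet_derivative (\<lambda>y. ?D y u) (at (x + \<xi> *\<^sub>R u + \<eta> *\<^sub>R v)) v"
    by auto
  then show ?thesis using \<xi> by (intro exI[of _ \<xi>] exI[of _ \<eta>]) auto
qed

text \<open>The second difference of \<open>F\<close> over a parallelogram is symmetric in
  \<open>u\<close> and \<open>v\<close>. Evaluated in the two orders it is \<open>h * h\<close>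
  times a value of either mixed derivative near \<open>x\<close>, so continuity forbids the two to
  differ at \<open>x\<close>.\<close>

lemma symmetric_second_derivative_real:
  fixes F :: "'a::euclidean_space \<Rightarrow> real"
  assumes F: "smooth_on S F" and S: "open S" "x \<in> S"
  shows "frechet_derivative (\<lambda>y. frechet_derivative F (at y) u) (at x) v =
    frechet_derivative (\<lambda>y. frechet_derivative F (at y) v) (at x) u" 
proof (rule ccontr)
  define P where "P = (\<lambda>x. frechet_derivative (\<lambda>y. frechet_derivative F (at y) u) (at x) v)"
  define Q where "Q = (\<lambda>x. frechet_derivative (\<lambda>y. frechet_derivative F (at y) v) (at x) u)"
  assume "\<not> ?thesis"
  then have ne: "P x \<noteq> Q x" by (simp add: P_def Q_def)
  define \<epsilon> where "\<epsilon> = \<bar>P x - Q x\<bar> / 2"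
  have \<epsilon>: "\<epsilon> > 0" using ne by (simp add: \<epsilon>_def)
  have "isCont P x" "isCont Q x"
    unfolding P_def Q_def using S smooth_on_continuous_on[OF smooth_on_derivative[OF smooth_on_derivative[OF F]]]
    by (auto simp: continuous_on_eq_continuous_at)
  then have "\<forall>\<^sub>F y in nhds x. dist (P y) (P x) < \<epsilon>" "\<forall>\<^sub>F y in nhds x. dist (Q y) (Q x) < \<epsilon>"
    using \<epsilon> unfolding isCont_def tendsto_at_iff_tendsto_nhds by (blast dest: tendstoD)+
  moreover have "\<forall>\<^sub>F y in nhds x. y \<in> S" using S eventually_nhds by blast
  ultimately have "\<forall>\<^sub>F y in nhds x. dist (P y) (P x) < \<epsilon> \<and> dist (Q y) (Q x) < \<epsilon> \<and> y \<in> S"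
    by eventually_elim auto
  then obtain d where d: "d > 0" "\<And>y. dist y x < d \<Longrightarrow> dist (P y) (P x) < \<epsilon> \<and> dist (Q y) (Q x) < \<epsilon> \<and> y \<in> S"
    by (auto simp: eventually_nhds_metric)
  \<comment> \<open>Every point of the parallelogram is then within \<open>d / 2\<close> of
    \<open>x\<close>; the summand 1 guards against \<open>u = v = 0\<close>.\<close>
  define h where "h = d / (norm u + norm v + 1) / 2"
  have pos: "norm u + norm v + 1 > 0" by (smt (verit) norm_ge_zero)
  have h: "h > 0" "h * (norm u + norm v) < d"
  proof -
    show "h > 0" using d pos by (simp add: h_def)
    have "h * (norm u + norm v) \<le> h * (norm u + norm v + 1)" using \<open>h > 0\<close> by simp
    also have "\<dots> = d / 2"
      using nonzero_eq_divide_eq[of "norm u + norm v + 1" h "d / 2"] pos by (simp add: h_def)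
    finally show "h * (norm u + norm v) < d" using d by simp
  qed
  have near: "dist (x + s *\<^sub>R a + t *\<^sub>R b) x < d"
    if "0 \<le> s" "s \<le> h" "0 \<le> t" "t \<le> h" "norm a + norm b = norm u + norm v" for s t a b
  proof -
    have "dist (x + s *\<^sub>R a + t *\<^sub>R b) x \<le> s * norm a + t * norm b"
      using norm_triangle_ineq[of "s *\<^sub>R a" "t *\<^sub>R b"] that by (simp add: dist_norm)
    also have "\<dots> \<le> h * norm a + h * norm b" using that by (intro add_mono mult_right_mono) auto
    also have "\<dots> = h * (norm u + norm v)" using that by (metis distrib_left)
    finally show ?thesis using h by simp
  qed
  have PQ: "frechet_derivative (\<lambda>y. frechet_derivative F (at y) u) (at x) v = P x"
    "frechet_derivative (\<lambda>y. frechet_derivative F (at y) v) (at x) u = Q x" for x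
    by (simp_all add: P_def Q_def)
  obtain \<xi> \<eta> where 1: "0 < \<xi>" "\<xi> < h" "0 < \<eta>" "\<eta> < h"
    "F (x + h *\<^sub>R u + h *\<^sub>R v) - F (x + h *\<^sub>R u) - F (x + h *\<^sub>R v) + F x = h * h * P (x + \<xi> *\<^sub>R u + \<eta> *\<^sub>R v)"
    using second_difference_mean_value[OF F h(1), of x u v, OF conjunct2[OF conjunct2[OF d(2)[OF near]]],
      unfolded PQ] by auto
  obtain \<xi>' \<eta>' where 2: "0 < \<xi>'" "\<xi>' < h" "0 < \<eta>'" "\<eta>' < h"
    "F (x + h *\<^sub>R v + h *\<^sub>R u) - F (x + h *\<^sub>R v) - F (x + h *\<^sub>R u) + F x = h * h * Q (x + \<xi>' *\<^sub>R v + \<eta>' *\<^sub>R u)"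
    using second_difference_mean_value[OF F h(1), of x v u, OF conjunct2[OF conjunct2[OF d(2)[OF near]]],
      unfolded PQ] by auto
  have swap: "a - b - c + d = (e::real) \<Longrightarrow> a - c - b + d = f \<Longrightarrow> e = f" for a b c d e f by linarith
  have "x + h *\<^sub>R v + h *\<^sub>R u = x + h *\<^sub>R u + h *\<^sub>R v" by simp
  from swap[OF 1(5) 2(5)[unfolded this]]
  have "h * h * P (x + \<xi> *\<^sub>R u + \<eta> *\<^sub>R v) = h * h * Q (x + \<xi>' *\<^sub>R v + \<eta>' *\<^sub>R u)" .
  then have "P (x + \<xi> *\<^sub>R u + \<eta> *\<^sub>R v) = Q (x + \<xi>' *\<^sub>R v + \<eta>' *\<^sub>R u)"
    using h(1) by (simp only: mult_cancel_left mult_eq_0_iff) simp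
  moreover have "dist (P (x + \<xi> *\<^sub>R u + \<eta> *\<^sub>R v)) (P x) < \<epsilon>"
    by (rule conjunct1[OF d(2)[OF near]]) (use 1(1-4) in simp_all)
  moreover have "dist (Q (x + \<xi>' *\<^sub>R v + \<eta>' *\<^sub>R u)) (Q x) < \<epsilon>"
    by (rule conjunct1[OF conjunct2[OF d(2)[OF near]]]) (use 2(1-4) in simp_all)
  moreover have "\<bar>p - q\<bar> < 2 * e" if "p' = q'" "dist p' p < e" "dist q' q < e" for p q p' q' e :: real
    using that unfolding dist_real_def by linarith
  ultimately have "\<bar>P x - Q x\<bar> < 2 * \<epsilon>" by blast
  then show False by (simp add: \<epsilon>_def)
qed

lemma frechet_derivative_linear_compose:
  "f differentiable (at x) \<Longrightarrow> bounded_linear L \<Longrightarrow>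
    frechet_derivative (\<lambda>y. L (f y)) (at x) v = L (frechet_derivative f (at x) v)"
proof -
  assume f: "f differentiable (at x)" and L: "bounded_linear L"
  have "((\<lambda>y. L (f y)) has_derivative (\<lambda>v. L (frechet_derivative f (at x) v))) (at x)"
    by (rule bounded_linear.has_derivative[OF L]) (use f in \<open>simp add: frechet_derivative_works\<close>)
  from frechet_derivative_at[OF this, symmetric] show ?thesis by (rule fun_cong)
qed

lemma smooth_on_differentiable: "smooth_on S f \<Longrightarrow> x \<in> S \<Longrightarrow> f differentiable (at x)"
  by (rule differentiableI[OF smooth_on_has_derivative])

lemma symmetric_second_derivative:
  fixes F :: "'a::euclidean_space \<Rightarrow> 'b::euclidean_space"
  assumes F: "smooth_on S F" and S: "open S" "x \<in> S"
  shows "frechet_derivative (\<lambda>y. frechet_derivative F (at y) u) (at x) v =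
    frechet_derivative (\<lambda>y. frechet_derivative F (at y) v) (at x) u"
proof (rule euclidean_eqI)
  fix b :: 'b assume "b \<in> Basis"
  have *: "frechet_derivative (\<lambda>y. frechet_derivative F (at y) u) (at x) v \<bullet> b =
    frechet_derivative (\<lambda>y. frechet_derivative (\<lambda>z. F z \<bullet> b) (at y) u) (at x) v" for u v
  proof -
    have 1: "frechet_derivative (\<lambda>z. F z \<bullet> b) (at y) u = frechet_derivative F (at y) u \<bullet> b" if "y \<in> S" for y
      by (rule frechet_derivative_linear_compose[OF _ bounded_linear_inner_left])
        (rule smooth_on_differentiable[OF F that])
    have 2: "(\<lambda>y. frechet_derivative F (at y) u) differentiable at x"
      by (rule smooth_on_differentiable[OF smooth_on_derivative[OF F] S(2)])
    have "frechet_derivative (\<lambda>y. frechet_derivative F (at y) u) (at x) v \<bullet> b =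
      frechet_derivative (\<lambda>y. frechet_derivative F (at y) u \<bullet> b) (at x) v"
      by (rule frechet_derivative_linear_compose[OF 2 bounded_linear_inner_left, symmetric])
    also have "frechet_derivative (\<lambda>y. frechet_derivative F (at y) u \<bullet> b) (at x) =
      frechet_derivative (\<lambda>y. frechet_derivative (\<lambda>z. F z \<bullet> b) (at y) u) (at x)"
    proof (rule frechet_derivative_transform_within_open[OF _ S])
      show "(\<lambda>y. frechet_derivative F (at y) u \<bullet> b) differentiable (at x)"
        by (rule smooth_on_differentiable[OF smooth_on_inner_const[OF S(1) smooth_on_derivative[OF F]] S(2)])
    qed (simp add: 1)
    finally show ?thesis .
  qed
  show "frechet_derivative (\<lambda>y. frechet_derivative F (at y) u) (at x) v \<bullet> b =
    frechet_derivative (\<lambda>y. frechet_derivative F (at y) v) (at x) u \<bullet> b"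
    unfolding * by (rule symmetric_second_derivative_real[OF smooth_on_inner_const[OF S(1) F] S])
qed

subsection \<open>Hadamard's lemma\<close>

lemma convex_segment_point:
  assumes "convex S" "x \<in> S" "y \<in> S" "0 \<le> t" "t \<le> 1"
  shows "y + t *\<^sub>R (x - y) \<in> S"
proof -
  have "(1 - t) *\<^sub>R y + t *\<^sub>R x \<in> S" using assms by (simp add: convex_alt)
  then show ?thesis by (simp add: algebra_simps)
qed

text \<open>Differentiating in \<open>x\<close> under the integral sign brings out a factor
  \<open>t\<close>. The weight \<open>t ^ m\<close> absorbs it, so the induction goes through with
  \<open>m\<close> raised by one.\<close>

lemma higher_differentiable_on_segment_integral:
  fixes h :: "'a::euclidean_space \<Rightarrow> real"
  assumes S: "open S" "convex S" "y \<in> S" and h: "higher_differentiable_on S h k"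
  shows "higher_differentiable_on S (\<lambda>x. integral {0..1} (\<lambda>t. t ^ m * h (y + t *\<^sub>R (x - y)))) k"
  using h
proof (induction k arbitrary: h m)
  case 0
  have "continuous_on (S \<times> cbox 0 1) (\<lambda>z. h (y + snd z *\<^sub>R (fst z - y)))"
    by (rule continuous_on_compose2[OF 0[unfolded higher_differentiable_on.simps]])
      (auto intro!: continuous_intros simp: convex_segment_point S)
  then have "continuous_on (S \<times> cbox 0 1) (\<lambda>z. snd z ^ m * h (y + snd z *\<^sub>R (fst z - y)))"
    by (intro continuous_on_mult continuous_on_power continuous_on_snd continuous_on_id)
  then have "continuous_on (S \<times> cbox 0 1) (\<lambda>(x, t). t ^ m * h (y + t *\<^sub>R (x - y)))"
    by (simp add: split_beta)
  from integral_continuous_on_param[OF this] show ?case by (simp add: cbox_interval)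
next
  case (Suc k)
  let ?D = "\<lambda>x. frechet_derivative h (at x)"
  let ?p = "\<lambda>x t. y + t *\<^sub>R (x - y)"
  \<comment> \<open>The Leibniz rule expects the derivative as a bounded linear function, hence the
    packaging by \<open>Blinfun\<close>; continuity and the integral are then checked one direction
    at a time.\<close>
  let ?fx = "\<lambda>x t. Blinfun (\<lambda>v. t ^ Suc m * ?D (?p x t) v)"
  have p: "?p x t \<in> S" if "x \<in> S" "t \<in> {0..1}" for x t
    using that S by (auto intro: convex_segment_point)
  have der: "(h has_derivative ?D z) (at z)" if "z \<in> S" for z
    by (rule higher_differentiable_on_has_derivative[OF Suc.prems that])
  have cont: "continuous_on S (\<lambda>x. ?D x v)" for v
  proof -
    have "higher_differentiable_on S (\<lambda>x. ?D x v) j" if "j \<le> k" for j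
      using that Suc.prems
    proof (induction rule: inc_induct)
      case base
      then show ?case by simp
    next
      case (step n)
      then show ?case using higher_differentiable_on_Suc_mono by blast
    qed
    from this[of 0] show ?thesis by simp
  qed
  have app: "blinfun_apply (?fx x t) = (\<lambda>v. t ^ Suc m * ?D (?p x t) v)" if "x \<in> S" "t \<in> {0..1}" for x t
    by (rule bounded_linear_Blinfun_apply, rule bounded_linear_const_mult,
        rule has_derivative_bounded_linear[OF der[OF p[OF that]]])
  have contp: "continuous_on (S \<times> {0..1}) (\<lambda>z. g (?p (fst z) (snd z)))"
    if "continuous_on S g" for g :: "'a \<Rightarrow> real"
    by (rule continuous_on_compose2[OF that]) (auto intro!: continuous_intros p)
  show ?case
  proof (rule higher_differentiable_on_SucI[OF S(1),
        where D="\<lambda>x v. integral {0..1} (\<lambda>t. t ^ Suc m * ?D (?p x t) v)"])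
    fix x assume x: "x \<in> S"
    have "((\<lambda>x. integral (cbox 0 1) (\<lambda>t. t ^ m * h (?p x t))) has_derivative
        integral (cbox 0 1) (?fx x)) (at x within S)"
    proof (rule leibniz_rule[OF _ _ _ x S(2)])
      fix x and t :: real assume "x \<in> S" "t \<in> cbox 0 1"
      then have xt: "x \<in> S" "t \<in> {0..1}" by (auto simp: cbox_interval)
      have lin: "((\<lambda>x. ?p x t) has_derivative (\<lambda>v. t *\<^sub>R v)) (at x)"
        by (auto intro!: derivative_eq_intros)
      have "((\<lambda>x. h (?p x t)) has_derivative (\<lambda>v. ?D (?p x t) (t *\<^sub>R v))) (at x)"
        using diff_chain_at[OF lin der[OF p[OF xt]]] by (simp add: o_def)
      from has_derivative_mult_right[OF this, of "t ^ m"]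
      have "((\<lambda>x. t ^ m * h (?p x t)) has_derivative (\<lambda>v. t ^ m * ?D (?p x t) (t *\<^sub>R v))) (at x)" .
      moreover have "(\<lambda>v. t ^ m * ?D (?p x t) (t *\<^sub>R v)) = blinfun_apply (?fx x t)"
        unfolding app[OF xt] using linear_cmul[OF has_derivative_linear[OF der[OF p[OF xt]]]] by auto
      ultimately show "((\<lambda>x. t ^ m * h (?p x t)) has_derivative blinfun_apply (?fx x t)) (at x within S)"
        by (simp add: has_derivative_at_withinI)
    next
      fix x assume "x \<in> S"
      have "continuous_on S h"
        by (rule has_derivative_continuous_on[OF has_derivative_at_withinI[OF der]])
      then have "continuous_on {0..1} (\<lambda>t. h (?p x t))"
        by (rule continuous_on_compose2) (use p \<open>x \<in> S\<close> in \<open>auto intro!: continuous_intros\<close>)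
      then have "continuous_on {0..1} (\<lambda>t. t ^ m * h (?p x t))"
        by (intro continuous_on_mult continuous_on_power continuous_on_id)
      then show "(\<lambda>t. t ^ m * h (?p x t)) integrable_on cbox 0 1"
        by (simp add: cbox_interval integrable_continuous_real)
    next
      show "continuous_on (S \<times> cbox 0 1) (\<lambda>(x, t). ?fx x t)"
      proof (rule continuous_on_blinfun_componentwise)
        fix i :: 'a
        have "continuous_on (S \<times> {0..1}) (\<lambda>z. snd z ^ Suc m * ?D (?p (fst z) (snd z)) i)"
          by (intro continuous_on_mult continuous_on_power continuous_on_snd continuous_on_id
              contp[OF cont])
        then have "continuous_on (S \<times> {0..1}) (\<lambda>z. blinfun_apply (case z of (x, t) \<Rightarrow> ?fx x t) i)"
          by (rule continuous_on_eq) (auto simp only: app split_beta fst_conv snd_conv mem_Times_iff)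
        then show "continuous_on (S \<times> cbox 0 1) (\<lambda>z. blinfun_apply (case z of (x, t) \<Rightarrow> ?fx x t) i)"
          by (simp only: cbox_interval)
      qed
    qed
    then have "((\<lambda>x. integral {0..1} (\<lambda>t. t ^ m * h (?p x t))) has_derivative integral {0..1} (?fx x)) (at x)"
      using at_within_open[OF x S(1)] by (simp add: cbox_interval)
    moreover have "blinfun_apply (integral {0..1} (?fx x)) = (\<lambda>v. integral {0..1} (\<lambda>t. t ^ Suc m * ?D (?p x t) v))"
    proof
      fix v
      have "continuous_on {0..1} (\<lambda>t. ?fx x t)"
      proof (rule continuous_on_blinfun_componentwise)
        fix i :: 'a
        have "continuous_on {0..1} (\<lambda>t. ?D (?p x t) i)"
          by (rule continuous_on_compose2[OF cont[of i]]) (use p x in \<open>auto intro!: continuous_intros\<close>)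
        then have "continuous_on {0..1} (\<lambda>t. t ^ Suc m * ?D (?p x t) i)"
          by (intro continuous_on_mult continuous_on_power continuous_on_id)
        then show "continuous_on {0..1} (\<lambda>t. blinfun_apply (?fx x t) i)"
          by (rule continuous_on_eq) (simp only: app[OF x])
      qed
      then have "?fx x integrable_on {0..1}" by (rule integrable_continuous_real)
      then have "blinfun_apply (integral {0..1} (?fx x)) v = integral {0..1} (\<lambda>t. blinfun_apply (?fx x t) v)"
        by (rule blinfun_apply_integral)
      also have "\<dots> = integral {0..1} (\<lambda>t. t ^ Suc m * ?D (?p x t) v)"
        by (rule integral_cong) (simp only: app[OF x])
      finally show "blinfun_apply (integral {0..1} (?fx x)) v = integral {0..1} (\<lambda>t. t ^ Suc m * ?D (?p x t) v)" .
    qed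
    ultimately show "((\<lambda>x. integral {0..1} (\<lambda>t. t ^ m * h (?p x t))) has_derivative
        (\<lambda>v. integral {0..1} (\<lambda>t. t ^ Suc m * ?D (?p x t) v))) (at x)" by simp
  next
    show "higher_differentiable_on S (\<lambda>x. integral {0..1} (\<lambda>t. t ^ Suc m * ?D (?p x t) v)) k" for v
      by (rule Suc.IH) (use Suc.prems in simp)
  qed
qed

text \<open>Integrate the derivative of \<open>F\<close> along the segment from \<open>y\<close> to
  \<open>x\<close> and expand it in the basis: \<open>G b\<close> is the average of the partial
  derivative in direction \<open>b\<close>. Splitting off factors that vanish at \<open>y\<close>
  lets a point derivation be evaluated term by term with the Leibniz rule.\<close>

lemma Hadamard_lemma:
  fixes F :: "'a::euclidean_space \<Rightarrow> real"
  assumes S: "open S" "convex S" "y \<in> S" and F: "smooth_on S F"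
  obtains G where "\<And>b. smooth_on S (G b)"
    and "\<And>x. x \<in> S \<Longrightarrow> F x = F y + (\<Sum>b\<in>Basis. ((x - y) \<bullet> b) * G b x)"
    and "\<And>b. G b y = frechet_derivative F (at y) b"
proof
  let ?D = "\<lambda>x. frechet_derivative F (at x)"
  let ?G = "\<lambda>b x. integral {0..1} (\<lambda>t. ?D (y + t *\<^sub>R (x - y)) b)"
  show "smooth_on S (?G b)" for b
    unfolding smooth_on_def
  proof
    fix k
    have "higher_differentiable_on S (\<lambda>x. ?D x b) k"
      using smooth_on_derivative[OF F] by (simp add: smooth_on_def)
    from higher_differentiable_on_segment_integral[OF S this, of 0]
    show "higher_differentiable_on S (?G b) k" by simp
  qed
  show "?G b y = ?D y b" for b by simp
  fix x assume x: "x \<in> S"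
  let ?p = "\<lambda>t. y + t *\<^sub>R (x - y)"
  have p: "?p t \<in> S" if "t \<in> {0..1}" for t using that S x by (auto intro: convex_segment_point)
  have int: "(\<lambda>t. ((x - y) \<bullet> b) * ?D (?p t) b) integrable_on {0..1}" for b
  proof -
    have "continuous_on {0..1} (\<lambda>t. ?D (?p t) b)"
      by (rule continuous_on_compose2[OF smooth_on_continuous_on[OF smooth_on_derivative[OF F]]])
        (use p in \<open>auto intro!: continuous_intros\<close>)
    then show ?thesis by (intro integrable_continuous_real continuous_on_mult continuous_on_const)
  qed
  have "((\<lambda>t. F (?p t)) has_vector_derivative ?D (?p t) (x - y)) (at t within {0..1})" if "t \<in> {0..1}" for t
  proof -
    have lin: "(?p has_derivative (\<lambda>s. s *\<^sub>R (x - y))) (at t)"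
      by (auto intro!: derivative_eq_intros)
    note D = smooth_on_has_derivative[OF F p[OF that]]
    have "((\<lambda>t. F (?p t)) has_derivative (\<lambda>s. s *\<^sub>R ?D (?p t) (x - y))) (at t)"
      using diff_chain_at[OF lin D] linear_cmul[OF has_derivative_linear[OF D]] by (simp add: o_def)
    then show ?thesis by (auto simp: has_vector_derivative_def intro: has_derivative_at_withinI)
  qed
  then have "((\<lambda>t. ?D (?p t) (x - y)) has_integral F (?p 1) - F (?p 0)) {0..1}"
    by (intro fundamental_theorem_of_calculus) auto
  then have "F x - F y = integral {0..1} (\<lambda>t. ?D (?p t) (x - y))" by (simp add: integral_unique)
  also have "\<dots> = integral {0..1} (\<lambda>t. \<Sum>b\<in>Basis. ((x - y) \<bullet> b) * ?D (?p t) b)"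
  proof (rule integral_cong)
    fix t :: real assume "t \<in> {0..1}"
    note lin = smooth_on_linear_derivative[OF F p[OF this]]
    have "?D (?p t) (\<Sum>b\<in>Basis. (w \<bullet> b) *\<^sub>R b) = (\<Sum>b\<in>Basis. (w \<bullet> b) * ?D (?p t) b)" for w
      by (simp only: linear_sum[OF lin] linear_cmul[OF lin] real_scaleR_def)
    from this[of "x - y"] show "?D (?p t) (x - y) = (\<Sum>b\<in>Basis. ((x - y) \<bullet> b) * ?D (?p t) b)"
      by (subst (asm) euclidean_representation)
  qed
  also have "\<dots> = (\<Sum>b\<in>Basis. ((x - y) \<bullet> b) * ?G b x)"
    by (subst integral_sum) (auto simp: int)
  finally show "F x = F y + (\<Sum>b\<in>Basis. ((x - y) \<bullet> b) * ?G b x)" by simp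
qed

subsection \<open>Bump functions\<close>

text \<open>\<open>flat_exp 0\<close> is the standard function that vanishes to infinite order at 0.
  The powers of \<open>inverse x\<close> make the family closed under differentiation up to linear
  combinations, which is what the proof of smoothness inducts on.\<close>

definition flat_exp :: "nat \<Rightarrow> real \<Rightarrow> real"
  where "flat_exp n x = (if x > 0 then inverse x ^ n * exp (- inverse x) else 0)"

lemma flat_exp_tendsto: "(flat_exp n \<longlongrightarrow> 0) (at_right 0)"
proof -
  have "((\<lambda>x. inverse x ^ n / exp (inverse x)) \<longlongrightarrow> 0) (at_right (0::real))"
    by (rule filterlim_compose[OF tendsto_power_div_exp_0 filterlim_inverse_at_top_right])
  then show ?thesis
    by (rule Lim_transform_eventually)
      (auto simp: flat_exp_def exp_minus field_simps eventually_at_filter)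
qed

lemma flat_exp_has_derivative:
  "(flat_exp n has_real_derivative flat_exp (n + 2) x - n * flat_exp (n + 1) x) (at x)"
proof -
  consider "x > 0" | "x < 0" | "x = 0" by linarith
  then show ?thesis
  proof cases
    case 1
    have p: "((\<lambda>x. inverse x ^ n) has_real_derivative - n * inverse x ^ Suc n) (at x)"
    proof (induction n)
      case (Suc n)
      have i: "(inverse has_real_derivative - (inverse x * inverse x)) (at x)"
        using 1 by (auto intro!: derivative_eq_intros)
      show ?case using DERIV_mult[OF i Suc] by (simp add: algebra_simps)
    qed simp
    have e: "((\<lambda>x. exp (- inverse x)) has_real_derivative exp (- inverse x) * (inverse x * inverse x)) (at x)"
      using 1 by (auto intro!: derivative_eq_intros)
    have "((\<lambda>x. inverse x ^ n * exp (- inverse x)) has_real_derivative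
        flat_exp (n + 2) x - n * flat_exp (n + 1) x) (at x)"
      using DERIV_mult[OF p e] 1 by (simp add: flat_exp_def algebra_simps)
    then show ?thesis
      by (rule has_field_derivative_transform_within_open[where S="{0<..}"]) (use 1 in \<open>auto simp: flat_exp_def\<close>)
  next
    case 2
    have "((\<lambda>x. 0) has_real_derivative flat_exp (n + 2) x - n * flat_exp (n + 1) x) (at x)"
      using 2 by (simp add: flat_exp_def)
    then show ?thesis
      by (rule has_field_derivative_transform_within_open[where S="{..<0}"]) (use 2 in \<open>auto simp: flat_exp_def\<close>)
  next
    case 3
    \<comment> \<open>At 0 the right difference quotient is \<open>flat_exp (Suc n)\<close>, whose
      limit is already known; from the left it is 0.\<close>
    have "((\<lambda>y. (flat_exp n y - flat_exp n 0) / (y - 0)) \<longlongrightarrow> 0) (at_right 0)"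
      by (rule Lim_transform_eventually[OF flat_exp_tendsto[of "Suc n"]])
        (auto simp: flat_exp_def eventually_at_filter field_simps)
    moreover have "((\<lambda>y. (flat_exp n y - flat_exp n 0) / (y - 0)) \<longlongrightarrow> 0) (at_left 0)"
      by (rule Lim_transform_eventually[OF tendsto_const])
        (auto simp: flat_exp_def eventually_at_filter)
    ultimately have "((\<lambda>y. (flat_exp n y - flat_exp n 0) / (y - 0)) \<longlongrightarrow> 0) (at 0)"
      by (simp add: filterlim_split_at)
    then show ?thesis using 3 by (simp add: has_field_derivative_iff flat_exp_def)
  qed
qed

lemma smooth_on_flat_exp: "smooth_on UNIV (flat_exp n)"
proof -
  have "higher_differentiable_on UNIV (flat_exp n) k" for k
  proof (induction k arbitrary: n)
    case 0
    show ?case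
      using DERIV_continuous_on[OF has_field_derivative_at_within[OF flat_exp_has_derivative]] by simp
  next
    case (Suc k)
    have "higher_differentiable_on UNIV (\<lambda>x. c * flat_exp j x) k" for c :: real and j
      by (intro higher_differentiable_on_bilinear[OF open_UNIV bounded_bilinear_mult]
          higher_differentiable_on_const Suc.IH)
    from higher_differentiable_on_add[OF open_UNIV this this]
    have "higher_differentiable_on UNIV (\<lambda>x. v * flat_exp (n + 2) x + (- v * n) * flat_exp (n + 1) x) k"
      for v :: real .
    then have "higher_differentiable_on UNIV (\<lambda>x. (flat_exp (n + 2) x - n * flat_exp (n + 1) x) * v) k"
      for v :: real by (simp add: algebra_simps)
    then show ?case
      by (intro higher_differentiable_on_SucI[OF open_UNIV flat_exp_has_derivative[unfolded has_field_derivative_def]])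
  qed
  then show ?thesis by (simp add: smooth_on_def)
qed

lemma bump_function:
  fixes y :: "'a::euclidean_space"
  assumes "\<rho> > 0"
  obtains \<beta> :: "'a \<Rightarrow> real" where "smooth_on UNIV \<beta>" "\<beta> y = 1" "\<And>x. x \<notin> cball y \<rho> \<Longrightarrow> \<beta> x = 0"
proof
  \<comment> \<open>The squared distance keeps \<open>q\<close> polynomial, hence smooth at the
    centre as well; \<open>q\<close> is positive exactly inside the ball of radius
    \<open>\<rho>\<close>.\<close>
  define q where "q = (\<lambda>x. \<rho>\<^sup>2 + (-1) * ((x - y) \<bullet> (x - y)))"
  let ?\<beta> = "\<lambda>x. (1 / flat_exp 0 (\<rho>\<^sup>2)) * flat_exp 0 (q x)"
  have sub: "smooth_on UNIV (\<lambda>x. - y + x)" by (rule smooth_on_affine) (rule bounded_linear_ident)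
  have "smooth_on UNIV (\<lambda>x. \<rho>\<^sup>2 + (-1) * ((- y + x) \<bullet> (- y + x)))"
    by (intro smooth_on_add smooth_on_const smooth_on_mult open_UNIV
        smooth_on_bilinear[OF _ bounded_bilinear_inner] sub)
  then have "smooth_on UNIV q" by (simp add: q_def)
  then show "smooth_on UNIV ?\<beta>"
    by (intro smooth_on_mult smooth_on_const open_UNIV
        smooth_on_compose[where T=UNIV and f=q and g="flat_exp 0"] smooth_on_flat_exp) auto
  show "?\<beta> y = 1" using assms by (simp add: flat_exp_def q_def)
  show "?\<beta> x = 0" if "x \<notin> cball y \<rho>" for x
  proof -
    have "\<rho> < norm (x - y)" using that by (simp add: dist_norm norm_minus_commute)
    then have "\<rho>\<^sup>2 < (norm (x - y))\<^sup>2" using assms by (simp add: power_strict_mono)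
    then show ?thesis by (simp add: flat_exp_def q_def power2_norm_eq_inner)
  qed
qed

text \<open>Outside the ball of radius \<open>r\<close> the function \<open>f\<close> may be
  arbitrary. Because \<open>\<rho> < r\<close>, that ball and the complement of the smaller closed
  ball, where the product is 0, form an open cover of the space.\<close>

lemma smooth_on_bump_extension:
  assumes "smooth_on UNIV \<beta>" "smooth_on (ball y r) f" "\<And>x. x \<notin> cball y \<rho> \<Longrightarrow> \<beta> x = 0" "\<rho> < r"
  shows "smooth_on UNIV (\<lambda>x. (\<beta> x :: real) *\<^sub>R f x)"
proof -
  have "smooth_on (- cball y \<rho>) (\<lambda>x. \<beta> x *\<^sub>R f x)"
    by (rule smooth_on_cong[OF _ _ smooth_on_const[of _ 0]]) (use assms in auto)
  moreover have "smooth_on (ball y r) (\<lambda>x. \<beta> x *\<^sub>R f x)"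
    by (intro smooth_on_scaleR open_ball smooth_on_subset[OF assms(1)] assms(2)) simp
  ultimately have "smooth_on (- cball y \<rho> \<union> ball y r) (\<lambda>x. \<beta> x *\<^sub>R f x)"
    by (intro smooth_on_Un) auto
  moreover have "- cball y \<rho> \<union> ball y r = UNIV" using assms(4) by auto
  ultimately show ?thesis by simp
qed

section \<open>Smooth atlases\<close>

lemma is_chartD:
  assumes "is_chart T (U, c)"
  shows "openin T U" "open (c ` U)" "inj_on c U" "continuous_map (subtopology T U) euclidean c"
    "U \<subseteq> topspace T"
proof -
  have h: "openin T U" "open (c ` U)" "homeomorphic_map (subtopology T U) (top_of_set (c ` U)) c"
    using assms by (auto simp: is_chart_def)
  then show "openin T U" "open (c ` U)" "U \<subseteq> topspace T" by (auto dest: openin_subset)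
  then have U: "topspace (subtopology T U) = U" by (auto simp: topspace_subtopology)
  show "inj_on c U" using homeomorphic_imp_injective_map[OF h(3)] U by simp
  show "continuous_map (subtopology T U) euclidean c"
    using homeomorphic_imp_continuous_map[OF h(3)] by (simp add: continuous_map_in_subtopology)
qed

lemma chart_open_image:
  assumes "is_chart T (U, c)" "openin T N"
  shows "open (c ` (U \<inter> N))"
proof -
  have h: "homeomorphic_map (subtopology T U) (top_of_set (c ` U)) c"
    using assms by (auto simp: is_chart_def)
  have "openin (subtopology T U) (U \<inter> N)"
    using assms(2) by (auto simp: openin_subtopology)
  then have "openin (top_of_set (c ` U)) (c ` (U \<inter> N))"
    using homeomorphic_imp_open_map[OF h] by (auto simp: open_map_def)
  then show ?thesis using is_chartD(2)[OF assms(1)] openin_open_trans by blast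
qed

lemma openin_Int_vimage:
  "continuous_map T T' F \<Longrightarrow> openin T' V \<Longrightarrow> openin T U \<Longrightarrow> openin T (U \<inter> F -` V)"
proof -
  assume a: "continuous_map T T' F" "openin T' V" "openin T U"
  have "U \<inter> F -` V = U \<inter> {x \<in> topspace T. F x \<in> V}" using openin_subset[OF a(3)] by auto
  then show ?thesis using a openin_continuous_map_preimage[OF a(1,2)] by auto
qed

lemma chart_open_vimage:
  assumes "is_chart T (U, c)" "open V"
  shows "openin T (U \<inter> c -` V)"
proof -
  have "openin (subtopology T U) (U \<inter> c -` V)"
    using openin_Int_vimage[OF is_chartD(4)[OF assms(1)], of V U] assms is_chartD(1,5)[OF assms(1)]
    by (simp add: openin_open_subtopology)
  then show ?thesis using is_chartD(1)[OF assms(1)] by (auto simp: openin_open_subtopology)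
qed

text \<open>The chart axioms of \<open>smooth_manifold\<close> alone. They suffice for the calculus
  of maps and pass directly to products and Euclidean spaces; Hausdorffness is required separately
  where functions are extended by 0.\<close>

definition smooth_atlas :: "'a topology \<Rightarrow> ('a, 'e::euclidean_space) atlas \<Rightarrow> bool"
  where "smooth_atlas T A \<longleftrightarrow> (\<forall>C\<in>A. is_chart T C) \<and> (\<Union>(U, c)\<in>A. U) = topspace T \<and>
    (\<forall>(U, c)\<in>A. \<forall>(V, d)\<in>A. smooth_on (c ` (U \<inter> V)) (d \<circ> inv_into U c))"

lemma smooth_atlas_chart: "smooth_atlas T A \<Longrightarrow> (U, c) \<in> A \<Longrightarrow> is_chart T (U, c)"
  by (auto simp: smooth_atlas_def)

lemmas atlas_chartD = is_chartD[OF smooth_atlas_chart]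
lemmas atlas_open_image = chart_open_image[OF smooth_atlas_chart]

lemma smooth_atlas_cover:
  assumes "smooth_atlas T A" "p \<in> topspace T"
  obtains U c where "(U, c) \<in> A" "p \<in> U"
proof -
  have "p \<in> (\<Union>(U, c)\<in>A. U)" using assms by (simp add: smooth_atlas_def)
  then obtain C where "C \<in> A" "p \<in> fst C" by (auto simp: case_prod_unfold)
  then show ?thesis using that[of "fst C" "snd C"] by simp
qed

lemma smooth_atlas_transition:
  "smooth_atlas T A \<Longrightarrow> (U, c) \<in> A \<Longrightarrow> (V, d) \<in> A \<Longrightarrow> smooth_on (c ` (U \<inter> V)) (\<lambda>x. d (inv_into U c x))"
  by (fastforce simp: smooth_atlas_def o_def)

lemma smooth_manifold_atlas: "smooth_manifold T A \<Longrightarrow> smooth_atlas T A"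
  by (simp add: smooth_manifold_def smooth_atlas_def)

section \<open>Smooth maps between manifolds\<close>

lemma smooth_mapD:
  assumes "smooth_map T A T' A' F"
  shows "continuous_map T T' F"
    "(U, c) \<in> A \<Longrightarrow> (V, d) \<in> A' \<Longrightarrow> smooth_on (c ` (U \<inter> F -` V)) (\<lambda>x. d (F (inv_into U c x)))"
  using assms by (fastforce simp: smooth_map_def o_def)+

lemma smooth_mapI:
  assumes "continuous_map T T' F"
    "\<And>U c V d. (U, c) \<in> A \<Longrightarrow> (V, d) \<in> A' \<Longrightarrow> smooth_on (c ` (U \<inter> F -` V)) (\<lambda>x. d (F (inv_into U c x)))"
  shows "smooth_map T A T' A' F"
  using assms by (auto simp: smooth_map_def o_def)

text \<open>The coordinate expression factors through an intermediate chart only near a given point,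
  on the part that \<open>F\<close> sends into \<open>V\<close> and \<open>G\<close> then sends into
  \<open>W\<close>; smoothness is therefore proved locally.\<close>

lemma smooth_map_compose:
  assumes A: "smooth_atlas T A" and A': "smooth_atlas T' A'" and A'': "smooth_atlas T'' A''"
    and F: "smooth_map T A T' A' F" and G: "smooth_map T' A' T'' A'' G"
  shows "smooth_map T A T'' A'' (\<lambda>p. G (F p))"
proof (rule smooth_mapI)
  show "continuous_map T T'' (\<lambda>p. G (F p))"
    using continuous_map_compose[OF smooth_mapD(1)[OF F] smooth_mapD(1)[OF G]] by (simp add: o_def)
  fix U c W w assume c: "(U, c) \<in> A" and w: "(W, w) \<in> A''"
  note cU = atlas_chartD[OF A c]
  show "smooth_on (c ` (U \<inter> (\<lambda>p. G (F p)) -` W)) (\<lambda>x. w (G (F (inv_into U c x))))"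
  proof (rule smooth_on_local)
    fix x assume "x \<in> c ` (U \<inter> (\<lambda>p. G (F p)) -` W)"
    then obtain p where p: "p \<in> U" "G (F p) \<in> W" "x = c p" by auto
    have "F p \<in> topspace T'"
      using p cU(5) continuous_map_funspace[OF smooth_mapD(1)[OF F]] by auto
    then obtain V d where d: "(V, d) \<in> A'" "F p \<in> V" using smooth_atlas_cover[OF A'] by blast
    note dV = atlas_chartD[OF A' d(1)]
    let ?V = "V \<inter> G -` W" and ?f = "\<lambda>x. d (F (inv_into U c x))" and ?g = "\<lambda>y. w (G (inv_into V d y))"
    have V: "openin T' ?V"
      by (rule openin_Int_vimage[OF smooth_mapD(1)[OF G] atlas_chartD(1)[OF A'' w] dV(1)])
    let ?N = "c ` (U \<inter> F -` ?V)"
    have "c ` (U \<inter> (U \<inter> F -` ?V)) = ?N" by auto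
    then have N: "open ?N"
      using atlas_open_image[OF A c
          openin_Int_vimage[OF smooth_mapD(1)[OF F] V cU(1)]] by simp
    have "d ` (V \<inter> ?V) = d ` ?V" by (rule arg_cong[where f="image d"]) auto
    then have dopen: "open (d ` ?V)" using atlas_open_image[OF A' d(1) V] by simp
    have "smooth_on ?N (\<lambda>x. ?g (?f x))"
    proof (rule smooth_on_compose[OF N dopen, where f="?f" and g="?g"])
      show "?f ` ?N \<subseteq> d ` ?V" using cU(3) by (auto simp: inv_into_f_f)
      show "smooth_on (d ` ?V) ?g" by (rule smooth_mapD(2)[OF G d(1) w])
      show "smooth_on ?N ?f" by (rule smooth_on_subset[OF smooth_mapD(2)[OF F c d(1)]]) auto
    qed
    then have "smooth_on ?N (\<lambda>x. w (G (F (inv_into U c x))))"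
      by (rule smooth_on_cong[OF N, rotated]) (use cU(3) dV(3) in \<open>auto simp: inv_into_f_f\<close>)
    moreover have "x \<in> ?N" using p d by auto
    ultimately show "\<exists>N. open N \<and> x \<in> N \<and> smooth_on N (\<lambda>x. w (G (F (inv_into U c x))))"
      using N by blast
  qed
qed

lemma smooth_map_ident: "smooth_atlas T A \<Longrightarrow> smooth_map T A T A (\<lambda>p. p)"
  by (rule smooth_mapI) (auto simp: vimage_def smooth_atlas_transition)

lemma smooth_map_const: "q \<in> topspace T' \<Longrightarrow> smooth_map T A T' A' (\<lambda>p. q)"
  by (rule smooth_mapI) (auto simp: smooth_on_const)

section \<open>Products of manifolds\<close>

lemma prod_atlasE:
  assumes "C \<in> prod_atlas A B"
  obtains U c V d where "C = (U \<times> V, map_prod c d)" "(U, c) \<in> A" "(V, d) \<in> B"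
  using assms by (auto simp: prod_atlas_def)

lemma smooth_map_Pair:
  assumes A: "smooth_atlas T A" and A1: "smooth_atlas T1 A1" and A2: "smooth_atlas T2 A2"
    and F: "smooth_map T A T1 A1 F" and G: "smooth_map T A T2 A2 G"
  shows "smooth_map T A (prod_topology T1 T2) (prod_atlas A1 A2) (\<lambda>p. (F p, G p))"
proof (rule smooth_mapI)
  show "continuous_map T (prod_topology T1 T2) (\<lambda>p. (F p, G p))"
    using smooth_mapD(1)[OF F] smooth_mapD(1)[OF G] by (simp add: continuous_map_pairedI)
  fix U c W w assume c: "(U, c) \<in> A" and "(W, w) \<in> prod_atlas A1 A2"
  then obtain V d V' d' where w: "W = V \<times> V'" "w = map_prod d d'" "(V, d) \<in> A1" "(V', d') \<in> A2"
    by (auto elim: prod_atlasE)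
  have eq: "U \<inter> (\<lambda>p. (F p, G p)) -` W = (U \<inter> F -` V) \<inter> (U \<inter> G -` V')" using w by auto
  have "openin T ((U \<inter> F -` V) \<inter> (U \<inter> G -` V'))"
    by (intro openin_Int openin_Int_vimage[OF smooth_mapD(1)[OF F]] openin_Int_vimage[OF smooth_mapD(1)[OF G]]
        atlas_chartD(1)[OF A c] atlas_chartD(1)[OF A1 w(3)]
        atlas_chartD(1)[OF A2 w(4)])
  from atlas_open_image[OF A c this]
  have "open (c ` (U \<inter> (\<lambda>p. (F p, G p)) -` W))" unfolding eq by (simp add: Int_absorb1 inf_assoc)
  from smooth_on_Pair[OF this smooth_on_subset[OF smooth_mapD(2)[OF F c w(3)]]
      smooth_on_subset[OF smooth_mapD(2)[OF G c w(4)]]]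
  show "smooth_on (c ` (U \<inter> (\<lambda>p. (F p, G p)) -` W)) (\<lambda>x. w (F (inv_into U c x), G (inv_into U c x)))"
    unfolding w by auto
qed

lemma inv_into_map_prod:
  assumes "inj_on c U" "inj_on d V" "x \<in> c ` U" "y \<in> d ` V"
  shows "inv_into (U \<times> V) (map_prod c d) (x, y) = (inv_into U c x, inv_into V d y)"
proof -
  have "inj_on (map_prod c d) (U \<times> V)" using assms(1,2) by (rule map_prod_inj_on)
  then have "inv_into (U \<times> V) (map_prod c d) (map_prod c d (inv_into U c x, inv_into V d y)) =
      (inv_into U c x, inv_into V d y)"
    by (rule inv_into_f_f) (use assms(3,4) in \<open>auto intro: inv_into_into\<close>)
  then show ?thesis using assms(3,4) by (simp add: f_inv_into_f)
qed

lemma is_chart_prod: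
  assumes "is_chart T (U, c)" "is_chart T' (V, d)"
  shows "is_chart (prod_topology T T') (U \<times> V, map_prod c d)"
proof -
  have h: "homeomorphic_map (subtopology T U) (top_of_set (c ` U)) c"
    "homeomorphic_map (subtopology T' V) (top_of_set (d ` V)) d"
    using assms by (auto simp: is_chart_def)
  then obtain c' d' where "homeomorphic_maps (subtopology T U) (top_of_set (c ` U)) c c'"
    "homeomorphic_maps (subtopology T' V) (top_of_set (d ` V)) d d'"
    by (auto simp: homeomorphic_map_maps)
  then have "homeomorphic_maps (prod_topology (subtopology T U) (subtopology T' V))
      (prod_topology (top_of_set (c ` U)) (top_of_set (d ` V))) (\<lambda>(x, y). (c x, d y)) (\<lambda>(x, y). (c' x, d' y))"
    by (subst homeomorphic_maps_prod) simp
  then have "homeomorphic_map (prod_topology (subtopology T U) (subtopology T' V))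
      (prod_topology (top_of_set (c ` U)) (top_of_set (d ` V))) (\<lambda>(x, y). (c x, d y))"
    by (auto simp: homeomorphic_map_maps)
  then have "homeomorphic_map (subtopology (prod_topology T T') (U \<times> V))
      (top_of_set (c ` U \<times> d ` V)) (map_prod c d)"
    by (simp add: subtopology_Times map_prod_def flip: euclidean_product_topology)
  moreover have "map_prod c d ` (U \<times> V) = c ` U \<times> d ` V" by auto
  ultimately show ?thesis
    using is_chartD(1,2)[OF assms(1)] is_chartD(1,2)[OF assms(2)]
    by (simp add: is_chart_def open_Times openin_prod_Times_iff)
qed

lemma smooth_map_fst_snd:
  assumes A: "smooth_atlas T A" and B: "smooth_atlas T' B"
  shows "smooth_map (prod_topology T T') (prod_atlas A B) T A fst"
    and "smooth_map (prod_topology T T') (prod_atlas A B) T' B snd"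
proof -
  show "smooth_map (prod_topology T T') (prod_atlas A B) T A fst"
  proof (rule smooth_mapI)
    fix W w U' c' assume "(W, w) \<in> prod_atlas A B" and c': "(U', c') \<in> A"
    then obtain U c V d where w: "W = U \<times> V" "w = map_prod c d" and c: "(U, c) \<in> A" and d: "(V, d) \<in> B"
      by (auto elim: prod_atlasE)
    note cU = atlas_chartD[OF A c] and dV = atlas_chartD[OF B d]
    have eq: "w ` (W \<inter> fst -` U') = c ` (U \<inter> U') \<times> d ` V" using w by auto
    have op: "open (c ` (U \<inter> U'))" "open (c ` (U \<inter> U') \<times> d ` V)"
      using atlas_open_image[OF A c atlas_chartD(1)[OF A c']]
        dV(2) by (auto intro: open_Times)
    have "smooth_on (c ` (U \<inter> U') \<times> d ` V) (\<lambda>z. c' (inv_into U c (fst z)))"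
      by (rule smooth_on_compose[OF op(2,1), where f=fst and g="\<lambda>x. c' (inv_into U c x)"])
        (auto intro: smooth_atlas_transition[OF A c c'] smooth_on_linear bounded_linear_fst)
    then have "smooth_on (c ` (U \<inter> U') \<times> d ` V) (\<lambda>z. c' (fst (inv_into (U \<times> V) (map_prod c d) z)))"
      by (rule smooth_on_cong[OF op(2), rotated]) (auto simp: inv_into_map_prod[OF cU(3) dV(3)])
    then show "smooth_on (w ` (W \<inter> fst -` U')) (\<lambda>x. c' (fst (inv_into W w x)))"
      unfolding eq by (simp add: w)
  qed (rule continuous_map_fst)
  show "smooth_map (prod_topology T T') (prod_atlas A B) T' B snd"
  proof (rule smooth_mapI)
    fix W w V' d' assume "(W, w) \<in> prod_atlas A B" and d': "(V', d') \<in> B"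
    then obtain U c V d where w: "W = U \<times> V" "w = map_prod c d" and c: "(U, c) \<in> A" and d: "(V, d) \<in> B"
      by (auto elim: prod_atlasE)
    note cU = atlas_chartD[OF A c] and dV = atlas_chartD[OF B d]
    have eq: "w ` (W \<inter> snd -` V') = c ` U \<times> d ` (V \<inter> V')" using w by auto
    have op: "open (d ` (V \<inter> V'))" "open (c ` U \<times> d ` (V \<inter> V'))"
      using atlas_open_image[OF B d atlas_chartD(1)[OF B d']]
        cU(2) by (auto intro: open_Times)
    have "smooth_on (c ` U \<times> d ` (V \<inter> V')) (\<lambda>z. d' (inv_into V d (snd z)))"
      by (rule smooth_on_compose[OF op(2,1), where f=snd and g="\<lambda>x. d' (inv_into V d x)"])
        (auto intro: smooth_atlas_transition[OF B d d'] smooth_on_linear bounded_linear_snd)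
    then have "smooth_on (c ` U \<times> d ` (V \<inter> V')) (\<lambda>z. d' (snd (inv_into (U \<times> V) (map_prod c d) z)))"
      by (rule smooth_on_cong[OF op(2), rotated]) (auto simp: inv_into_map_prod[OF cU(3) dV(3)])
    then show "smooth_on (w ` (W \<inter> snd -` V')) (\<lambda>x. d' (snd (inv_into W w x)))"
      unfolding eq by (simp add: w)
  qed (rule continuous_map_snd)
qed

lemma smooth_atlas_prod:
  assumes A: "smooth_atlas T A" and B: "smooth_atlas T' B"
  shows "smooth_atlas (prod_topology T T') (prod_atlas A B)"
  unfolding smooth_atlas_def
proof (intro conjI ballI)
  show "is_chart (prod_topology T T') C" if "C \<in> prod_atlas A B" for C
    using that by (auto elim!: prod_atlasE intro!: is_chart_prod smooth_atlas_chart[OF A] smooth_atlas_chart[OF B])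
  have "(\<Union>(U, c)\<in>prod_atlas A B. U) = (\<Union>(U, c)\<in>A. U) \<times> (\<Union>(V, d)\<in>B. V)"
    by (auto simp: prod_atlas_def) blast
  then show "(\<Union>(U, c)\<in>prod_atlas A B. U) = topspace (prod_topology T T')"
    using A B by (simp add: smooth_atlas_def)
  fix C assume C_in: "C \<in> prod_atlas A B"
  have "case C' of (V, d) \<Rightarrow> smooth_on (snd C ` (fst C \<inter> V)) (d \<circ> inv_into (fst C) (snd C))"
    if "C' \<in> prod_atlas A B" for C'
  proof -
    from C_in that obtain U c V d U' c' V' d' where C: "C = (U \<times> V, map_prod c d)" "C' = (U' \<times> V', map_prod c' d')"
      and c: "(U, c) \<in> A" and d: "(V, d) \<in> B" and c': "(U', c') \<in> A" and d': "(V', d') \<in> B"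
      by (auto elim!: prod_atlasE)
    have W: "(U \<times> V, map_prod c d) \<in> prod_atlas A B" using c d by (auto simp: prod_atlas_def)
    note cU = atlas_chartD[OF A c] and dV = atlas_chartD[OF B d]
    have eq: "map_prod c d ` (U \<times> V \<inter> U' \<times> V') = c ` (U \<inter> U') \<times> d ` (V \<inter> V')" by auto
    have op: "open (c ` (U \<inter> U') \<times> d ` (V \<inter> V'))"
      by (intro open_Times atlas_open_image[OF A c]
          atlas_open_image[OF B d]
          atlas_chartD(1)[OF A c'] atlas_chartD(1)[OF B d'])
    have "smooth_on (c ` (U \<inter> U') \<times> d ` (V \<inter> V')) (\<lambda>z. (c' (fst (inv_into (U \<times> V) (map_prod c d) z)),
        d' (snd (inv_into (U \<times> V) (map_prod c d) z))))"
      by (rule smooth_on_Pair[OF op smooth_on_subset[OF smooth_mapD(2)[OF smooth_map_fst_snd(1)[OF A B] W c']]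
          smooth_on_subset[OF smooth_mapD(2)[OF smooth_map_fst_snd(2)[OF A B] W d']]]) auto
    moreover have "map_prod c' d' \<circ> inv_into (U \<times> V) (map_prod c d) =
        (\<lambda>z. (c' (fst (inv_into (U \<times> V) (map_prod c d) z)), d' (snd (inv_into (U \<times> V) (map_prod c d) z))))"
      by (auto simp: fun_eq_iff map_prod_def split_beta)
    ultimately show ?thesis by (simp only: C prod.case eq fst_conv snd_conv)
  qed
  then show "case C of (U, c) \<Rightarrow> \<forall>(V, d)\<in>prod_atlas A B. smooth_on (c ` (U \<inter> V)) (d \<circ> inv_into U c)"
    by (simp add: case_prod_unfold)
qed

lemma inv_into_UNIV_id [simp]: "inv_into UNIV (\<lambda>x. x) = (\<lambda>x. x)" "inv_into UNIV id = (\<lambda>x. x)"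
  by (auto simp: fun_eq_iff inv_into_def)

lemma smooth_atlas_euclidean: "smooth_atlas (euclidean :: 'e::euclidean_space topology) {(UNIV, id)}"
proof -
  have "homeomorphic_map euclidean euclidean (\<lambda>x::'e. x)" using homeomorphic_map_id[of euclidean euclidean] by (simp add: id_def)
  then show ?thesis
    using smooth_on_linear[OF bounded_linear_ident]
    by (simp add: smooth_atlas_def is_chart_def id_def o_def)
qed

subsection \<open>Smooth functions with values in a Euclidean space\<close>

text \<open>Values in an arbitrary Euclidean space are allowed because \<open>Ad p u\<close> and
  global coordinates are vector valued; \<open>smooth_functions\<close> is the real case.\<close>

abbreviation smooth_fun :: "'a topology \<Rightarrow> ('a, 'e::euclidean_space) atlas \<Rightarrow> ('a \<Rightarrow> 'b::euclidean_space) \<Rightarrow> bool"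
  where "smooth_fun T A f \<equiv> smooth_map T A euclidean {(UNIV, id)} f"

lemma smooth_functions_iff: "f \<in> smooth_functions T A \<longleftrightarrow> smooth_fun T A f"
  by (simp add: smooth_functions_def real_atlas_def)

lemma smooth_funD:
  "smooth_fun T A f \<Longrightarrow> (U, c) \<in> A \<Longrightarrow> smooth_on (c ` U) (\<lambda>x. f (inv_into U c x))"
  using smooth_mapD(2)[where V=UNIV and d=id and A'="{(UNIV, id)}"] by fastforce

text \<open>Continuity, which is part of \<open>smooth_map\<close>, is recovered from the charts by
  pasting, so only coordinate expressions have to be checked.\<close>

lemma smooth_funI:
  assumes A: "smooth_atlas T A" and f: "\<And>U c. (U, c) \<in> A \<Longrightarrow> smooth_on (c ` U) (\<lambda>x. f (inv_into U c x))"
  shows "smooth_fun T A f"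
proof (rule smooth_mapI)
  show "smooth_on (c ` (U \<inter> f -` V)) (\<lambda>x. d (f (inv_into U c x)))"
    if "(U, c) \<in> A" "(V, d) \<in> {(UNIV, id)}" for U c V d
    using f[OF that(1)] that by (auto intro: smooth_on_subset)
  show "continuous_map T euclidean f"
  proof (rule pasting_lemma[where I=A and T=fst and f="\<lambda>_. f"])
    show "openin T (fst C)" if "C \<in> A" for C
      using atlas_chartD(1)[OF A] that by (metis prod.collapse)
    show "continuous_map (subtopology T (fst C)) euclidean f" if C: "C \<in> A" for C
    proof -
      obtain U c where Uc: "C = (U, c)" by (cases C)
      then have c: "(U, c) \<in> A" using C by simp
      note cU = atlas_chartD[OF A c]
      have "continuous_map (subtopology T U) (top_of_set (c ` U)) c"
        using cU(4) by (auto simp: continuous_map_in_subtopology)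
      moreover have "continuous_map (top_of_set (c ` U)) euclidean (\<lambda>x. f (inv_into U c x))"
        using smooth_on_continuous_on[OF f[OF c]] by simp
      ultimately have "continuous_map (subtopology T U) euclidean ((\<lambda>x. f (inv_into U c x)) \<circ> c)"
        by (rule continuous_map_compose)
      then have "continuous_map (subtopology T U) euclidean f"
        by (rule continuous_map_eq) (use cU(3) in \<open>auto simp: inv_into_f_f\<close>)
      then show ?thesis by (simp add: Uc)
    qed
    show "\<exists>j. j \<in> A \<and> x \<in> fst j \<and> f x = f x" if x: "x \<in> topspace T" for x
    proof -
      obtain U c where "(U, c) \<in> A" "x \<in> U" using smooth_atlas_cover[OF A x] by blast
      then show ?thesis by (intro exI[of _ "(U, c)"]) simp
    qed
  qed simp
qed

lemma smooth_fun_bilinear: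
  assumes "smooth_atlas T A" "bounded_bilinear B" "smooth_fun T A f" "smooth_fun T A g"
  shows "smooth_fun T A (\<lambda>p. B (f p) (g p))"
  by (rule smooth_funI[OF assms(1)], rule smooth_on_bilinear[OF _ assms(2)])
    (auto intro: smooth_funD assms atlas_chartD(2)[OF assms(1)])

lemma smooth_fun_linear:
  assumes "smooth_atlas T A" "bounded_linear L" "smooth_fun T A f"
  shows "smooth_fun T A (\<lambda>p. L (f p))"
  by (rule smooth_funI[OF assms(1)], rule smooth_on_linear_compose[OF _ assms(2)])
    (auto intro: smooth_funD assms atlas_chartD(2)[OF assms(1)])

lemma smooth_fun_sum:
  assumes "smooth_atlas T A" "\<And>i. i \<in> I \<Longrightarrow> smooth_fun T A (f i)"
  shows "smooth_fun T A (\<lambda>p. \<Sum>i\<in>I. f i p)"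
  by (rule smooth_funI[OF assms(1)], rule smooth_on_sum)
    (auto intro: smooth_funD assms atlas_chartD(2)[OF assms(1)])

lemma smooth_fun_const: "smooth_fun T A (\<lambda>p. k)"
  by (rule smooth_map_const) simp

lemma smooth_fun_add:
  assumes "smooth_atlas T A" "smooth_fun T A f" "smooth_fun T A g"
  shows "smooth_fun T A (\<lambda>p. f p + g p)"
  by (rule smooth_funI[OF assms(1)], rule smooth_on_add)
    (auto intro: smooth_funD assms atlas_chartD(2)[OF assms(1)])

lemma smooth_fun_cong:
  assumes A: "smooth_atlas T A" and f: "smooth_fun T A f" and eq: "\<And>p. p \<in> topspace T \<Longrightarrow> f p = g p"
  shows "smooth_fun T A g"
proof (rule smooth_funI[OF A])
  fix U c assume c: "(U, c) \<in> A"
  note cU = atlas_chartD[OF A c]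
  show "smooth_on (c ` U) (\<lambda>x. g (inv_into U c x))"
    by (rule smooth_on_cong[OF cU(2) _ smooth_funD[OF f c]]) (use cU(3,5) eq in \<open>auto simp: inv_into_f_f\<close>)
qed

text \<open>Hausdorffness enters because the compact set \<open>K\<close>, transported to the manifold, must be closed
  for the extension by \<open>0\<close> to be smooth.\<close>

lemma smooth_fun_chart_extension:
  assumes A: "smooth_atlas T A" and H: "Hausdorff_space T" and c: "(U, c) \<in> A"
    and F: "smooth_on UNIV F" and K: "compact K" "K \<subseteq> c ` U" and zero: "\<And>x. x \<notin> K \<Longrightarrow> F x = 0"
  shows "smooth_fun T A (\<lambda>p. if p \<in> U then F (c p) else 0)" (is "smooth_fun T A ?f")
proof (rule smooth_funI[OF A])
  note ch = smooth_atlas_chart[OF A c]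
  note cU = is_chartD[OF ch]
  fix V d assume d: "(V, d) \<in> A"
  note dV = atlas_chartD[OF A d]
  let ?K = "inv_into U c ` K"
  have hom: "homeomorphic_map (subtopology T U) (top_of_set (c ` U)) c"
    using ch by (auto simp: is_chart_def)
  then obtain c' where c': "homeomorphic_maps (subtopology T U) (top_of_set (c ` U)) c c'"
    by (auto simp: homeomorphic_map_maps)
  have c'eq: "c' x = inv_into U c x" if "x \<in> c ` U" for x
  proof -
    have "c' x \<in> U" "c (c' x) = x"
      using c' that cU(5) by (auto simp: homeomorphic_maps_def continuous_map_def topspace_subtopology)
    then show ?thesis using cU(3) by (metis inv_into_f_f)
  qed
  have "compactin (top_of_set (c ` U)) K" using K by (simp add: compactin_subtopology)
  then have "compactin (subtopology T U) (c' ` K)"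
    using c' image_compactin by (auto simp: homeomorphic_maps_def)
  then have "compactin T ?K" using c'eq K(2) by (simp add: compactin_subtopology subset_iff cong: image_cong)
  then have closed: "closedin T ?K" using H compactin_imp_closedin by blast
  have VK: "openin T (V - ?K)" using dV(1) closed by (rule openin_diff)
  have "smooth_on (d ` (V \<inter> U)) (\<lambda>x. F (c (inv_into V d x)))"
    by (rule smooth_on_compose[OF atlas_open_image[OF A d cU(1)] open_UNIV,
        where f="\<lambda>x. c (inv_into V d x)" and g=F])
      (auto intro: smooth_atlas_transition[OF A d c] F)
  then have 1: "smooth_on (d ` (V \<inter> U)) (\<lambda>x. ?f (inv_into V d x))"
    by (rule smooth_on_cong[OF atlas_open_image[OF A d cU(1)], rotated])
      (use dV(3) in \<open>auto simp: inv_into_f_f\<close>)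
  have op: "open (d ` (V - ?K))"
    using atlas_open_image[OF A d VK] by (simp add: Int_Diff Int_absorb1 Int_absorb2)
  have 2: "smooth_on (d ` (V - ?K)) (\<lambda>x. ?f (inv_into V d x))"
  proof (rule smooth_on_cong[OF op _ smooth_on_const[of _ 0]])
    fix x assume "x \<in> d ` (V - ?K)"
    then obtain p where p: "p \<in> V" "p \<notin> ?K" "x = d p" by auto
    have "c p \<notin> K" if "p \<in> U"
    proof
      assume "c p \<in> K"
      then have "inv_into U c (c p) \<in> ?K" by blast
      then show False using p that cU(3) by (simp add: inv_into_f_f)
    qed
    then show "0 = ?f (inv_into V d x)" using p dV(3) by (simp add: inv_into_f_f zero)
  qed
  have "?K \<subseteq> U" using K(2) by (auto intro: inv_into_into)
  then have "V = (V \<inter> U) \<union> (V - ?K)" by auto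
  then have "d ` V = d ` (V \<inter> U) \<union> d ` (V - ?K)" by (metis image_Un)
  then show "smooth_on (d ` V) (\<lambda>x. ?f (inv_into V d x))"
    using smooth_on_Un[OF atlas_open_image[OF A d cU(1)] op 1 2] by simp
qed

section \<open>Derivatives at a point of a manifold\<close>

lemma linear_basis_expansion:
  assumes "linear L"
  shows "L u = (\<Sum>b\<in>Basis. (u \<bullet> b) *\<^sub>R L b)"
proof -
  have "L (\<Sum>b\<in>Basis. (u \<bullet> b) *\<^sub>R b) = (\<Sum>b\<in>Basis. (u \<bullet> b) *\<^sub>R L b)"
    by (simp only: linear_sum[OF assms] linear_cmul[OF assms])
  then show ?thesis by (subst (asm) euclidean_representation)
qed

lemma frechet_derivative_slice:
  assumes F: "smooth_on (S \<times> S') F" and x: "x \<in> S" "y \<in> S'"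
  shows "frechet_derivative (\<lambda>y. F (x, y)) (at y) v = frechet_derivative F (at (x, y)) (0, v)"
    and "frechet_derivative (\<lambda>x. F (x, y)) (at x) u = frechet_derivative F (at (x, y)) (u, 0)"
proof -
  have D: "(F has_derivative frechet_derivative F (at (x, y))) (at (x, y))"
    using smooth_on_has_derivative[OF F] x by simp
  have "((\<lambda>y. (x, y)) has_derivative (\<lambda>v. (0, v))) (at y)" by (auto intro!: derivative_eq_intros)
  from frechet_derivative_at[OF diff_chain_at[OF this D]]
  show "frechet_derivative (\<lambda>y. F (x, y)) (at y) v = frechet_derivative F (at (x, y)) (0, v)"
    unfolding o_def by (rule fun_cong[OF sym])
  have "((\<lambda>x. (x, y)) has_derivative (\<lambda>u. (u, 0))) (at x)" by (auto intro!: derivative_eq_intros)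
  from frechet_derivative_at[OF diff_chain_at[OF this D]]
  show "frechet_derivative (\<lambda>x. F (x, y)) (at x) u = frechet_derivative F (at (x, y)) (u, 0)"
    unfolding o_def by (rule fun_cong[OF sym])
qed

locale pointed_chart =
  fixes T :: "'a topology" and A :: "('a, 'e::euclidean_space) atlas"
    and U :: "'a set" and c :: "'a \<Rightarrow> 'e" and p :: 'a
  assumes atlas: "smooth_atlas T A" and chart: "(U, c) \<in> A" and base: "p \<in> U"
begin

text \<open>The chart identifies the tangent space at \<open>p\<close> with the model space:
  \<open>deriv f u\<close> is the action on \<open>f\<close> of the tangent vector with coordinates
  \<open>u\<close>. Letting \<open>f\<close> be vector valued makes differentials of maps instances
  of it.\<close>

definition deriv :: "('a \<Rightarrow> 'b::euclidean_space) \<Rightarrow> 'e \<Rightarrow> 'b"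
  where "deriv f u = frechet_derivative (\<lambda>x. f (inv_into U c x)) (at (c p)) u"

lemmas chartD = atlas_chartD[OF atlas chart]

lemma base_topspace: "p \<in> topspace T" using base chartD(5) by blast

lemma has_deriv:
  "smooth_fun T A f \<Longrightarrow> ((\<lambda>x. f (inv_into U c x)) has_derivative deriv f) (at (c p))"
  unfolding deriv_def[abs_def] using smooth_on_has_derivative[OF smooth_funD[OF _ chart]] base by blast

lemma deriv_linear: "smooth_fun T A f \<Longrightarrow> linear (deriv f)"
  using has_deriv has_derivative_linear by blast

lemma derivI: "((\<lambda>x. f (inv_into U c x)) has_derivative f') (at (c p)) \<Longrightarrow> deriv f = f'"
  unfolding deriv_def[abs_def] using frechet_derivative_at by metis

text \<open>Agreement on the chart domain is enough, so identities valid only on the group carrier,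
  such as associativity, may be used under \<open>deriv\<close>.\<close>

lemma deriv_cong:
  assumes f: "smooth_fun T A f" and eq: "\<And>q. q \<in> U \<Longrightarrow> f q = g q"
  shows "deriv f = deriv g"
proof -
  have "((\<lambda>x. g (inv_into U c x)) has_derivative deriv f) (at (c p))"
    by (rule has_derivative_transform_within_open[OF has_deriv[OF f] chartD(2)])
      (use base eq inv_into_f_f[OF chartD(3)] in auto)
  then show ?thesis by (rule derivI[symmetric])
qed

lemma deriv_const [simp]: "deriv (\<lambda>q. k) = (\<lambda>u. 0)"
  by (simp add: deriv_def[abs_def])

lemma deriv_linear_compose:
  assumes "smooth_fun T A f" "bounded_linear L"
  shows "deriv (\<lambda>q. L (f q)) = (\<lambda>u. L (deriv f u))"
  by (rule derivI[OF bounded_linear.has_derivative[OF assms(2) has_deriv[OF assms(1)]]])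

lemma deriv_bilinear:
  assumes "bounded_bilinear B" "smooth_fun T A f" "smooth_fun T A g"
  shows "deriv (\<lambda>q. B (f q) (g q)) = (\<lambda>u. B (f p) (deriv g u) + B (deriv f u) (g p))"
  using derivI[OF bounded_bilinear.FDERIV[OF assms(1) has_deriv[OF assms(2)] has_deriv[OF assms(3)]]]
  by (simp add: inv_into_f_f chartD(3) base)

lemma deriv_add:
  assumes "smooth_fun T A f" "smooth_fun T A g"
  shows "deriv (\<lambda>q. f q + g q) = (\<lambda>u. deriv f u + deriv g u)"
  by (rule derivI[OF has_derivative_add[OF has_deriv[OF assms(1)] has_deriv[OF assms(2)]]])

lemma deriv_sum:
  assumes "\<And>i. i \<in> I \<Longrightarrow> smooth_fun T A (f i)"
  shows "deriv (\<lambda>q. \<Sum>i\<in>I. f i q) = (\<lambda>u. \<Sum>i\<in>I. deriv (f i) u)"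
  by (rule derivI, rule has_derivative_sum) (rule has_deriv[OF assms])

section \<open>Derivatives depending smoothly on a parameter\<close>

lemma smooth_fun_product_chart:
  assumes F: "smooth_fun (prod_topology T' T) (prod_atlas B A) F"
    and B: "smooth_atlas T' B" and d: "(V, d) \<in> B"
  shows "smooth_on (d ` V \<times> c ` U) (\<lambda>z. F (inv_into V d (fst z), inv_into U c (snd z)))"
proof -
  note dV = atlas_chartD[OF B d]
  have "(V \<times> U, map_prod d c) \<in> prod_atlas B A" using d chart by (auto simp: prod_atlas_def)
  from smooth_funD[OF F this]
  have *: "smooth_on (d ` V \<times> c ` U) (\<lambda>z. F (inv_into (V \<times> U) (map_prod d c) z))"
    by (simp add: map_prod_surj_on[OF refl refl])
  show ?thesis
    by (rule smooth_on_cong[OF _ _ *])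
      (auto simp: inv_into_map_prod[OF dV(3) chartD(3)] open_Times dV(2) chartD(2))
qed

lemma smooth_fun_slice:
  assumes F: "smooth_fun (prod_topology T' T) (prod_atlas B A) F" and B: "smooth_atlas T' B"
    and m: "m \<in> topspace T'"
  shows "smooth_fun T A (\<lambda>q. F (m, q))"
  by (rule smooth_map_compose[OF atlas smooth_atlas_prod[OF B atlas] smooth_atlas_euclidean
        smooth_map_Pair[OF atlas B atlas smooth_map_const[OF m] smooth_map_ident[OF atlas]] F])

text \<open>In product coordinates this is a partial derivative of the joint expression, restricted
  to the slice through \<open>c p\<close>. Smoothness of \<open>lfield\<close> and \<open>Ad\<close>
  in the group element and of \<open>dflow\<close> in time all comes from here.\<close>

lemma smooth_fun_param_deriv:
  assumes F: "smooth_fun (prod_topology T' T) (prod_atlas B A) F" and B: "smooth_atlas T' B"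
  shows "smooth_fun T' B (\<lambda>m. deriv (\<lambda>q. F (m, q)) u)"
proof (rule smooth_funI[OF B])
  fix V d assume d: "(V, d) \<in> B"
  note dV = atlas_chartD[OF B d]
  let ?F = "\<lambda>z. F (inv_into V d (fst z), inv_into U c (snd z))"
  note F' = smooth_fun_product_chart[OF F B d]
  have aff: "bounded_linear (\<lambda>y. (y, 0 :: 'e))"
    by (intro bounded_linear_Pair bounded_linear_ident bounded_linear_zero)
  have "smooth_on (d ` V) (\<lambda>y. (0, c p) + (y, 0))" by (rule smooth_on_affine[OF aff])
  then have "smooth_on (d ` V) (\<lambda>y. (y, c p))" by simp
  then have "smooth_on (d ` V) (\<lambda>y. frechet_derivative ?F (at (y, c p)) (0, u))"
    by (rule smooth_on_compose[OF dV(2) _ _ smooth_on_derivative[OF F'], where f="\<lambda>y. (y, c p)", rotated 2])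
      (use base in \<open>auto intro: open_Times dV(2) chartD(2)\<close>)
  moreover have "frechet_derivative ?F (at (y, c p)) (0, u) = deriv (\<lambda>q. F (inv_into V d y, q)) u"
    if "y \<in> d ` V" for y
    using frechet_derivative_slice(1)[OF F' that, of "c p" u] base by (simp add: deriv_def)
  ultimately show "smooth_on (d ` V) (\<lambda>y. deriv (\<lambda>q. F (inv_into V d y, q)) u)"
    by (rule smooth_on_cong[OF dV(2), rotated])
qed

end

text \<open>One factor carries a parameter, the other the point of differentiation. The parameter is
  a group element for the bracket of left invariant fields and time for the bracket with
  \<open>X\<close>.\<close>

locale two_pointed_charts = P: pointed_chart T' B V d m + Q: pointed_chart T A U c p
  for T' :: "'b topology" and B :: "('b, 'f::euclidean_space) atlas" and V d m
    and T :: "'a topology" and A :: "('a, 'e::euclidean_space) atlas" and U c p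
begin

text \<open>In product coordinates both sides are mixed second derivatives in the directions
  \<open>(w, 0)\<close> and \<open>(0, u)\<close>.\<close>

lemma deriv_commute:
  assumes F: "smooth_fun (prod_topology T' T) (prod_atlas B A) F"
  shows "P.deriv (\<lambda>m. Q.deriv (\<lambda>q. F (m, q)) u) w = Q.deriv (\<lambda>q. P.deriv (\<lambda>m. F (m, q)) w) u"
proof -
  let ?F = "\<lambda>z. F (inv_into V d (fst z), inv_into U c (snd z))"
  let ?z = "(d m, c p)"
  note F' = Q.smooth_fun_product_chart[OF F P.atlas P.chart]
  have op: "open (d ` V \<times> c ` U)" and z: "d m \<in> d ` V" "c p \<in> c ` U" "?z \<in> d ` V \<times> c ` U"
    using P.base Q.base by (auto intro: open_Times P.chartD(2) Q.chartD(2))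
  have 1: "frechet_derivative ?F (at (y, c p)) (0, u) = Q.deriv (\<lambda>q. F (inv_into V d y, q)) u"
    if "y \<in> d ` V" for y
    using frechet_derivative_slice(1)[OF F' that z(2), of u] by (simp add: Q.deriv_def)
  have 2: "frechet_derivative ?F (at (d m, x)) (w, 0) = P.deriv (\<lambda>m. F (m, inv_into U c x)) w"
    if "x \<in> c ` U" for x
    using frechet_derivative_slice(2)[OF F' z(1) that, of w] by (simp add: P.deriv_def)
  have "P.deriv (\<lambda>m. Q.deriv (\<lambda>q. F (m, q)) u) w =
      frechet_derivative (\<lambda>y. Q.deriv (\<lambda>q. F (inv_into V d y, q)) u) (at (d m)) w"
    by (simp add: P.deriv_def)
  also have "frechet_derivative (\<lambda>y. Q.deriv (\<lambda>q. F (inv_into V d y, q)) u) (at (d m)) =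
      frechet_derivative (\<lambda>y. frechet_derivative ?F (at (y, c p)) (0, u)) (at (d m))"
    by (rule frechet_derivative_transform_within_open[OF _ P.chartD(2) z(1)])
      (use 1 smooth_on_differentiable[OF smooth_funD[OF Q.smooth_fun_param_deriv[OF F P.atlas] P.chart] z(1)]
        in auto)
  also have "\<dots> w = frechet_derivative (\<lambda>z. frechet_derivative ?F (at z) (0, u)) (at ?z) (w, 0)"
    by (rule frechet_derivative_slice(2)[OF smooth_on_derivative[OF F'] z(1,2)])
  also have "\<dots> = frechet_derivative (\<lambda>z. frechet_derivative ?F (at z) (w, 0)) (at ?z) (0, u)"
    by (rule symmetric_second_derivative[OF F' op z(3)])
  also have "\<dots> = frechet_derivative (\<lambda>x. frechet_derivative ?F (at (d m, x)) (w, 0)) (at (c p)) u"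
    by (rule frechet_derivative_slice(1)[OF smooth_on_derivative[OF F'] z(1,2), symmetric])
  also have "frechet_derivative (\<lambda>x. frechet_derivative ?F (at (d m, x)) (w, 0)) (at (c p)) =
      frechet_derivative (\<lambda>x. P.deriv (\<lambda>m. F (m, inv_into U c x)) w) (at (c p))"
  proof (rule frechet_derivative_transform_within_open[OF _ Q.chartD(2) z(2)])
    have aff: "bounded_linear (\<lambda>x. (0 :: 'f, x))"
      by (intro bounded_linear_Pair bounded_linear_ident bounded_linear_zero)
    have "smooth_on (c ` U) (\<lambda>x. (d m, 0) + (0, x))" by (rule smooth_on_affine[OF aff])
    then have "smooth_on (c ` U) (\<lambda>x. (d m, x))" by simp
    then have "smooth_on (c ` U) (\<lambda>x. frechet_derivative ?F (at (d m, x)) (w, 0))"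
      by (rule smooth_on_compose[OF Q.chartD(2) op _ smooth_on_derivative[OF F'], where f="\<lambda>x. (d m, x)", rotated])
        (use z in auto)
    then show "(\<lambda>x. frechet_derivative ?F (at (d m, x)) (w, 0)) differentiable (at (c p))"
      by (rule smooth_on_differentiable) (rule z(2))
  qed (rule 2)
  also have "\<dots> u = Q.deriv (\<lambda>q. P.deriv (\<lambda>m. F (m, q)) w) u" by (simp add: Q.deriv_def)
  finally show ?thesis .
qed

text \<open>Here function and vector both depend on the parameter. Expanding \<open>v m\<close> in
  the basis reduces to the product rule with fixed vectors, and the interchange of derivatives
  rewrites the first term. Both bracket formulas are instances.\<close>

lemma deriv_moving_vector:
  assumes F: "smooth_fun (prod_topology T' T) (prod_atlas B A) F" and v: "smooth_fun T' B v"
  shows "P.deriv (\<lambda>m. Q.deriv (\<lambda>q. F (m, q)) (v m)) w =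
    Q.deriv (\<lambda>q. P.deriv (\<lambda>m. F (m, q)) w) (v m) + Q.deriv (\<lambda>q. F (m, q)) (P.deriv v w)"
proof -
  have lin: "linear (Q.deriv (\<lambda>q. F (m', q)))" if "m' \<in> topspace T'" for m'
    by (rule Q.deriv_linear[OF Q.smooth_fun_slice[OF F P.atlas that]])
  have sm: "smooth_fun T' B (\<lambda>m. Q.deriv (\<lambda>q. F (m, q)) b)" for b
    by (rule Q.smooth_fun_param_deriv[OF F P.atlas])
  have smv: "smooth_fun T' B (\<lambda>m. v m \<bullet> b)" for b
    by (rule smooth_fun_linear[OF P.atlas bounded_linear_inner_left v])
  have smt: "smooth_fun T' B (\<lambda>m. (v m \<bullet> b) *\<^sub>R Q.deriv (\<lambda>q. F (m, q)) b)" for b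
    by (rule smooth_fun_bilinear[OF P.atlas bounded_bilinear_scaleR smv sm])
  have "P.deriv (\<lambda>m. \<Sum>b\<in>Basis. (v m \<bullet> b) *\<^sub>R Q.deriv (\<lambda>q. F (m, q)) b) =
      P.deriv (\<lambda>m. Q.deriv (\<lambda>q. F (m, q)) (v m))"
  proof (rule P.deriv_cong)
    show "smooth_fun T' B (\<lambda>m. \<Sum>b\<in>Basis. (v m \<bullet> b) *\<^sub>R Q.deriv (\<lambda>q. F (m, q)) b)"
      by (rule smooth_fun_sum[OF P.atlas smt])
    show "(\<Sum>b\<in>Basis. (v m' \<bullet> b) *\<^sub>R Q.deriv (\<lambda>q. F (m', q)) b) = Q.deriv (\<lambda>q. F (m', q)) (v m')"
      if "m' \<in> V" for m'
      by (rule linear_basis_expansion[OF lin, symmetric]) (use that P.chartD(5) in blast)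
  qed
  then have "P.deriv (\<lambda>m. Q.deriv (\<lambda>q. F (m, q)) (v m)) w =
      P.deriv (\<lambda>m. \<Sum>b\<in>Basis. (v m \<bullet> b) *\<^sub>R Q.deriv (\<lambda>q. F (m, q)) b) w" by simp
  also have "\<dots> = (\<Sum>b\<in>Basis. P.deriv (\<lambda>m. (v m \<bullet> b) *\<^sub>R Q.deriv (\<lambda>q. F (m, q)) b) w)"
    by (rule fun_cong[OF P.deriv_sum[OF smt]])
  also have "\<dots> = (\<Sum>b\<in>Basis. (v m \<bullet> b) *\<^sub>R P.deriv (\<lambda>m. Q.deriv (\<lambda>q. F (m, q)) b) w +
      (P.deriv v w \<bullet> b) *\<^sub>R Q.deriv (\<lambda>q. F (m, q)) b)"
    by (simp only: P.deriv_bilinear[OF bounded_bilinear_scaleR smv sm]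
        P.deriv_linear_compose[OF v bounded_linear_inner_left])
  also have "\<dots> = (\<Sum>b\<in>Basis. (v m \<bullet> b) *\<^sub>R Q.deriv (\<lambda>q. P.deriv (\<lambda>m. F (m, q)) w) b) +
      (\<Sum>b\<in>Basis. (P.deriv v w \<bullet> b) *\<^sub>R Q.deriv (\<lambda>q. F (m, q)) b)"
    by (simp only: sum.distrib deriv_commute[OF F])
  also have "(\<Sum>b\<in>Basis. (v m \<bullet> b) *\<^sub>R Q.deriv (\<lambda>q. P.deriv (\<lambda>m. F (m, q)) w) b) =
      Q.deriv (\<lambda>q. P.deriv (\<lambda>m. F (m, q)) w) (v m)"
  proof (rule linear_basis_expansion[OF Q.deriv_linear, symmetric])
    \<comment> \<open>\<open>smooth_fun_param_deriv\<close> differentiates the second factor only,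
      hence the exchange of factors.\<close>
    have "smooth_fun (prod_topology T T') (prod_atlas A B) (\<lambda>z. F (snd z, fst z))"
      by (rule smooth_map_compose[OF smooth_atlas_prod[OF Q.atlas P.atlas] smooth_atlas_prod[OF P.atlas Q.atlas]
            smooth_atlas_euclidean smooth_map_Pair[OF smooth_atlas_prod[OF Q.atlas P.atlas] P.atlas Q.atlas
              smooth_map_fst_snd(2)[OF Q.atlas P.atlas] smooth_map_fst_snd(1)[OF Q.atlas P.atlas]] F])
    from P.smooth_fun_param_deriv[OF this Q.atlas, of w]
    show "smooth_fun T A (\<lambda>q. P.deriv (\<lambda>m. F (m, q)) w)" by simp
  qed
  also have "(\<Sum>b\<in>Basis. (P.deriv v w \<bullet> b) *\<^sub>R Q.deriv (\<lambda>q. F (m, q)) b) = Q.deriv (\<lambda>q. F (m, q)) (P.deriv v w)"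
    by (rule linear_basis_expansion[OF lin[OF P.base_topspace], symmetric])
  finally show ?thesis .
qed

end

subsection \<open>Coordinate functions and tangent vectors\<close>

context pointed_chart
begin

lemma chart_bump:
  obtains r and \<beta> :: "'e \<Rightarrow> real"
  where "r > 0" "ball (c p) r \<subseteq> c ` U" "cball (c p) (r / 2) \<subseteq> c ` U"
    "smooth_on UNIV \<beta>" "\<beta> (c p) = 1" "\<And>x. x \<notin> cball (c p) (r / 2) \<Longrightarrow> \<beta> x = 0"
proof -
  obtain r where r: "r > 0" "ball (c p) r \<subseteq> c ` U"
    using chartD(2) base open_contains_ball by (metis imageI)
  have K: "cball (c p) (r / 2) \<subseteq> c ` U" by (rule order_trans[OF _ r(2)]) (use r(1) in auto)
  obtain \<beta> :: "'e \<Rightarrow> real" where \<beta>: "smooth_on UNIV \<beta>" "\<beta> (c p) = 1"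
      "\<And>x. x \<notin> cball (c p) (r / 2) \<Longrightarrow> \<beta> x = 0"
    using bump_function[of "r / 2" "c p"] r by auto
  show ?thesis by (rule that[OF r K \<beta>])
qed

lemma chart_extension:
  assumes H: "Hausdorff_space T" and F: "smooth_on UNIV F"
    and K: "cball (c p) \<rho> \<subseteq> c ` U" and zero: "\<And>x. x \<notin> cball (c p) \<rho> \<Longrightarrow> F x = 0"
  shows "smooth_fun T A (\<lambda>q. if q \<in> U then F (c q) else 0)"
    and "deriv (\<lambda>q. if q \<in> U then F (c q) else 0) = frechet_derivative F (at (c p))"
proof -
  show "smooth_fun T A (\<lambda>q. if q \<in> U then F (c q) else 0)"
    by (rule smooth_fun_chart_extension[OF atlas H chart F compact_cball K zero])
  have D: "(F has_derivative frechet_derivative F (at (c p))) (at (c p))"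
    by (rule smooth_on_has_derivative[OF F]) simp
  show "deriv (\<lambda>q. if q \<in> U then F (c q) else 0) = frechet_derivative F (at (c p))"
    by (rule derivI[OF has_derivative_transform_within_open[OF D chartD(2)]])
      (use base in \<open>auto simp: f_inv_into_f inv_into_into\<close>)
qed

lemma smooth_on_translate: "smooth_on S (\<lambda>x. x - a)"
proof -
  have "smooth_on S (\<lambda>x. - a + x)" by (rule smooth_on_affine) (rule bounded_linear_ident)
  then show ?thesis by simp
qed

text \<open>The chart is meaningful only on \<open>U\<close>, so it is recentred and multiplied by a
  bump. A bump equal to 1 merely at the base point is enough: in the product rule its derivative
  multiplies \<open>x - c p\<close>, which is 0 there.\<close>

lemma coordinate_map_exists:
  assumes H: "Hausdorff_space T"
  obtains cb :: "'a \<Rightarrow> 'e" where "smooth_fun T A cb" "deriv cb = (\<lambda>u. u)"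
proof -
  obtain r and \<beta> :: "'e \<Rightarrow> real"
    where r: "r > 0" "ball (c p) r \<subseteq> c ` U" and K: "cball (c p) (r / 2) \<subseteq> c ` U"
      and \<beta>: "smooth_on UNIV \<beta>" "\<beta> (c p) = 1" "\<And>x. x \<notin> cball (c p) (r / 2) \<Longrightarrow> \<beta> x = 0"
    by (rule chart_bump) (rule that, assumption+)
  let ?F = "\<lambda>x. \<beta> x *\<^sub>R (x - c p)"
  have F: "smooth_on UNIV ?F" by (intro smooth_on_scaleR open_UNIV \<beta> smooth_on_translate)
  have "(?F has_derivative (\<lambda>u. \<beta> (c p) *\<^sub>R u + frechet_derivative \<beta> (at (c p)) u *\<^sub>R (c p - c p))) (at (c p))"
    by (rule bounded_bilinear.FDERIV[OF bounded_bilinear_scaleR smooth_on_has_derivative[OF \<beta>(1)]])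
      (auto intro!: derivative_eq_intros)
  then have "frechet_derivative ?F (at (c p)) = (\<lambda>u. u)"
    using frechet_derivative_at \<beta>(2) by fastforce
  with that[OF chart_extension(1)[OF H F K]] chart_extension(2)[OF H F K] \<beta>(3) show ?thesis
    by simp
qed

text \<open>By Hadamard's lemma a function is, near \<open>p\<close>, a constant plus products whose
  first factors are coordinates vanishing at \<open>p\<close>. The Leibniz rule evaluates each
  product from the values of \<open>v\<close> on the coordinates alone.\<close>

lemma tangent_space_deriv:
  assumes H: "Hausdorff_space T" and v: "v \<in> tangent_space T A p"
  obtains w where "\<And>f. smooth_fun T A f \<Longrightarrow> v f = deriv f w"
proof -
  have add: "v (f + g) = v f + v g" and scale: "v (a *\<^sub>R f) = a * v f"
    and mult: "v (f * g) = f p * v g + g p * v f"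
    if "smooth_fun T A f" "smooth_fun T A g" for f g a
    using v that by (auto simp: tangent_space_def smooth_functions_iff)
  have add': "v (\<lambda>q. f q + g q) = v f + v g" and scale': "v (\<lambda>q. a * f q) = a * v f"
    and mult': "v (\<lambda>q. f q * g q) = f p * v g + g p * v f"
    if "smooth_fun T A f" "smooth_fun T A g" for f g a
    using add[OF that] scale[OF that] mult[OF that]
    by (simp_all add: plus_fun_def times_fun_def scaleR_fun_def)
  have "v (\<lambda>q. 1 * 1) = 1 * v (\<lambda>q. 1) + 1 * v (\<lambda>q. 1)"
    by (rule mult'[OF smooth_fun_const smooth_fun_const])
  then have one: "v (\<lambda>q. 1) = 0" by simp
  have const: "v (\<lambda>q. k) = 0" for k
    using scale'[OF smooth_fun_const smooth_fun_const, of k 1] one by simp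
  have sum0: "v (\<lambda>q. \<Sum>i\<in>I. f i q) = (\<Sum>i\<in>I. v (f i))" if "finite I" "\<And>i. smooth_fun T A (f i)"
    for I and f :: "'e \<Rightarrow> 'a \<Rightarrow> real"
    using that(1)
  proof (induction I)
    case empty
    then show ?case by (simp add: const)
  next
    case (insert i I)
    then show ?case
      using add'[OF that(2)[of i] smooth_fun_sum[OF atlas that(2), of "\<lambda>i. i" I]] by simp
  qed
  obtain r and \<beta> :: "'e \<Rightarrow> real"
    where r: "r > 0" "ball (c p) r \<subseteq> c ` U" and K: "cball (c p) (r / 2) \<subseteq> c ` U"
      and \<beta>: "smooth_on UNIV \<beta>" "\<beta> (c p) = 1" "\<And>x. x \<notin> cball (c p) (r / 2) \<Longrightarrow> \<beta> x = 0"
    by (rule chart_bump) (rule that, assumption+)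
  define ext where "ext F = (\<lambda>q. if q \<in> U then F (c q) else 0)" for F :: "'e \<Rightarrow> real"
  have ext_bump: "smooth_fun T A (ext (\<lambda>x. \<beta> x * F x))" if "smooth_on (ball (c p) r) F" for F
  proof -
    have "smooth_on UNIV (\<lambda>x. \<beta> x * F x)"
      using smooth_on_bump_extension[OF \<beta>(1) that, of "r / 2"] \<beta>(3) r(1) by simp
    from chart_extension(1)[OF H this K] \<beta>(3) show ?thesis by (simp add: ext_def)
  qed
  let ?\<xi> = "\<lambda>b. ext (\<lambda>x. \<beta> x * ((x - c p) \<bullet> b))"
  \<comment> \<open>The components of \<open>w\<close> can only be the values of \<open>v\<close> on
    the coordinate functions, here localised by the bump.\<close>
  define w where "w = (\<Sum>b\<in>Basis. v (?\<xi> b) *\<^sub>R b)"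
  have xi: "smooth_fun T A (?\<xi> b)" for b
    by (intro ext_bump smooth_on_inner_const open_ball smooth_on_translate)
  have "v f = deriv f w" if f: "smooth_fun T A f" for f
  proof -
    define F where "F = (\<lambda>x. f (inv_into U c x))"
    have F: "smooth_on (ball (c p) r) F"
      unfolding F_def by (rule smooth_on_subset[OF smooth_funD[OF f chart] r(2)])
    have Fc: "F (c q) = f q" if "q \<in> U" for q using that chartD(3) by (simp add: F_def inv_into_f_f)
    obtain G where G: "\<And>b. smooth_on (ball (c p) r) (G b)"
      "\<And>x. x \<in> ball (c p) r \<Longrightarrow> F x = F (c p) + (\<Sum>b\<in>Basis. ((x - c p) \<bullet> b) * G b x)"
      "\<And>b. G b (c p) = frechet_derivative F (at (c p)) b"
      using Hadamard_lemma[OF open_ball convex_ball _ F, of "c p"] r(1) by auto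
    have one': "smooth_fun T A (ext (\<lambda>x. \<beta> x * 1))" by (intro ext_bump smooth_on_const)
    define g where "g = (\<lambda>q. f q + (- f p))"
    have g: "smooth_fun T A g" unfolding g_def by (intro smooth_fun_add[OF atlas] f smooth_fun_const)
    have "v g = v f" unfolding g_def using add'[OF f smooth_fun_const, of "- f p"] const by simp
    \<comment> \<open>Multiplying \<open>g\<close> by the square of the localised bump does not
      change \<open>v g\<close>, since \<open>g p = 0\<close> and the bump is 1 at \<open>p\<close>.
      The square supplies one cut-off to the coordinate function and one to the Hadamard
      coefficient.\<close>
    let ?b = "ext (\<lambda>x. \<beta> x * 1)"
    have bp: "?b p = 1" "g p = 0" by (auto simp: ext_def base \<beta> g_def)
    have bb: "smooth_fun T A (\<lambda>q. ?b q * ?b q)"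
      by (rule smooth_fun_bilinear[OF atlas bounded_bilinear_mult one' one'])
    have "v (\<lambda>q. (?b q * ?b q) * g q) = v g"
      using mult'[OF bb g] bp by simp
    also have "(\<lambda>q. (?b q * ?b q) * g q) =
        (\<lambda>q. \<Sum>b\<in>Basis. ?\<xi> b q * ext (\<lambda>x. \<beta> x * G b x) q)"
    proof
      fix q
      show "(?b q * ?b q) * g q = (\<Sum>b\<in>Basis. ?\<xi> b q * ext (\<lambda>x. \<beta> x * G b x) q)"
      proof (cases "q \<in> U \<and> c q \<in> cball (c p) (r / 2)")
        case True
        then have "c q \<in> ball (c p) r" using r(1) by auto
        from G(2)[OF this] True have "g q = (\<Sum>b\<in>Basis. ((c q - c p) \<bullet> b) * G b (c q))"
          by (simp add: g_def Fc base)
        then show ?thesis using True by (simp add: ext_def sum_distrib_left mult.assoc mult.left_commute)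
      next
        case False
        then show ?thesis using \<beta>(3)[of "c q"] by (auto simp: ext_def)
      qed
    qed
    also have "v \<dots> = (\<Sum>b\<in>Basis. v (\<lambda>q. ?\<xi> b q * ext (\<lambda>x. \<beta> x * G b x) q))"
      by (rule sum0[OF finite_Basis]) (rule smooth_fun_bilinear[OF atlas bounded_bilinear_mult xi ext_bump[OF G(1)]])
    also have "\<dots> = (\<Sum>b\<in>Basis. G b (c p) * v (?\<xi> b))"
      by (rule sum.cong[OF refl], subst mult'[OF xi ext_bump[OF G(1)]]) (simp add: ext_def base \<beta>)
    also have "\<dots> = (\<Sum>b\<in>Basis. (w \<bullet> b) *\<^sub>R deriv f b)"
      by (rule sum.cong[OF refl]) (simp add: G(3) F_def deriv_def w_def inner_sum_left_Basis)
    also have "\<dots> = deriv f w" by (rule linear_basis_expansion[OF deriv_linear[OF f], symmetric])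
    finally show ?thesis using \<open>v g = v f\<close> by simp
  qed
  then show ?thesis by (rule that)
qed

end

section \<open>Left invariant vector fields\<close>

locale lie_group_chart = lie_group G for G :: "('a, 'e::euclidean_space) lie_struct" (structure) +
  fixes U :: "'a set" and c :: "'a \<Rightarrow> 'e"
  assumes id_chart: "(U, c) \<in> charts G" and one_mem: "\<one> \<in> U"
begin

abbreviation "T \<equiv> gtop G"
abbreviation "A \<equiv> charts G"

lemma atlas: "smooth_atlas T A" by (rule smooth_manifold_atlas[OF manifold])

lemma Hausdorff: "Hausdorff_space T" using manifold by (simp add: smooth_manifold_def)

sublocale pointed_chart T A U c "\<one>"
  by unfold_locales (rule atlas id_chart one_mem)+

lemma U_carrier: "q \<in> U \<Longrightarrow> q \<in> carrier G" using chartD(5) topspace_eq by auto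

lemma smooth_mult_maps:
  assumes B: "smooth_atlas T' B" and F: "smooth_map T' B T A F" and H: "smooth_map T' B T A H"
  shows "smooth_map T' B T A (\<lambda>m. F m \<otimes> H m)"
  using smooth_map_compose[OF B smooth_atlas_prod[OF atlas atlas] atlas
      smooth_map_Pair[OF B atlas atlas F H] smooth_mult] by simp

lemma smooth_inv_map:
  assumes B: "smooth_atlas T' B" and F: "smooth_map T' B T A F"
  shows "smooth_map T' B T A (\<lambda>m. inv (F m))"
  by (rule smooth_map_compose[OF B atlas atlas F smooth_inv])

lemma smooth_const_map: "g \<in> carrier G \<Longrightarrow> smooth_map T' B T A (\<lambda>m. g)"
  by (rule smooth_map_const) (simp add: topspace_eq)

lemma smooth_fun_compose:
  "smooth_atlas T' B \<Longrightarrow> smooth_map T' B T A F \<Longrightarrow> smooth_fun T A f \<Longrightarrow> smooth_fun T' B (\<lambda>m. f (F m))"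
  by (rule smooth_map_compose[OF _ atlas smooth_atlas_euclidean])

text \<open>The left invariant field with coordinate vector \<open>u\<close> at the identity. It is
  0 off the carrier and on non-smooth functions, as the normalisations of
  \<open>vector_fields\<close> and \<open>tangent_space\<close> demand.\<close>

definition lfield :: "'e \<Rightarrow> 'a vector_field"
  where "lfield u = (\<lambda>p f. if p \<in> carrier G \<and> smooth_fun T A f then deriv (\<lambda>q. f (p \<otimes> q)) u else 0)"

lemma smooth_left_translate: "p \<in> carrier G \<Longrightarrow> smooth_fun T A f \<Longrightarrow> smooth_fun T A (\<lambda>q. f (p \<otimes> q))"
  by (rule smooth_fun_compose[OF atlas smooth_mult_maps[OF atlas smooth_const_map smooth_map_ident[OF atlas]]])

lemma smooth_two_variable:
  "smooth_fun T A f \<Longrightarrow> smooth_fun (prod_topology T T) (prod_atlas A A) (\<lambda>z. f (fst z \<otimes> snd z))"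
  by (rule smooth_fun_compose[OF smooth_atlas_prod[OF atlas atlas] smooth_mult_maps[OF
        smooth_atlas_prod[OF atlas atlas] smooth_map_fst_snd(1)[OF atlas atlas] smooth_map_fst_snd(2)[OF atlas atlas]]])

lemma lfield_in_tangent_space:
  assumes p: "p \<in> carrier G"
  shows "lfield u p \<in> tangent_space T A p"
proof -
  note l = smooth_left_translate[OF p]
  have "lfield u p (f + g) = lfield u p f + lfield u p g" if "smooth_fun T A f" "smooth_fun T A g" for f g
  proof -
    have "smooth_fun T A (f + g)" using smooth_fun_add[OF atlas that] by (simp add: plus_fun_def)
    then show ?thesis using p that deriv_add[OF l[OF that(1)] l[OF that(2)]] by (simp add: lfield_def)
  qed
  moreover have "lfield u p (a *\<^sub>R f) = a * lfield u p f" if "smooth_fun T A f" for f a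
  proof -
    have "smooth_fun T A (a *\<^sub>R f)"
      using smooth_fun_linear[OF atlas bounded_linear_mult_right that] by (simp add: scaleR_fun_def)
    then show ?thesis using p that deriv_linear_compose[OF l[OF that] bounded_linear_mult_right]
      by (simp add: lfield_def scaleR_fun_def)
  qed
  moreover have "lfield u p (f * g) = f p * lfield u p g + g p * lfield u p f"
    if "smooth_fun T A f" "smooth_fun T A g" for f g
  proof -
    have "smooth_fun T A (f * g)"
      using smooth_fun_bilinear[OF atlas bounded_bilinear_mult that] by (simp add: times_fun_def)
    then show ?thesis
      using p that deriv_bilinear[OF bounded_bilinear_mult l[OF that(1)] l[OF that(2)]] by (simp add: lfield_def)
  qed
  ultimately show ?thesis by (simp add: tangent_space_def smooth_functions_iff lfield_def)
qed

lemma lfield_smooth: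
  assumes f: "smooth_fun T A f"
  shows "smooth_fun T A (\<lambda>p. lfield u p f)"
  by (rule smooth_fun_cong[OF atlas smooth_fun_param_deriv[OF smooth_two_variable[OF f] atlas, of u]])
    (use f in \<open>simp add: lfield_def topspace_eq\<close>)

lemma lfield_vector_field: "lfield u \<in> vector_fields T A"
  unfolding vector_fields_def smooth_functions_iff
  using lfield_in_tangent_space lfield_smooth
  by (auto simp: topspace_eq lfield_def zero_fun_def smooth_functions_iff)

lemma lfield_lie_algebra: "lfield u \<in> lie_algebra G"
  unfolding lie_algebra_def
proof (intro CollectI conjI ballI lfield_vector_field)
  fix g h assume gh: "g \<in> carrier G" "h \<in> carrier G"
  show "pushforward T A (\<lambda>x. g \<otimes> x) (lfield u h) = lfield u (g \<otimes> h)"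
  proof
    fix f
    show "pushforward T A (\<lambda>x. g \<otimes> x) (lfield u h) f = lfield u (g \<otimes> h) f"
    proof (cases "smooth_fun T A f")
      case True
      have "deriv (\<lambda>q. f (g \<otimes> (h \<otimes> q))) = deriv (\<lambda>q. f ((g \<otimes> h) \<otimes> q))"
        by (rule deriv_cong[OF smooth_left_translate[OF gh(2) smooth_left_translate[OF gh(1) True]]])
          (use gh U_carrier in \<open>simp add: m_assoc\<close>)
      then show ?thesis using gh True smooth_left_translate[OF gh(1) True]
        by (simp add: pushforward_def smooth_functions_iff lfield_def o_def)
    qed (simp add: pushforward_def smooth_functions_iff lfield_def)
  qed
qed

text \<open>At the identity \<open>tangent_space_deriv\<close> supplies the vector, and left
  invariance carries it to every point. Together with \<open>lfield_eq_iff\<close> this makes the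
  Lie algebra a copy of the model space.\<close>

lemma lie_algebra_lfield:
  assumes X: "X \<in> lie_algebra G"
  obtains w where "X = lfield w"
proof -
  have Xv: "X \<in> vector_fields T A" and inv: "\<And>g h. g \<in> carrier G \<Longrightarrow> h \<in> carrier G \<Longrightarrow>
      pushforward T A (\<lambda>x. g \<otimes> x) (X h) = X (g \<otimes> h)"
    using X by (auto simp: lie_algebra_def)
  have tan: "X p \<in> tangent_space T A p" if "p \<in> carrier G" for p
    using Xv that by (auto simp: vector_fields_def topspace_eq)
  obtain w where w: "\<And>f. smooth_fun T A f \<Longrightarrow> X \<one> f = deriv f w"
    using tangent_space_deriv[OF Hausdorff tan[OF one_closed]] by blast
  have "X p f = lfield w p f" for p f
  proof (cases "p \<in> carrier G \<and> smooth_fun T A f")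
    case True
    then have p: "p \<in> carrier G" and f: "smooth_fun T A f" by auto
    have "X p f = pushforward T A (\<lambda>x. p \<otimes> x) (X \<one>) f" using inv[OF p one_closed] p by simp
    also have "\<dots> = X \<one> (\<lambda>q. f (p \<otimes> q))" using f by (simp add: pushforward_def smooth_functions_iff o_def)
    also have "\<dots> = lfield w p f" using w[OF smooth_left_translate[OF p f]] p f by (simp add: lfield_def)
    finally show ?thesis .
  next
    case False
    then show ?thesis
      using Xv tan[of p] by (cases "p \<in> carrier G")
        (auto simp: lfield_def vector_fields_def topspace_eq tangent_space_def smooth_functions_iff)
  qed
  then show ?thesis using that by blast
qed

lemma lfield_linear: "linear lfield"
proof (rule linearI)
  have l: "linear (deriv (\<lambda>q. f (p \<otimes> q)))" if "p \<in> carrier G" "smooth_fun T A f" for p f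
    by (rule deriv_linear[OF smooth_left_translate[OF that]])
  show "lfield (u + v) = lfield u + lfield v" for u v
    by (auto simp: lfield_def fun_eq_iff linear_add[OF l])
  show "lfield (r *\<^sub>R u) = r *\<^sub>R lfield u" for r u
    by (auto simp: lfield_def fun_eq_iff scaleR_fun_def linear_cmul[OF l])
qed

text \<open>A global stand-in for the chart, fixed once by choice: differentials of maps are
  computed by composing with it, without regard to where the image leaves \<open>U\<close>.\<close>

definition coord :: "'a \<Rightarrow> 'e"
  where "coord = (SOME cb. smooth_fun T A cb \<and> deriv cb = (\<lambda>u. u))"

lemma coord: "smooth_fun T A coord" "deriv coord = (\<lambda>u. u)"
proof -
  have "\<exists>cb. smooth_fun T A cb \<and> deriv cb = (\<lambda>u. u)"
    using coordinate_map_exists[OF Hausdorff] by blast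
  from someI_ex[OF this] show "smooth_fun T A coord" "deriv coord = (\<lambda>u. u)"
    by (simp_all add: coord_def)
qed

lemma lfield_eq_iff: "lfield u = lfield v \<longleftrightarrow> u = v"
proof
  assume eq: "lfield u = lfield v"
  have "u \<bullet> b = v \<bullet> b" for b
  proof -
    let ?f = "\<lambda>q. coord q \<bullet> b"
    have f: "smooth_fun T A ?f" by (rule smooth_fun_linear[OF atlas bounded_linear_inner_left coord(1)])
    have "deriv (\<lambda>q. ?f (\<one> \<otimes> q)) = deriv ?f"
      by (rule deriv_cong[OF smooth_left_translate[OF one_closed f]]) (simp add: U_carrier)
    then have "lfield w \<one> ?f = w \<bullet> b" for w
      using f deriv_linear_compose[OF coord(1) bounded_linear_inner_left, of b]
      by (simp add: lfield_def coord(2))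
    then show ?thesis using eq by metis
  qed
  then show "u = v" by (simp add: euclidean_eq_iff[of u])
qed simp

section \<open>Differentials of self-maps at the identity\<close>

text \<open>Intended for maps that fix the identity, for which \<open>deriv_compose\<close> shows it
  to be the differential in the chart. Phrasing it by \<open>deriv\<close> lets linearity and smooth
  dependence on parameters be inherited.\<close>

definition diff :: "('a \<Rightarrow> 'a) \<Rightarrow> 'e \<Rightarrow> 'e"
  where "diff F = deriv (\<lambda>q. coord (F q))"

lemma deriv_compose:
  assumes F: "smooth_map T A T A F" "F \<one> = \<one>" and f: "smooth_fun T A f"
  shows "deriv (\<lambda>q. f (F q)) u = deriv f (diff F u)"
proof -
  let ?W = "c ` (U \<inter> F -` U)" and ?F = "\<lambda>x. c (F (inv_into U c x))"
  have "open (c ` (U \<inter> (U \<inter> F -` U)))"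
    by (rule atlas_open_image[OF atlas chart
          openin_Int_vimage[OF smooth_mapD(1)[OF F(1)] chartD(1) chartD(1)]])
  then have W: "open ?W" by (simp add: Int_absorb1)
  have one_W: "c \<one> \<in> ?W" using base F(2) by auto
  have F_one: "?F (c \<one>) = c \<one>" using chartD(3) base F(2) by (simp add: inv_into_f_f)
  let ?L = "frechet_derivative ?F (at (c \<one>))"
  have L: "(?F has_derivative ?L) (at (c \<one>))"
    by (rule smooth_on_has_derivative[OF smooth_mapD(2)[OF F(1) chart chart] one_W])
  have chain: "deriv (\<lambda>q. h (F q)) = (\<lambda>u. deriv h (?L u))" if h: "smooth_fun T A h" for h :: "'a \<Rightarrow> 'z::euclidean_space"
  proof (rule derivI, rule has_derivative_transform_within_open[OF _ W one_W])
    show "((\<lambda>x. h (inv_into U c (?F x))) has_derivative (\<lambda>u. deriv h (?L u))) (at (c \<one>))"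
      using diff_chain_at[OF L, of "\<lambda>x. h (inv_into U c x)" "deriv h"] has_deriv[OF h]
      by (simp add: F_one o_def)
    show "h (inv_into U c (?F x)) = h (F (inv_into U c x))" if "x \<in> ?W" for x
      using that chartD(3) by (auto simp: inv_into_f_f)
  qed
  \<comment> \<open>Applied to \<open>coord\<close>, whose derivative is the identity, the chain
    rule identifies the chart differential with \<open>diff F\<close>.\<close>
  have "diff F = ?L" unfolding diff_def chain[OF coord(1)] by (simp add: coord(2))
  then show ?thesis by (simp add: chain[OF f])
qed

lemma diff_linear:
  "smooth_map T A T A F \<Longrightarrow> linear (diff F)"
  unfolding diff_def by (rule deriv_linear[OF smooth_fun_compose[OF atlas _ coord(1)]])

lemma diff_compose:
  assumes "smooth_map T A T A F" "F \<one> = \<one>" "smooth_map T A T A H"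
  shows "diff (\<lambda>q. H (F q)) u = diff H (diff F u)"
  unfolding diff_def[of "\<lambda>q. H (F q)"] diff_def[of H]
  by (rule deriv_compose[OF assms(1,2) smooth_fun_compose[OF atlas assms(3) coord(1)]])

lemma diff_cong:
  assumes "smooth_map T A T A F" "\<And>q. q \<in> carrier G \<Longrightarrow> F q = H q"
  shows "diff F = diff H"
  unfolding diff_def
  by (rule deriv_cong[OF smooth_fun_compose[OF atlas assms(1) coord(1)]]) (simp add: assms(2) U_carrier)

lemma diff_ident: "diff (\<lambda>q. q) = (\<lambda>u. u)"
  by (simp add: diff_def coord(2))

end

section \<open>Invariant inner products\<close>

definition inner_form :: "('e::euclidean_space \<Rightarrow> 'e \<Rightarrow> real) \<Rightarrow> bool"
  where "inner_form Q \<longleftrightarrow> (\<forall>x. linear (Q x)) \<and> (\<forall>x y. Q x y = Q y x) \<and> (\<forall>x. x \<noteq> 0 \<longrightarrow> Q x x > 0)"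

lemma inner_form_linear:
  assumes "inner_form Q"
  shows "linear (Q x)" "linear (\<lambda>x. Q x y)"
proof -
  show l: "linear (Q x)" for x using assms by (simp add: inner_form_def)
  have "(\<lambda>x. Q x y) = Q y" using assms by (auto simp: inner_form_def)
  then show "linear (\<lambda>x. Q x y)" using l by simp
qed

text \<open>The change of variables \<open>R\<close> turns \<open>Q\<close> into the standard inner
  product, so skewness for \<open>Q\<close> becomes ordinary skewness and Euclidean facts about
  spheres and orthogonal complements apply.\<close>

lemma inner_form_orthonormal_basis:
  fixes Q :: "'e::euclidean_space \<Rightarrow> 'e \<Rightarrow> real"
  assumes Q: "inner_form Q"
  obtains R R' :: "'e \<Rightarrow> 'e" where "linear R" "linear R'" "\<And>x. R (R' x) = x" "\<And>x. R' (R x) = x"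
    "\<And>x y. Q (R x) (R y) = x \<bullet> y"
proof -
  note lin = inner_form_linear[OF Q]
  have "\<exists>r. \<forall>b\<in>B. \<forall>b'\<in>B. Q (r b) (r b') = b \<bullet> b'" if "B \<subseteq> Basis" for B :: "'e set"
  proof -
    have "finite B" using that finite_Basis finite_subset by blast
    then show ?thesis using that
    proof (induction B)
      case empty
      then show ?case by simp
    next
      case (insert i B)
      then obtain r where r: "\<forall>b\<in>B. \<forall>b'\<in>B. Q (r b) (r b') = b \<bullet> b'" by auto
      \<comment> \<open>Its values are orthogonal to the missing basis vector \<open>i\<close>, so
        it is not onto and hence not injective. A nonzero kernel vector is
        \<open>Q\<close>-orthogonal to all \<open>r b\<close> and, once normalised, becomes the
        image of \<open>i\<close>.\<close>
      let ?f = "\<lambda>x. \<Sum>b\<in>B. Q (r b) x *\<^sub>R b"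
      have linf: "linear ?f"
        by (rule linearI) (simp_all add: linear_add[OF lin(1)] linear_cmul[OF lin(1)]
            scaleR_add_left sum.distrib scaleR_sum_right)
      have fi: "?f x \<bullet> i = 0" for x
        using insert by (auto simp: inner_sum_left inner_Basis intro!: sum.neutral)
      have "\<not> surj ?f"
      proof
        assume "surj ?f"
        then obtain x where "?f x = i" by (rule surjE) (rule that, rule sym)
        then have "i \<bullet> i = 0" using fi[of x] by (simp only:)
        then show False using insert.prems by simp
      qed
      then have "\<not> inj ?f" using linear_injective_imp_surjective[OF linf] by auto
      then have "\<exists>x. ?f x = 0 \<and> x \<noteq> 0" unfolding linear_injective_0[OF linf] by simp
      then obtain x where x: "x \<noteq> 0" "?f x = 0" by (elim exE conjE)
      have orth: "Q (r b) x = 0" if b: "b \<in> B" for b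
      proof -
        have "?f x \<bullet> b = (\<Sum>b'\<in>B. if b' = b then Q (r b) x else 0)"
          unfolding inner_sum_left
          by (rule sum.cong[OF refl]) (use insert.prems b in \<open>auto simp: inner_Basis subset_iff\<close>)
        then show ?thesis using x(2) b insert.hyps(1) by simp
      qed
      have pos: "Q x x > 0" using Q x(1) by (simp add: inner_form_def)
      let ?n = "(1 / sqrt (Q x x)) *\<^sub>R x"
      have sym: "Q x y = Q y x" for x y using Q by (simp add: inner_form_def)
      have nn: "Q ?n ?n = 1"
        using pos by (simp add: linear_cmul[OF lin(1)] linear_cmul[OF lin(2)])
      have orth': "Q (r b) ?n = 0" "Q ?n (r b) = 0" if "b \<in> B" for b
        using orth[OF that] sym[of x "r b"] by (simp_all add: linear_cmul[OF lin(1)] linear_cmul[OF lin(2)])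
      have ib: "i \<bullet> b = 0" "b \<bullet> i = 0" if "b \<in> B" for b
        using insert that by (auto simp: inner_Basis subset_iff)
      have ii: "i \<bullet> i = 1" using insert.prems by simp
      have "\<forall>b\<in>insert i B. \<forall>b'\<in>insert i B. Q ((r(i := ?n)) b) ((r(i := ?n)) b') = b \<bullet> b'"
        using r nn orth' ib ii insert.hyps(2) by (auto simp: fun_upd_def)
      then show ?case by blast
    qed
  qed
  from this[OF order_refl] obtain r where "\<forall>b\<in>(Basis :: 'e set). \<forall>b'\<in>Basis. Q (r b) (r b') = b \<bullet> b'" ..
  then have r: "\<And>b b'. b \<in> Basis \<Longrightarrow> b' \<in> Basis \<Longrightarrow> Q (r b) (r b') = b \<bullet> (b' :: 'e)"
    by blast
  define R where "R = (\<lambda>x :: 'e. \<Sum>b\<in>Basis. (x \<bullet> b) *\<^sub>R r b)"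
  have linR: "linear R"
    unfolding R_def
    by (rule linearI) (simp_all add: inner_add_left scaleR_add_left sum.distrib scaleR_sum_right)
  have QR: "Q (R x) (R y) = x \<bullet> y" for x y
  proof -
    have R_eq: "R z = (\<Sum>b\<in>Basis. (z \<bullet> b) *\<^sub>R r b)" for z by (simp add: R_def)
    have "Q (R x) (R y) = (\<Sum>b\<in>Basis. (x \<bullet> b) * Q (r b) (R y))"
      unfolding R_eq[of x] by (simp only: linear_sum[OF lin(2)] linear_cmul[OF lin(2)] real_scaleR_def)
    also have "\<dots> = (\<Sum>b\<in>Basis. (x \<bullet> b) * (\<Sum>b'\<in>Basis. (y \<bullet> b') * Q (r b) (r b')))"
      unfolding R_eq[of y] by (simp only: linear_sum[OF lin(1)] linear_cmul[OF lin(1)] real_scaleR_def)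
    also have "\<dots> = (\<Sum>b\<in>Basis. (x \<bullet> b) * (\<Sum>b'\<in>Basis. if b' = b then y \<bullet> b else 0))"
      by (intro sum.cong refl arg_cong2[where f="(*)"]) (auto simp: r inner_Basis)
    also have "\<dots> = x \<bullet> y" by (simp add: euclidean_inner[of x y])
    finally show ?thesis .
  qed
  have "inj R"
  proof (subst linear_injective_0[OF linR], intro allI impI)
    fix x assume "R x = 0"
    then have "x \<bullet> x = 0" using QR[of x x] linear_0[OF lin(1)] by simp
    then show "x = 0" by simp
  qed
  from linear_injective_isomorphism[OF linR this]
  obtain R' where "linear R'" "\<forall>x. R' (R x) = x" "\<forall>x. R (R' x) = x" by blast
  with that[of R R'] linR QR show ?thesis by blast
qed

subsection \<open>Bounded groups of linear maps\<close>

definition bilinear_form :: "('e::euclidean_space \<Rightarrow> 'e \<Rightarrow> real) \<Rightarrow> bool"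
  where "bilinear_form q \<longleftrightarrow> (\<forall>x. linear (q x)) \<and> (\<forall>y. linear (\<lambda>x. q x y))"

text \<open>The squared Frobenius norm of the matrix of \<open>q\<close>. It comes from an inner
  product, so the parallelogram law is available.\<close>

definition form_norm2 :: "('e::euclidean_space \<Rightarrow> 'e \<Rightarrow> real) \<Rightarrow> real"
  where "form_norm2 q = (\<Sum>b\<in>Basis. \<Sum>b'\<in>Basis. (q b b')\<^sup>2)"

lemma form_norm2_nonneg: "form_norm2 q \<ge> 0"
  by (simp add: form_norm2_def sum_nonneg)

lemma bilinear_form_expand:
  assumes "bilinear_form q"
  shows "q x y = (\<Sum>b\<in>Basis. \<Sum>b'\<in>Basis. (x \<bullet> b) * (y \<bullet> b') * q b b')"
proof -
  have l: "linear (q x)" "linear (\<lambda>x. q x y)" for x y using assms by (auto simp: bilinear_form_def)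
  have "q x y = (\<Sum>b\<in>Basis. (x \<bullet> b) *\<^sub>R q b y)" by (rule linear_basis_expansion[OF l(2)])
  also have "\<dots> = (\<Sum>b\<in>Basis. (x \<bullet> b) *\<^sub>R (\<Sum>b'\<in>Basis. (y \<bullet> b') *\<^sub>R q b b'))"
    by (intro sum.cong refl arg_cong2[where f=scaleR] linear_basis_expansion[OF l(1)])
  finally show ?thesis by (simp add: sum_distrib_left mult.assoc)
qed

text \<open>Cauchy-Schwarz for the double sum in coordinates; \<open>DIM('e) ^ 2\<close> counts its
  terms.\<close>

lemma bilinear_form_bound:
  fixes q :: "'e::euclidean_space \<Rightarrow> 'e \<Rightarrow> real"
  assumes "bilinear_form q"
  shows "(q x y)\<^sup>2 \<le> (norm x)\<^sup>2 * (norm y)\<^sup>2 * DIM('e) ^ 2 * form_norm2 q"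
proof -
  let ?I = "(Basis :: 'e set) \<times> (Basis :: 'e set)"
  have "q x y = (\<Sum>(b, b')\<in>?I. (x \<bullet> b) * (y \<bullet> b') * q b b')"
    by (subst bilinear_form_expand[OF assms]) (simp add: sum.cartesian_product)
  then have "(q x y)\<^sup>2 \<le> (\<Sum>z\<in>?I. ((x \<bullet> fst z) * (y \<bullet> snd z) * q (fst z) (snd z))\<^sup>2) * card ?I"
    using sum_squared_le_sum_of_squares[of "\<lambda>z. (x \<bullet> fst z) * (y \<bullet> snd z) * q (fst z) (snd z)" ?I]
    by (simp add: case_prod_unfold)
  also have "\<dots> \<le> (\<Sum>z\<in>?I. (norm x)\<^sup>2 * (norm y)\<^sup>2 * (q (fst z) (snd z))\<^sup>2) * card ?I"
  proof (intro mult_right_mono sum_mono)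
    fix z assume z: "z \<in> ?I"
    have *: "(v \<bullet> b)\<^sup>2 \<le> (norm v)\<^sup>2" if "b \<in> Basis" for v b :: 'e
      using Basis_le_norm[OF that, of v] by (metis abs_le_square_iff abs_norm_cancel)
    have "((x \<bullet> fst z) * (y \<bullet> snd z) * q (fst z) (snd z))\<^sup>2 =
        ((x \<bullet> fst z)\<^sup>2 * (y \<bullet> snd z)\<^sup>2) * (q (fst z) (snd z))\<^sup>2"
      by (simp add: power_mult_distrib)
    also have "\<dots> \<le> ((norm x)\<^sup>2 * (norm y)\<^sup>2) * (q (fst z) (snd z))\<^sup>2"
      by (intro mult_right_mono mult_mono *) (use z in auto)
    finally show "((x \<bullet> fst z) * (y \<bullet> snd z) * q (fst z) (snd z))\<^sup>2 \<le> (norm x)\<^sup>2 * (norm y)\<^sup>2 * (q (fst z) (snd z))\<^sup>2" .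
  qed simp
  also have "\<dots> = (norm x)\<^sup>2 * (norm y)\<^sup>2 * DIM('e) ^ 2 * form_norm2 q"
    by (simp add: form_norm2_def sum_distrib_left sum_distrib_right sum.cartesian_product
        case_prod_unfold card_cartesian_product power2_eq_square mult_ac)
  finally show ?thesis .
qed

locale bounded_linear_group =
  fixes S :: "('e::euclidean_space \<Rightarrow> 'e) set" and C :: real
  assumes linear_S: "h \<in> S \<Longrightarrow> linear h"
    and ident_S: "(\<lambda>x. x) \<in> S"
    and compose_S: "h \<in> S \<Longrightarrow> k \<in> S \<Longrightarrow> (\<lambda>x. h (k x)) \<in> S"
    and inverse_S: "h \<in> S \<Longrightarrow> \<exists>k\<in>S. \<forall>x. h (k x) = x \<and> k (h x) = x"
    and bounded_S: "h \<in> S \<Longrightarrow> norm (h x) \<le> C * norm x"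
    and C_pos: "C > 0"
begin

abbreviation pull :: "('e \<Rightarrow> 'e \<Rightarrow> real) \<Rightarrow> ('e \<Rightarrow> 'e) \<Rightarrow> 'e \<Rightarrow> 'e \<Rightarrow> real"
  where "pull q h \<equiv> (\<lambda>x y. q (h x) (h y))"

text \<open>The domination clause has three purposes: boundedness of \<open>S\<close> puts the
  standard inner product into the set, quantifying over all of \<open>S\<close> makes the set
  invariant under \<open>pull\<close>, and the case of the identity map keeps limits positive
  definite.\<close>

definition K where "K = {q. bilinear_form q \<and> (\<forall>x y. q x y = q y x) \<and>
    (\<forall>h\<in>S. \<forall>x. (norm (h x))\<^sup>2 \<le> C\<^sup>2 * q x x)}"

text \<open>Taking the supremum over the orbit makes the size of a form invariant under
  \<open>S\<close>, while boundedness of \<open>S\<close> keeps it comparable with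
  \<open>form_norm2\<close>.\<close>

definition orbit_norm2 where "orbit_norm2 q = (SUP h\<in>S. form_norm2 (pull q h))"

text \<open>Pulling back along an element of \<open>S\<close> enlarges \<open>form_norm2\<close> at
  most by this factor. The first \<open>DIM('e) ^ 2\<close> counts matrix entries; the bracket is
  the bound of \<open>bilinear_form_bound\<close> for one entry, basis vectors being sent to vectors
  of norm at most \<open>C\<close>.\<close>

definition D :: real where "D = DIM('e) ^ 2 * (C ^ 4 * DIM('e) ^ 2)"

lemma D_pos: "D > 0" using C_pos by (simp add: D_def)

lemma bilinear_pull: "bilinear_form q \<Longrightarrow> h \<in> S \<Longrightarrow> bilinear_form (pull q h)"
  unfolding bilinear_form_def using linear_compose[OF linear_S, of h] by (auto simp: o_def)

lemma form_norm2_pull_le: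
  assumes q: "bilinear_form q" and h: "h \<in> S"
  shows "form_norm2 (pull q h) \<le> D * form_norm2 q"
proof -
  have "(q (h b) (h b'))\<^sup>2 \<le> C ^ 4 * DIM('e) ^ 2 * form_norm2 q" if "b \<in> Basis" "b' \<in> Basis" for b b'
  proof -
    have n: "(norm (h i))\<^sup>2 \<le> C\<^sup>2" if "i \<in> Basis" for i
      using bounded_S[OF h, of i] that by (simp add: power_mono)
    have "(q (h b) (h b'))\<^sup>2 \<le> ((norm (h b))\<^sup>2 * (norm (h b'))\<^sup>2) * (DIM('e) ^ 2 * form_norm2 q)"
      using bilinear_form_bound[OF q, of "h b" "h b'"] by (simp add: mult.assoc)
    also have "\<dots> \<le> (C\<^sup>2 * C\<^sup>2) * (DIM('e) ^ 2 * form_norm2 q)"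
      by (intro mult_right_mono mult_mono n that) (auto simp: form_norm2_nonneg)
    finally show ?thesis by (simp add: power2_eq_square power4_eq_xxxx mult.assoc)
  qed
  then have "form_norm2 (pull q h) \<le> (\<Sum>b\<in>(Basis::'e set). \<Sum>b'\<in>(Basis::'e set). C ^ 4 * DIM('e) ^ 2 * form_norm2 q)"
    unfolding form_norm2_def[of "pull q h"] by (intro sum_mono) auto
  then show ?thesis by (simp add: D_def power2_eq_square mult.assoc)
qed

lemma bdd_orbit: "bilinear_form q \<Longrightarrow> bdd_above ((\<lambda>h. form_norm2 (pull q h)) ` S)"
  using form_norm2_pull_le by (intro bdd_aboveI2)

text \<open>This is the preceding bound for pulling back along the inverse of
  \<open>h\<close>.\<close>

lemma form_norm2_le_pull:
  assumes q: "bilinear_form q" and h: "h \<in> S"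
  shows "form_norm2 q \<le> D * form_norm2 (pull q h)"
proof -
  obtain k where k: "k \<in> S" "\<And>x. h (k x) = x" using inverse_S[OF h] by blast
  show ?thesis using form_norm2_pull_le[OF bilinear_pull[OF q h] k(1)] by (simp add: k(2))
qed

lemma orbit_norm2_pull:
  assumes q: "bilinear_form q" and h: "h \<in> S"
  shows "orbit_norm2 (pull q h) = orbit_norm2 q"
proof -
  obtain k where k: "k \<in> S" "\<And>x. h (k x) = x" using inverse_S[OF h] by blast
  have "(\<lambda>g. form_norm2 (pull (pull q h) g)) ` S = (\<lambda>g. form_norm2 (pull q g)) ` S"
  proof (intro subset_antisym image_subsetI)
    fix g assume "g \<in> S"
    then show "form_norm2 (pull (pull q h) g) \<in> (\<lambda>g. form_norm2 (pull q g)) ` S"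
      using compose_S[OF h] by (intro image_eqI[where x="\<lambda>x. h (g x)"]) auto
    show "form_norm2 (pull q g) \<in> (\<lambda>g. form_norm2 (pull (pull q h) g)) ` S"
      using compose_S[OF k(1) \<open>g \<in> S\<close>] by (intro image_eqI[where x="\<lambda>x. k (g x)"]) (auto simp: k(2))
  qed
  then show ?thesis by (simp add: orbit_norm2_def)
qed

text \<open>The parallelogram law makes the invariant norm uniformly convex, so a minimising sequence
  over the invariant convex set \<open>K\<close> is Cauchy and its limit is invariant.  This replaces
  averaging over Haar measure.\<close>

lemma orbit_norm2_midpoint:
  assumes q: "bilinear_form q" and r: "bilinear_form r"
  shows "orbit_norm2 (\<lambda>x y. (q x y + r x y) / 2) \<le>
    (orbit_norm2 q + orbit_norm2 r) / 2 - form_norm2 (\<lambda>x y. q x y - r x y) / (4 * D)"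
proof -
  have bd: "bilinear_form (\<lambda>x y. q x y - r x y)"
    using q r unfolding bilinear_form_def by (auto intro!: linear_compose_sub)
  show ?thesis
    unfolding orbit_norm2_def[of "\<lambda>x y. (q x y + r x y) / 2"]
  proof (rule cSUP_least)
    show "S \<noteq> {}" using ident_S by blast
    fix h assume h: "h \<in> S"
    have "form_norm2 (pull (\<lambda>x y. (q x y + r x y) / 2) h) =
        (form_norm2 (pull q h) + form_norm2 (pull r h)) / 2 - form_norm2 (pull (\<lambda>x y. q x y - r x y) h) / 4"
    proof -
      have "((s + t) / 2)\<^sup>2 = (s\<^sup>2 + t\<^sup>2) / 2 - (s - t)\<^sup>2 / 4" for s t :: real
        by (simp add: power2_eq_square field_simps)
      then show ?thesis
        by (simp add: form_norm2_def sum.distrib sum_subtractf sum_divide_distrib add_divide_distrib)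
    qed
    also have "\<dots> \<le> (orbit_norm2 q + orbit_norm2 r) / 2 - form_norm2 (\<lambda>x y. q x y - r x y) / (4 * D)"
    proof -
      have "form_norm2 (pull q h) \<le> orbit_norm2 q" "form_norm2 (pull r h) \<le> orbit_norm2 r"
        unfolding orbit_norm2_def by (intro cSUP_upper h bdd_orbit q r)+
      \<comment> \<open>The loss in the parallelogram law has a lower bound independent of
        \<open>h\<close>, so it survives the supremum.\<close>
      moreover have "form_norm2 (\<lambda>x y. q x y - r x y) / (4 * D) \<le> form_norm2 (pull (\<lambda>x y. q x y - r x y) h) / 4"
        using form_norm2_le_pull[OF bd h] D_pos by (simp add: field_simps)
      ultimately show ?thesis by (simp add: add_mono diff_mono divide_right_mono)
    qed
    finally show "form_norm2 (pull (\<lambda>x y. (q x y + r x y) / 2) h) \<le> \<dots>" .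
  qed
qed

lemma K_pull:
  assumes q: "q \<in> K" and h: "h \<in> S"
  shows "pull q h \<in> K"
proof -
  obtain k where k: "k \<in> S" "\<And>x. k (h x) = x" using inverse_S[OF h] by blast
  \<comment> \<open>With \<open>k\<close> inverse to \<open>h\<close>, the domination clause is
    applied to \<open>g\<close> composed with \<open>k\<close>, at the point
    \<open>h x\<close>.\<close>
  have "(norm (g x))\<^sup>2 \<le> C\<^sup>2 * q (h x) (h x)" if "g \<in> S" for g x
  proof -
    have "\<forall>h\<in>S. \<forall>x. (norm (h x))\<^sup>2 \<le> C\<^sup>2 * q x x" using q by (simp add: K_def)
    from bspec[OF this compose_S[OF that k(1)]] have "(norm (g (k (h x))))\<^sup>2 \<le> C\<^sup>2 * q (h x) (h x)" by simp
    then show ?thesis by (simp add: k(2))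
  qed
  then show ?thesis using q bilinear_pull[OF _ h] by (auto simp: K_def)
qed

lemma K_midpoint:
  assumes "q \<in> K" "r \<in> K"
  shows "(\<lambda>x y. (q x y + r x y) / 2) \<in> K"
proof -
  have half: "linear (\<lambda>x. f x / 2)" if "linear f" for f :: "'e \<Rightarrow> real"
    using linear_compose_scale_right[OF that, of "1/2"] by simp
  have "bilinear_form (\<lambda>x y. (q x y + r x y) / 2)"
    using assms by (auto simp: K_def bilinear_form_def intro!: half linear_compose_add)
  moreover have "(norm (h x))\<^sup>2 \<le> C\<^sup>2 * ((q x x + r x x) / 2)" if "h \<in> S" for h x
  proof -
    have "(norm (h x))\<^sup>2 \<le> C\<^sup>2 * q x x" "(norm (h x))\<^sup>2 \<le> C\<^sup>2 * r x x"
      using assms that by (auto simp: K_def)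
    then show ?thesis by (simp add: distrib_left)
  qed
  ultimately show ?thesis using assms by (auto simp: K_def)
qed

lemma K_nonempty: "(\<lambda>x y. x \<bullet> y) \<in> K"
proof -
  have "(norm (h x))\<^sup>2 \<le> C\<^sup>2 * (x \<bullet> x)" if "h \<in> S" for h x
    using power_mono[OF bounded_S[OF that, of x], of 2] by (simp add: power_mult_distrib power2_norm_eq_inner)
  moreover have "bilinear_form (\<lambda>x y::'e. x \<bullet> y)"
    by (auto simp: bilinear_form_def intro!: bounded_linear.linear bounded_linear_inner_left bounded_linear_inner_right)
  ultimately show ?thesis by (simp add: K_def inner_commute)
qed

theorem invariant_inner_form:
  obtains Q where "inner_form Q" "\<And>h x y. h \<in> S \<Longrightarrow> Q (h x) (h y) = Q x y"
proof -
  define m where "m = (INF q\<in>K. orbit_norm2 q)"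
  have bK: "bilinear_form q" if "q \<in> K" for q using that by (simp add: K_def)
  have nonneg: "orbit_norm2 q \<ge> 0" if "q \<in> K" for q
    unfolding orbit_norm2_def
    by (rule cSUP_upper2[OF bdd_orbit[OF bK[OF that]] ident_S form_norm2_nonneg])
  have bdd: "bdd_below (orbit_norm2 ` K)" using nonneg by (intro bdd_belowI2[of _ 0])
  have lower: "m \<le> orbit_norm2 q" if "q \<in> K" for q unfolding m_def by (rule cINF_lower[OF bdd that])
  have "\<exists>q\<in>K. orbit_norm2 q < m + 1 / Suc n" for n
  proof -
    have "Inf (orbit_norm2 ` K) < m + 1 / Suc n" by (simp add: m_def)
    then show ?thesis using cInf_lessD[of "orbit_norm2 ` K"] K_nonempty by blast
  qed
  then obtain q where q: "\<And>n. q n \<in> K" "\<And>n. orbit_norm2 (q n) < m + 1 / Suc n" by metis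
  \<comment> \<open>Two nearly minimal forms are close: their midpoint lies in \<open>K\<close> and
    cannot fall below \<open>m\<close>, which bounds the loss term.\<close>
  have close: "form_norm2 (\<lambda>x y. r x y - s x y) \<le> 4 * D * \<epsilon>"
    if "r \<in> K" "s \<in> K" "orbit_norm2 r \<le> m + \<epsilon>" "orbit_norm2 s \<le> m + \<epsilon>" for r s \<epsilon>
  proof -
    have cancel: "t \<le> \<epsilon>" if "m \<le> (a + b) / 2 - t" "a \<le> m + \<epsilon>" "b \<le> m + \<epsilon>" for a b t
      using that by argo
    have "m \<le> (orbit_norm2 r + orbit_norm2 s) / 2 - form_norm2 (\<lambda>x y. r x y - s x y) / (4 * D)"
      using lower[OF K_midpoint[OF that(1,2)]] orbit_norm2_midpoint[OF bK[OF that(1)] bK[OF that(2)]] by simp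
    from cancel[OF this that(3,4)] have "form_norm2 (\<lambda>x y. r x y - s x y) / (4 * D) \<le> \<epsilon>" .
    then show ?thesis using D_pos by (simp add: field_simps)
  qed
  have pt: "(r x y - s x y)\<^sup>2 \<le> ((norm x)\<^sup>2 * (norm y)\<^sup>2 * DIM('e) ^ 2 * (4 * D)) * \<epsilon>"
    if "r \<in> K" "s \<in> K" "orbit_norm2 r \<le> m + \<epsilon>" "orbit_norm2 s \<le> m + \<epsilon>" for r s \<epsilon> x y
  proof -
    have "bilinear_form (\<lambda>x y. r x y - s x y)"
      using bK[OF that(1)] bK[OF that(2)] unfolding bilinear_form_def by (auto intro!: linear_compose_sub)
    from bilinear_form_bound[OF this, of x y]
    have "(r x y - s x y)\<^sup>2 \<le> ((norm x)\<^sup>2 * (norm y)\<^sup>2 * DIM('e) ^ 2) * form_norm2 (\<lambda>x y. r x y - s x y)" .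
    also have "\<dots> \<le> ((norm x)\<^sup>2 * (norm y)\<^sup>2 * DIM('e) ^ 2) * (4 * D * \<epsilon>)"
      by (intro mult_left_mono close that) simp
    finally show ?thesis by (simp add: mult.assoc)
  qed
  have tail: "orbit_norm2 (q j) \<le> m + 1 / Suc n" if "j \<ge> n" for j n
  proof -
    have "1 / Suc j \<le> 1 / real (Suc n)" using that by (intro divide_left_mono) auto
    then show ?thesis using q(2)[of j] by linarith
  qed
  have small: "\<exists>n. k * (1 / Suc n) < e" if "e > 0" for k e :: real
  proof -
    have "(\<lambda>n. k * (1 / Suc n)) \<longlonglongrightarrow> k * 0"
      by (intro tendsto_mult tendsto_const LIMSEQ_Suc[OF lim_1_over_n])
    then have "\<forall>\<^sub>F n in sequentially. k * (1 / Suc n) < e" using that by (simp add: order_tendstoD)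
    then show ?thesis by (auto simp: eventually_sequentially)
  qed
  have "Cauchy (\<lambda>n. q n x y)" for x y
  proof (rule metric_CauchyI)
    fix e :: real assume e: "e > 0"
    then obtain n where n: "((norm x)\<^sup>2 * (norm y)\<^sup>2 * DIM('e) ^ 2 * (4 * D)) * (1 / Suc n) < e\<^sup>2"
      using small[of "e\<^sup>2"] by auto
    have "dist (q i x y) (q j x y) < e" if "i \<ge> n" "j \<ge> n" for i j
    proof -
      have "(q i x y - q j x y)\<^sup>2 < e\<^sup>2"
        using pt[OF q(1) q(1) tail[OF that(1)] tail[OF that(2)], of x y] n by linarith
      then show ?thesis using e by (metis dist_real_def abs_le_square_iff abs_of_pos not_less)
    qed
    then show "\<exists>M. \<forall>i\<ge>M. \<forall>j\<ge>M. dist (q i x y) (q j x y) < e" by blast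
  qed
  then have "\<exists>l. (\<lambda>n. q n x y) \<longlonglongrightarrow> l" for x y
    using Cauchy_convergent convergent_def by blast
  then obtain Q where Q: "\<And>x y. (\<lambda>n. q n x y) \<longlonglongrightarrow> Q x y" by metis
  have qlin: "linear (q n x)" "linear (\<lambda>x. q n x y)" for n x y
    using bK[OF q(1)[of n]] by (auto simp: bilinear_form_def)
  have "inner_form Q"
    unfolding inner_form_def
  proof (intro conjI allI impI)
    show "linear (Q x)" for x
    proof (rule linearI)
      fix y z r
      have "(\<lambda>n. q n x (y + z)) \<longlonglongrightarrow> Q x y + Q x z"
        using tendsto_add[OF Q[of x y] Q[of x z]] by (simp add: linear_add[OF qlin(1)])
      then show "Q x (y + z) = Q x y + Q x z" using Q LIMSEQ_unique by blast
      have "(\<lambda>n. q n x (r *\<^sub>R y)) \<longlonglongrightarrow> r *\<^sub>R Q x y"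
        using tendsto_scaleR[OF tendsto_const Q[of x y]] by (simp add: linear_cmul[OF qlin(1)])
      then show "Q x (r *\<^sub>R y) = r *\<^sub>R Q x y" using Q LIMSEQ_unique by blast
    qed
    show "Q x y = Q y x" for x y
    proof -
      have "(\<lambda>n. q n x y) = (\<lambda>n. q n y x)" using q(1) by (auto simp: K_def)
      then show ?thesis using Q[of x y] Q[of y x] LIMSEQ_unique by metis
    qed
    show "0 < Q x x" if "x \<noteq> 0" for x
    proof -
      \<comment> \<open>The identity belongs to \<open>S\<close>; its domination inequality passes
        to the limit and keeps \<open>Q\<close> positive definite.\<close>
      have "(norm x)\<^sup>2 \<le> C\<^sup>2 * q n x x" for n using q(1)[of n] ident_S by (auto simp: K_def)
      then have "(norm x)\<^sup>2 \<le> C\<^sup>2 * Q x x"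
        by (intro tendsto_lowerbound[OF tendsto_mult[OF tendsto_const Q]]) auto
      moreover have "(norm x)\<^sup>2 > 0" using that by simp
      ultimately have "0 < C\<^sup>2 * Q x x" by linarith
      then show ?thesis using C_pos by (simp add: zero_less_mult_iff)
    qed
  qed
  moreover have "Q (h x) (h y) = Q x y" if h: "h \<in> S" for h x y
  proof -
    let ?k = "(norm x)\<^sup>2 * (norm y)\<^sup>2 * DIM('e) ^ 2 * (4 * D)"
    \<comment> \<open>\<open>q n\<close> and its pullback have the same orbit norm, so they are
      equally close to minimal and, by \<open>pt\<close>, close to each other.\<close>
    have b: "(pull (q n) h x y - q n x y)\<^sup>2 \<le> ?k * (1 / Suc n)" for n
      by (rule pt[OF K_pull[OF q(1) h] q(1)]) (use tail[of n n] orbit_norm2_pull[OF bK[OF q(1)] h] in auto)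
    have "(\<lambda>n. (q n (h x) (h y) - q n x y)\<^sup>2) \<longlonglongrightarrow> (Q (h x) (h y) - Q x y)\<^sup>2"
      by (intro tendsto_power tendsto_diff Q)
    moreover have "(\<lambda>n. ?k * (1 / Suc n)) \<longlonglongrightarrow> ?k * 0"
      by (intro tendsto_mult tendsto_const LIMSEQ_Suc[OF lim_1_over_n])
    ultimately have "(Q (h x) (h y) - Q x y)\<^sup>2 \<le> ?k * 0"
      by (rule LIMSEQ_le) (use b in auto)
    then show ?thesis by simp
  qed
  ultimately show ?thesis by (rule that)
qed

end

subsection \<open>Traces\<close>

definition trace_of :: "('e::euclidean_space \<Rightarrow> 'e) \<Rightarrow> real"
  where "trace_of A = (\<Sum>b\<in>Basis. A b \<bullet> b)"

lemma trace_of_commute: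
  fixes A B :: "'e::euclidean_space \<Rightarrow> 'e"
  assumes "linear A" "linear B"
  shows "trace_of (\<lambda>x. A (B x)) = trace_of (\<lambda>x. B (A x))"
proof -
  have expand: "A (B b) \<bullet> b = (\<Sum>b'\<in>Basis. (B b \<bullet> b') * (A b' \<bullet> b))" if "linear A" for A B :: "'e \<Rightarrow> 'e" and b
    by (subst linear_basis_expansion[OF that]) (simp add: inner_sum_left)
  have "trace_of (\<lambda>x. A (B x)) = (\<Sum>b\<in>Basis. \<Sum>b'\<in>Basis. (B b \<bullet> b') * (A b' \<bullet> b))"
    by (simp only: trace_of_def expand[OF assms(1)])
  also have "\<dots> = (\<Sum>b'\<in>Basis. \<Sum>b\<in>Basis. (A b' \<bullet> b) * (B b \<bullet> b'))"
    by (subst sum.swap) (simp add: mult.commute)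
  also have "\<dots> = trace_of (\<lambda>x. B (A x))"
    by (simp only: trace_of_def expand[OF assms(2)])
  finally show ?thesis .
qed

text \<open>In \<open>Q\<close>-orthonormal coordinates the map is an ordinary skew matrix, and the
  trace of its square is minus the sum of the squared norms of its columns; conjugation does not
  change the trace.\<close>

lemma skew_trace_square:
  fixes A :: "'e::euclidean_space \<Rightarrow> 'e"
  assumes Q: "inner_form Q" and A: "linear A" and skew: "\<And>x y. Q (A x) y = - Q x (A y)"
  shows "trace_of (\<lambda>x. A (A x)) \<le> 0" and "trace_of (\<lambda>x. A (A x)) = 0 \<Longrightarrow> A x = 0"
proof -
  obtain R R' :: "'e \<Rightarrow> 'e" where R: "linear R" "linear R'" "\<And>x. R (R' x) = x" "\<And>x. R' (R x) = x"
    "\<And>x y. Q (R x) (R y) = x \<bullet> y" by (rule inner_form_orthonormal_basis[OF Q]) (rule that, assumption+)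
  define N where "N = (\<lambda>x. R' (A (R x)))"
  have skewN: "N x \<bullet> y = - (x \<bullet> N y)" for x y
    using skew[of "R x" "R y"] by (simp add: N_def R(3) flip: R(5))
  have NN: "linear (\<lambda>x. A (A (R x)))"
    using linear_compose[OF linear_compose[OF R(1) A] A] by (simp add: o_def)
  have "trace_of (\<lambda>x. A (A x)) = trace_of (\<lambda>x. A (A (R (R' x))))" by (simp add: R(3))
  also have "\<dots> = trace_of (\<lambda>x. R' (A (A (R x))))" by (rule trace_of_commute[OF NN R(2)])
  also have "\<dots> = trace_of (\<lambda>x. N (N x))" by (simp add: N_def R(3))
  also have "\<dots> = - (\<Sum>b\<in>Basis. (norm (N b))\<^sup>2)"
    by (simp add: trace_of_def skewN[of "N _"] power2_norm_eq_inner sum_negf)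
  finally have tr: "trace_of (\<lambda>x. A (A x)) = - (\<Sum>b\<in>Basis. (norm (N b))\<^sup>2)" .
  show "trace_of (\<lambda>x. A (A x)) \<le> 0" unfolding tr by (simp add: sum_nonneg)
  assume "trace_of (\<lambda>x. A (A x)) = 0"
  then have "N b = 0" if "b \<in> Basis" for b
    using that unfolding tr by (simp add: sum_nonneg_eq_0_iff)
  moreover have "linear N" using linear_compose[OF linear_compose[OF R(1) A] R(2)] by (simp add: N_def o_def)
  ultimately have "N z = 0" for z by (subst linear_basis_expansion[of N]) auto
  from this[of "R' x"] have "R' (A x) = 0" by (simp add: N_def R(3))
  then show "A x = 0" using R(3)[of "A x"] linear_0[OF R(1)] by simp
qed

subsection \<open>Skew maps with a single frequency\<close>

text \<open>A minimum at \<open>t = 0\<close> has vanishing first derivative. The test value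
  \<open>t = - a / k\<close>, with \<open>k\<close> larger than \<open>\<bar>b\<bar>\<close>, is
  small enough for the linear term to win.\<close>

lemma quadratic_nonneg_imp_linear_zero:
  fixes a b :: real
  assumes nonneg: "\<And>t. 0 \<le> 2 * t * a + t\<^sup>2 * b"
  shows "a = 0"
proof (rule ccontr)
  assume a: "a \<noteq> 0"
  define k where "k = \<bar>b\<bar> + 1"
  have k: "k > 0" "b < k" by (auto simp: k_def)
  have "0 \<le> 2 * (- a / k) * a + (- a / k)\<^sup>2 * b" by (rule nonneg)
  also have "\<dots> = (a\<^sup>2 / k) * (b / k - 2)" using k by (simp add: field_simps power2_eq_square)
  finally have F: "0 \<le> (a\<^sup>2 / k) * (b / k - 2)" .
  have pos: "0 < a\<^sup>2 / k" using a k by simp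
  have "b / k \<ge> 2"
  proof (rule ccontr)
    assume "\<not> b / k \<ge> 2"
    then have "(a\<^sup>2 / k) * (b / k - 2) < 0" by (intro mult_pos_neg pos) simp
    then show False using F by simp
  qed
  moreover have "b / k < 1" using k by simp
  ultimately show False by simp
qed

text \<open>A variational substitute for diagonalisation. If the vectors satisfying the identity did
  not fill the space, \<open>N\<close> would act on their orthogonal complement, and a unit vector
  there maximising \<open>norm (N x)\<close> would be an eigenvector of the square of
  \<open>N\<close>, which puts it back among them.\<close>

lemma skew_single_frequency:
  fixes N :: "'e::euclidean_space \<Rightarrow> 'e"
  assumes N: "linear N" and skew: "\<And>x y. N x \<bullet> y = - (x \<bullet> N y)"
    and freq: "\<And>x \<beta>. x \<noteq> 0 \<Longrightarrow> \<beta> > 0 \<Longrightarrow> N (N x) = - (\<beta>\<^sup>2) *\<^sub>R x \<Longrightarrow> \<beta> = \<bar>\<alpha>\<bar>"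
  shows "N (N (N x)) = - (\<alpha>\<^sup>2) *\<^sub>R N x"
proof -
  define K where "K = {x. N (N (N x)) = - (\<alpha>\<^sup>2) *\<^sub>R N x}"
  have subK: "subspace K"
    unfolding K_def by (rule subspaceI)
      (simp_all add: linear_0[OF N] linear_add[OF N] linear_cmul[OF N] scaleR_add_right)
  have NK: "N x \<in> K" if "x \<in> K" for x using that by (simp add: K_def linear_cmul[OF N] linear_neg[OF N])
  have "K = UNIV"
  proof (rule ccontr)
    assume "K \<noteq> UNIV"
    then have "span K \<noteq> UNIV" using subK by (simp add: span_eq_iff[THEN iffD2])
    then have "dim K \<noteq> DIM('e)" by (simp add: dim_eq_full)
    then have "dim K < DIM('e)" using dim_subset_UNIV[of K] by simp
    then obtain y where y: "y \<noteq> 0" "\<And>x. x \<in> span K \<Longrightarrow> orthogonal y x"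
      using orthogonal_to_subspace_exists[of K] by blast
    define W where "W = {y. \<forall>x\<in>K. x \<bullet> y = 0}"
    have subW: "subspace W" unfolding W_def by (rule subspaceI) (auto simp: inner_add_right)
    have NW: "N y \<in> W" if "y \<in> W" for y
    proof -
      have "x \<bullet> N y = 0" if "x \<in> K" for x
        using \<open>y \<in> W\<close> NK[OF that] skew[of x y] by (simp add: W_def)
      then show ?thesis by (simp add: W_def)
    qed
    have yW: "y \<in> W" using y(2) span_base[of _ K] by (auto simp: W_def orthogonal_def inner_commute)
    let ?S = "W \<inter> sphere 0 1"
    have "compact ?S" by (intro closed_Int_compact closed_subspace[OF subW] compact_sphere)
    moreover have "(1 / norm y) *\<^sub>R y \<in> ?S" using yW y(1) subspace_mul[OF subW] by simp
    then have "?S \<noteq> {}" by blast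
    moreover have "continuous_on ?S (\<lambda>x. (norm (N x))\<^sup>2)"
      using N by (intro continuous_intros linear_continuous_on) (simp add: linear_conv_bounded_linear)
    ultimately have "\<exists>x\<in>?S. \<forall>z\<in>?S. (norm (N z))\<^sup>2 \<le> (norm (N x))\<^sup>2"
      by (rule continuous_attains_sup)
    then obtain x where x: "x \<in> ?S" "\<forall>z\<in>?S. (norm (N z))\<^sup>2 \<le> (norm (N x))\<^sup>2" ..
    define l where "l = (norm (N x))\<^sup>2"
    have xW: "x \<in> W" and nx: "norm x = 1" using x(1) by auto
    have p: "0 \<le> l * (z \<bullet> z) - N z \<bullet> N z" if "z \<in> W" for z
    proof (cases "z = 0")
      case False
      have "(1 / norm z) *\<^sub>R z \<in> ?S" using that False subspace_mul[OF subW] by simp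
      from x(2)[rule_format, OF this] have "(norm (N z))\<^sup>2 / (norm z)\<^sup>2 \<le> l"
        by (simp add: l_def linear_cmul[OF N] power_divide power_mult_distrib)
      then show ?thesis using False by (simp add: field_simps flip: power2_norm_eq_inner)
    qed (simp add: linear_0[OF N])
    \<comment> \<open>Half the gradient at \<open>x\<close> of the quadratic form in
      \<open>p\<close>, which is nonnegative on \<open>W\<close> and 0 at \<open>x\<close>. Moving
      from \<open>x\<close> along \<open>z\<close>, the linear coefficient is
      \<open>z \<bullet> z\<close> and must vanish.\<close>
    define z where "z = l *\<^sub>R x + N (N x)"
    have zW: "z \<in> W" unfolding z_def by (intro subspace_add[OF subW] subspace_mul[OF subW] NW xW)
    have "0 \<le> 2 * t * (l * (x \<bullet> z) - N x \<bullet> N z) + t\<^sup>2 * (l * (z \<bullet> z) - N z \<bullet> N z)" for t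
    proof -
      have "x + t *\<^sub>R z \<in> W" by (intro subspace_add[OF subW] subspace_mul[OF subW] xW zW)
      from p[OF this] show ?thesis
        using nx by (simp add: linear_add[OF N] linear_cmul[OF N] inner_add_left inner_add_right inner_commute
            power2_eq_square algebra_simps l_def norm_eq_1 power2_norm_eq_inner[unfolded power2_eq_square])
    qed
    then have "l * (x \<bullet> z) - N x \<bullet> N z = 0" by (rule quadratic_nonneg_imp_linear_zero)
    then have "z \<bullet> z = 0" using skew[of "N x" z] by (simp add: z_def inner_add_left)
    then have NNx: "N (N x) = - l *\<^sub>R x" by (simp add: z_def add_eq_0_iff)
    have "x \<in> K"
    proof (cases "l = 0")
      case True
      then show ?thesis by (simp add: l_def K_def linear_0[OF N])
    next
      case False
      then have l: "l > 0" by (simp add: l_def)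
      then have "sqrt l = \<bar>\<alpha>\<bar>" using freq[of x "sqrt l"] NNx nx by fastforce
      then have "l = \<alpha>\<^sup>2" using l by (metis abs_of_pos power2_abs real_sqrt_pow2_iff less_imp_le)
      then show ?thesis using NNx by (simp add: K_def linear_cmul[OF N] linear_neg[OF N])
    qed
    then have "x \<bullet> x = 0" using xW by (simp add: W_def)
    then show False using nx by simp
  qed
  then show ?thesis by (auto simp: K_def)
qed

text \<open>Preservation of \<open>B\<close> makes the generator skew. The frequency hypothesis
  concerns eigenvectors \<open>x + i y\<close> of \<open>M\<close> for \<open>i \<beta>\<close> and
  leaves only the frequency \<open>\<bar>\<alpha>\<bar>\<close>, so the cube of \<open>M\<close> is
  \<open>- \<alpha>^2 M\<close> and the flow is trigonometric.\<close>

lemma isometric_flow_periodic: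
  fixes E :: "real \<Rightarrow> 'e::euclidean_space \<Rightarrow> 'e"
  assumes B: "inner_form B"
    and E: "\<And>t. linear (E t)" "\<And>s t x. E (s + t) x = E s (E t x)" "\<And>x. E 0 x = x"
    and isometric: "\<And>t x y. B (E t x) (E t y) = B x y"
    and M: "\<And>x. ((\<lambda>t. E t x) has_vector_derivative M x) (at 0)"
    and freq: "\<And>x y \<beta>. x \<noteq> 0 \<Longrightarrow> \<beta> > 0 \<Longrightarrow> M x = - \<beta> *\<^sub>R y \<Longrightarrow> M y = \<beta> *\<^sub>R x \<Longrightarrow> \<beta> = \<bar>\<alpha>\<bar>"
  shows "\<exists>T>0. \<forall>x. E T x = x"
proof -
  have linM: "linear M"
  proof (rule linearI)
    fix x y r
    have "((\<lambda>t. E t (x + y)) has_vector_derivative M x + M y) (at 0)"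
      using has_vector_derivative_add[OF M M, of x y] by (simp add: linear_add[OF E(1)])
    then show "M (x + y) = M x + M y" using M vector_derivative_unique_at by blast
    have "((\<lambda>t. E t (r *\<^sub>R x)) has_vector_derivative r *\<^sub>R M x) (at 0)"
      using bounded_linear.has_vector_derivative[OF bounded_linear_scaleR_right[of r] M, of x]
      by (simp add: linear_cmul[OF E(1)])
    then show "M (r *\<^sub>R x) = r *\<^sub>R M x" using M vector_derivative_unique_at by blast
  qed
  have bil: "bounded_bilinear B"
    unfolding bilinear_conv_bounded_bilinear[symmetric] bilinear_def
    using inner_form_linear[OF B] by simp
  have skewM: "B (M x) y = - B x (M y)" for x y
  proof -
    have "((\<lambda>t. B (E t x) (E t y)) has_vector_derivative B (E 0 x) (M y) + B (M x) (E 0 y)) (at 0)"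
      by (rule bounded_bilinear.has_vector_derivative[OF bil M M])
    then have "((\<lambda>t. B x y) has_vector_derivative B x (M y) + B (M x) y) (at 0)"
      by (simp add: isometric E(3))
    moreover have "((\<lambda>t::real. B x y) has_vector_derivative 0) (at 0)" by (rule has_vector_derivative_const)
    ultimately have "B x (M y) + B (M x) y = 0" by (rule vector_derivative_unique_at)
    then show ?thesis by simp
  qed
  obtain R R' :: "'e \<Rightarrow> 'e" where R: "linear R" "linear R'" "\<And>x. R (R' x) = x" "\<And>x. R' (R x) = x"
    "\<And>x y. B (R x) (R y) = x \<bullet> y" by (rule inner_form_orthonormal_basis[OF B]) (rule that, assumption+)
  define N where "N = (\<lambda>x. R' (M (R x)))"
  have RN: "R (N x) = M (R x)" for x by (simp add: N_def R(3))
  have linN: "linear N" using linear_compose[OF linear_compose[OF R(1) linM] R(2)] by (simp add: N_def o_def)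
  have skewN: "N x \<bullet> y = - (x \<bullet> N y)" for x y
    using skewM[of "R x" "R y"] by (simp add: RN flip: R(5))
  have "N (N (N x)) = - (\<alpha>\<^sup>2) *\<^sub>R N x" for x
  proof (rule skew_single_frequency[OF linN skewN])
    fix x \<beta> assume x: "x \<noteq> 0" "\<beta> > (0::real)" "N (N x) = - (\<beta>\<^sup>2) *\<^sub>R x"
    have "R x \<noteq> 0" using x(1) R(4)[of x] linear_0[OF R(2)] by auto
    moreover have "M (M (R x)) = - (\<beta>\<^sup>2) *\<^sub>R R x"
      using arg_cong[OF x(3), of R] by (simp add: RN linear_cmul[OF R(1)] linear_neg[OF R(1)])
    \<comment> \<open>The vector \<open>y = - (1 / \<beta>) M (R x)\<close> completes
      \<open>R x\<close> to the complex eigenvector \<open>R x + i y\<close> for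
      \<open>i \<beta>\<close>.\<close>
    ultimately show "\<beta> = \<bar>\<alpha>\<bar>"
      using x(2) freq[of "R x" \<beta> "- (1 / \<beta>) *\<^sub>R M (R x)"]
      by (simp add: linear_cmul[OF linM] linear_neg[OF linM] power2_eq_square)
  qed
  then have "R (N (N (N (R' x)))) = R (- (\<alpha>\<^sup>2) *\<^sub>R N (R' x))" for x by simp
  then have M3: "M (M (M x)) = - (\<alpha>\<^sup>2) *\<^sub>R M x" for x
    by (simp add: RN R(3) linear_cmul[OF R(1)] linear_neg[OF R(1)])
  \<comment> \<open>By the group law, the linear map \<open>E t\<close> carries the derivative at
    time 0 to time \<open>t\<close>.\<close>
  have der: "((\<lambda>s. E s x) has_vector_derivative E t (M x)) (at t)" for t x
  proof -
    have "((\<lambda>s. s - t) has_vector_derivative 1) (at t)" by (auto intro!: derivative_eq_intros)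
    moreover have "((\<lambda>s. E s x) has_vector_derivative M x) (at (t - t))" using M by simp
    ultimately have "((\<lambda>s. E (s - t) x) has_vector_derivative M x) (at t)"
      using vector_diff_chain_at[of "\<lambda>s. s - t" 1 t "\<lambda>s. E s x" "M x"] by (simp add: o_def)
    from bounded_linear.has_vector_derivative[OF _ this, of "E t"] E(1)
    have "((\<lambda>s. E t (E (s - t) x)) has_vector_derivative E t (M x)) (at t)"
      by (simp add: linear_conv_bounded_linear)
    then show ?thesis by (simp flip: E(2))
  qed
  \<comment> \<open>Solutions of the reversed equation undo the flow: the derivative of
    \<open>E t (z t)\<close> is \<open>E t (M (z t)) + E t (- M (z t)) = 0\<close>. This takes the
    place of a uniqueness theorem for differential equations.\<close>
  have const: "E T (z T) = z 0" if z: "\<And>t. (z has_vector_derivative - M (z t)) (at t)" for z and T :: real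
  proof -
    have "((\<lambda>t. E t (z t)) has_vector_derivative 0) (at t)" for t
    proof -
      have zb: "((\<lambda>t. z t \<bullet> b) has_vector_derivative (- M (z t)) \<bullet> b) (at t)" for b
        by (rule bounded_linear.has_vector_derivative[OF bounded_linear_inner_left z])
      have "((\<lambda>t. \<Sum>b\<in>Basis. (z t \<bullet> b) *\<^sub>R E t b) has_vector_derivative
          (\<Sum>b\<in>Basis. (z t \<bullet> b) *\<^sub>R E t (M b) + ((- M (z t)) \<bullet> b) *\<^sub>R E t b)) (at t)"
        by (intro has_vector_derivative_sum
            bounded_bilinear.has_vector_derivative[OF bounded_bilinear_scaleR zb der])
      also have "(\<lambda>t. \<Sum>b\<in>Basis. (z t \<bullet> b) *\<^sub>R E t b) = (\<lambda>t. E t (z t))"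
        by (intro ext linear_basis_expansion[OF E(1), symmetric])
      also have "(\<Sum>b\<in>Basis. (z t \<bullet> b) *\<^sub>R E t (M b) + ((- M (z t)) \<bullet> b) *\<^sub>R E t b) =
          E t (M (z t)) + E t (- M (z t))"
        using linear_basis_expansion[OF E(1), of t "- M (z t)"]
          linear_basis_expansion[OF linear_compose[OF linM E(1)], of t "z t"]
        by (simp add: sum_subtractf sum_negf o_def)
      also have "\<dots> = 0" by (simp add: linear_neg[OF E(1)])
      finally show ?thesis .
    qed
    then obtain k where "\<And>t. t \<in> UNIV \<Longrightarrow> E t (z t) = k"
      using has_vector_derivative_zero_constant[of UNIV "\<lambda>t. E t (z t)"] by auto
    then show ?thesis using E(3) by (metis UNIV_I)
  qed
  show ?thesis
  proof (cases "\<alpha> = 0")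
    case True
    \<comment> \<open>For \<alpha> = 0 the map is skew and nilpotent, hence 0: skewness turns
      \<open>N (N (N x)) = 0\<close> into \<open>N (N x) = 0\<close>, and this into
      \<open>N x = 0\<close>. Every time is then a period, and 1 is taken.\<close>
    have N3: "N (N (N x)) = 0" for x
      using M3 True by (simp add: N_def R(3) linear_0[OF R(2)])
    have N2: "N (N x) = 0" for x
      using skewN[of "N x" "N (N x)"] N3 by (simp add: linear_0[OF linN])
    have "N x = 0" for x using skewN[of x "N x"] N2 by simp
    then have "M x = 0" for x using RN[of "R' x"] R(3) linear_0[OF R(1)] by simp
    then show ?thesis using const[of "\<lambda>_. x" 1 for x]
      by (intro exI[of _ 1]) (auto intro: has_vector_derivative_const)
  next
    case False
    define T where "T = 2 * pi / \<bar>\<alpha>\<bar>"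
    have T: "T > 0" using False by (simp add: T_def)
    have "\<alpha> * T = 2 * pi \<or> \<alpha> * T = - (2 * pi)" using False by (auto simp: T_def abs_if)
    then have trig: "sin (\<alpha> * T) = 0" "cos (\<alpha> * T) = 1" by auto
    have "E T x = x" for x
    proof -
      \<comment> \<open>This is \<open>exp (- t M) x\<close>, the power series being summed with
        \<open>M (M (M x)) = - \<alpha>^2 M x\<close>. Both coefficients vanish at
        \<open>t = 0\<close> and at \<open>t = T\<close>.\<close>
      define z where "z t = x - (sin (\<alpha> * t) / \<alpha>) *\<^sub>R M x + ((1 - cos (\<alpha> * t)) / \<alpha>\<^sup>2) *\<^sub>R M (M x)" for t
      have "(z has_vector_derivative - cos (\<alpha> * t) *\<^sub>R M x + (sin (\<alpha> * t) / \<alpha>) *\<^sub>R M (M x)) (at t)" for t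
      proof -
        have 1: "((\<lambda>t. sin (\<alpha> * t) / \<alpha>) has_vector_derivative cos (\<alpha> * t)) (at t)"
          using False unfolding has_real_derivative_iff_has_vector_derivative[symmetric]
          by (auto intro!: derivative_eq_intros)
        have 2: "((\<lambda>t. (1 - cos (\<alpha> * t)) / \<alpha>\<^sup>2) has_vector_derivative sin (\<alpha> * t) / \<alpha>) (at t)"
          using False unfolding has_real_derivative_iff_has_vector_derivative[symmetric]
          by (auto intro!: derivative_eq_intros simp: power2_eq_square)
        have "((\<lambda>t. x - (sin (\<alpha> * t) / \<alpha>) *\<^sub>R M x + ((1 - cos (\<alpha> * t)) / \<alpha>\<^sup>2) *\<^sub>R M (M x)) has_vector_derivative
            0 - cos (\<alpha> * t) *\<^sub>R M x + (sin (\<alpha> * t) / \<alpha>) *\<^sub>R M (M x)) (at t)"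
          by (intro has_vector_derivative_add has_vector_derivative_diff has_vector_derivative_const
              bounded_linear.has_vector_derivative[OF bounded_linear_scaleR_left 1]
              bounded_linear.has_vector_derivative[OF bounded_linear_scaleR_left 2])
        then show ?thesis by (simp add: z_def[abs_def])
      qed
      moreover have "- cos (\<alpha> * t) *\<^sub>R M x + (sin (\<alpha> * t) / \<alpha>) *\<^sub>R M (M x) = - M (z t)" for t
        using False by (simp add: z_def linear_add[OF linM] linear_diff[OF linM] linear_cmul[OF linM] M3 algebra_simps
            diff_divide_distrib)
      ultimately have "(z has_vector_derivative - M (z t)) (at t)" for t by simp
      from const[OF this, of T] show ?thesis by (simp add: z_def trig)
    qed
    then show ?thesis using T by blast
  qed
qed

context lie_group_chart
begin

section \<open>The adjoint representation\<close>

abbreviation conj_by :: "'a \<Rightarrow> 'a \<Rightarrow> 'a"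
  where "conj_by p \<equiv> (\<lambda>q. p \<otimes> q \<otimes> inv p)"

definition Ad :: "'a \<Rightarrow> 'e \<Rightarrow> 'e"
  where "Ad p = diff (conj_by p)"

text \<open>Defined by differentiating \<open>Ad\<close> rather than through brackets, so that
  invariance under \<open>Ad\<close> can be differentiated directly;
  \<open>lie_bracket_lfield\<close> identifies it with the bracket of left invariant fields.\<close>

definition ad :: "'e \<Rightarrow> 'e \<Rightarrow> 'e"
  where "ad u v = deriv (\<lambda>p. Ad p v) u"

lemma smooth_conj: "p \<in> carrier G \<Longrightarrow> smooth_map T A T A (conj_by p)"
  by (rule smooth_mult_maps[OF atlas smooth_mult_maps[OF atlas smooth_const_map smooth_map_ident[OF atlas]]
        smooth_const_map]) auto

lemma conj_one: "p \<in> carrier G \<Longrightarrow> conj_by p \<one> = \<one>"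
  by simp

lemma Ad_smooth: "smooth_fun T A (\<lambda>p. Ad p u)"
proof -
  note P = smooth_atlas_prod[OF atlas atlas]
  note s = smooth_map_fst_snd[OF atlas atlas]
  have "smooth_fun (prod_topology T T) (prod_atlas A A) (\<lambda>z. coord (fst z \<otimes> snd z \<otimes> inv (fst z)))"
    by (rule smooth_fun_compose[OF P smooth_mult_maps[OF P smooth_mult_maps[OF P s] smooth_inv_map[OF P s(1)]] coord(1)])
  from smooth_fun_param_deriv[OF this atlas, of u] show ?thesis by (simp add: Ad_def diff_def)
qed

lemma Ad_linear: "p \<in> carrier G \<Longrightarrow> linear (Ad p)"
  unfolding Ad_def by (rule diff_linear[OF smooth_conj])

lemma Ad_one: "Ad \<one> = (\<lambda>u. u)"
proof -
  have "diff (\<lambda>q. q) = diff (conj_by \<one>)"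
    by (rule diff_cong[OF smooth_map_ident[OF atlas]]) simp
  then show ?thesis by (simp add: Ad_def diff_ident)
qed

lemma Ad_mult:
  assumes p: "p \<in> carrier G" and q: "q \<in> carrier G"
  shows "Ad (p \<otimes> q) u = Ad p (Ad q u)"
proof -
  have "diff (\<lambda>r. conj_by p (conj_by q r)) u = Ad p (Ad q u)"
    unfolding Ad_def by (rule diff_compose[OF smooth_conj[OF q] conj_one[OF q] smooth_conj[OF p]])
  moreover have "diff (conj_by (p \<otimes> q)) = diff (\<lambda>r. conj_by p (conj_by q r))"
    by (rule diff_cong[OF smooth_conj]) (use p q in \<open>simp_all add: m_assoc inv_mult_group\<close>)
  ultimately show ?thesis by (simp add: Ad_def)
qed

lemma Ad_inv: "p \<in> carrier G \<Longrightarrow> Ad p (Ad (inv p) u) = u" "p \<in> carrier G \<Longrightarrow> Ad (inv p) (Ad p u) = u"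
  by (simp_all add: Ad_one flip: Ad_mult)

lemma ad_linear_left: "linear (\<lambda>u. ad u v)"
  unfolding ad_def by (rule deriv_linear[OF Ad_smooth])

lemma ad_linear_right: "linear (ad u)"
proof (rule linearI)
  fix v w r
  have "deriv (\<lambda>p. Ad p v + Ad p w) = deriv (\<lambda>p. Ad p (v + w))"
    by (rule deriv_cong[OF smooth_fun_add[OF atlas Ad_smooth Ad_smooth]])
      (simp add: linear_add[OF Ad_linear] U_carrier)
  then show "ad u (v + w) = ad u v + ad u w"
    using fun_cong[OF deriv_add[OF Ad_smooth Ad_smooth, of v w], of u] by (simp add: ad_def)
  have "deriv (\<lambda>p. r *\<^sub>R Ad p v) = deriv (\<lambda>p. Ad p (r *\<^sub>R v))"
    by (rule deriv_cong[OF smooth_fun_linear[OF atlas bounded_linear_scaleR_right Ad_smooth]])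
      (simp add: linear_cmul[OF Ad_linear] U_carrier)
  then show "ad u (r *\<^sub>R v) = r *\<^sub>R ad u v"
    using fun_cong[OF deriv_linear_compose[OF Ad_smooth bounded_linear_scaleR_right[of r], of v], of u]
    by (simp add: ad_def)
qed

text \<open>An endomorphism intertwines conjugation by \<open>p\<close> with conjugation by
  \<open>F p\<close>; take differentials at the identity.\<close>

lemma endomorphism_Ad:
  assumes F: "smooth_map T A T A F" "F \<in> hom G G" and p: "p \<in> carrier G"
  shows "Ad (F p) (diff F u) = diff F (Ad p u)"
proof -
  interpret F: group_hom G G F using F(2) by unfold_locales
  have Fp: "F p \<in> carrier G" using p by simp
  have "Ad (F p) (diff F u) = diff (\<lambda>q. conj_by (F p) (F q)) u"
    unfolding Ad_def by (rule diff_compose[OF F(1) F.hom_one smooth_conj[OF Fp], symmetric])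
  also have "diff (\<lambda>q. conj_by (F p) (F q)) = diff (\<lambda>q. F (conj_by p q))"
    by (rule diff_cong[OF smooth_map_compose[OF atlas atlas atlas F(1) smooth_conj[OF Fp]]]) (use p in simp)
  also have "\<dots> u = diff F (Ad p u)"
    unfolding Ad_def by (rule diff_compose[OF smooth_conj[OF p] conj_one[OF p] F(1)])
  finally show ?thesis .
qed

text \<open>Differentiate \<open>endomorphism_Ad\<close> in the group element at the
  identity.\<close>

lemma endomorphism_ad:
  assumes F: "smooth_map T A T A F" "F \<in> hom G G"
  shows "ad (diff F u) (diff F v) = diff F (ad u v)"
proof -
  interpret F: group_hom G G F using F(2) by unfold_locales
  have bl: "bounded_linear (diff F)" using diff_linear[OF F(1)] by (simp add: linear_conv_bounded_linear)
  have "ad (diff F u) (diff F v) = deriv (\<lambda>p. Ad (F p) (diff F v)) u"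
    unfolding ad_def by (rule deriv_compose[OF F(1) F.hom_one Ad_smooth, symmetric])
  also have "deriv (\<lambda>p. Ad (F p) (diff F v)) = deriv (\<lambda>p. diff F (Ad p v))"
    by (rule deriv_cong[OF smooth_fun_compose[OF atlas F(1) Ad_smooth]])
      (simp add: endomorphism_Ad[OF F] U_carrier)
  also have "\<dots> u = diff F (ad u v)"
    by (simp add: ad_def deriv_linear_compose[OF Ad_smooth bl])
  finally show ?thesis .
qed

text \<open>Since \<open>m r = (m r m^-1) m\<close>, the vector at \<open>p m\<close> can be moved
  to the slot between \<open>p\<close> and \<open>m\<close>. The dependence on \<open>m\<close> is
  then split between a smooth function and the vector \<open>Ad m v\<close>, the shape required by
  \<open>deriv_moving_vector\<close>.\<close>

lemma lfield_at_product:
  assumes p: "p \<in> carrier G" "m \<in> carrier G" and f: "smooth_fun T A f"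
  shows "lfield v (p \<otimes> m) f = deriv (\<lambda>r. f (p \<otimes> r \<otimes> m)) (Ad m v)"
proof -
  have s: "smooth_fun T A (\<lambda>r. f (p \<otimes> r \<otimes> m))"
    by (rule smooth_fun_compose[OF atlas smooth_mult_maps[OF atlas smooth_mult_maps[OF atlas
            smooth_const_map[OF p(1)] smooth_map_ident[OF atlas]] smooth_const_map[OF p(2)]] f])
  have "deriv (\<lambda>r. f (p \<otimes> m \<otimes> r)) = deriv (\<lambda>r. f (p \<otimes> conj_by m r \<otimes> m))"
    by (rule deriv_cong[OF smooth_left_translate[OF _ f]])
      (use p in \<open>auto simp: m_assoc U_carrier\<close>)
  then show ?thesis
    using deriv_compose[OF smooth_conj[OF p(2)] conj_one[OF p(2)] s, of v] p f
    by (simp add: lfield_def Ad_def)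
qed

text \<open>Differentiating \<open>lfield_at_product\<close> in \<open>m\<close> along
  \<open>u\<close> gives two terms. The first is the same product of fields in the opposite order,
  by interchange of derivatives; the second comes from the derivative \<open>ad u v\<close> of
  \<open>Ad m v\<close> and is therefore the bracket.\<close>

lemma lie_bracket_lfield: "lie_bracket (lfield u) (lfield v) = lfield (ad u v)"
proof (intro ext)
  fix p f
  show "lie_bracket (lfield u) (lfield v) p f = lfield (ad u v) p f"
  proof (cases "p \<in> carrier G \<and> smooth_fun T A f")
    case True
    then have p: "p \<in> carrier G" and f: "smooth_fun T A f" by auto
    interpret PQ: two_pointed_charts T A U c "\<one>" T A U c "\<one>" by unfold_locales
    note P = smooth_atlas_prod[OF atlas atlas]
    note s = smooth_map_fst_snd[OF atlas atlas]
    let ?F = "\<lambda>z. f (p \<otimes> snd z \<otimes> fst z)"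
    have F: "smooth_fun (prod_topology T T) (prod_atlas A A) ?F"
      by (rule smooth_fun_compose[OF P smooth_mult_maps[OF P smooth_mult_maps[OF P smooth_const_map[OF p] s(2)] s(1)] f])
    have "lfield u p (\<lambda>q. lfield v q f) = deriv (\<lambda>m. lfield v (p \<otimes> m) f) u"
      using p lfield_smooth[OF f] by (simp add: lfield_def[of u])
    also have "deriv (\<lambda>m. lfield v (p \<otimes> m) f) = deriv (\<lambda>m. deriv (\<lambda>r. ?F (m, r)) (Ad m v))"
      by (rule deriv_cong[OF smooth_left_translate[OF p lfield_smooth[OF f]]])
        (simp add: lfield_at_product[OF p _ f] U_carrier)
    also have "\<dots> u = deriv (\<lambda>r. deriv (\<lambda>m. ?F (m, r)) u) (Ad \<one> v) + deriv (\<lambda>r. ?F (\<one>, r)) (deriv (\<lambda>m. Ad m v) u)"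
      by (rule PQ.deriv_moving_vector[OF F Ad_smooth])
    also have "deriv (\<lambda>r. ?F (\<one>, r)) = deriv (\<lambda>r. f (p \<otimes> r))"
      by (rule deriv_cong[symmetric, OF smooth_left_translate[OF p f]]) (simp add: p U_carrier)
    also have "\<dots> (deriv (\<lambda>m. Ad m v) u) = lfield (ad u v) p f"
      using p f by (simp add: lfield_def ad_def)
    also have "deriv (\<lambda>r. deriv (\<lambda>m. ?F (m, r)) u) = deriv (\<lambda>r. lfield u (p \<otimes> r) f)"
      by (rule deriv_cong[symmetric, OF smooth_left_translate[OF p lfield_smooth[OF f]]])
        (simp add: lfield_def f p U_carrier)
    also have "\<dots> (Ad \<one> v) = lfield v p (\<lambda>q. lfield u q f)"
      using p lfield_smooth[OF f] by (simp add: lfield_def[of v] Ad_one)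
    finally show ?thesis by (simp add: lie_bracket_def)
  next
    case False
    then show ?thesis by (auto simp: lie_bracket_def lfield_def)
  qed
qed

lemma ad_skew: "ad u v = - ad v u"
proof -
  have "lfield (ad u v) = - lfield (ad v u)"
    by (simp add: lie_bracket_def fun_eq_iff flip: lie_bracket_lfield)
  also have "\<dots> = lfield (- ad v u)" by (simp add: linear_neg[OF lfield_linear])
  finally show ?thesis by (simp add: lfield_eq_iff)
qed

text \<open>Semisimplicity enters only here: the centre of the Lie algebra is an abelian ideal.\<close>

lemma semisimple_ad_injective:
  assumes "semisimple G" and u: "\<And>v. ad u v = 0"
  shows "u = 0"
proof -
  let ?Z = "{u. \<forall>v. ad u v = 0}"
  let ?I = "lfield ` ?Z"
  have subZ: "subspace ?Z"
    by (rule subspaceI) (auto simp: linear_0[OF ad_linear_left] linear_add[OF ad_linear_left]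
        linear_cmul[OF ad_linear_left])
  have zero: "lie_bracket X Y = 0" if X: "X \<in> lie_algebra G" and Y: "Y \<in> ?I" for X Y
  proof -
    obtain w where w: "X = lfield w" using lie_algebra_lfield[OF X] by blast
    obtain z where z: "Y = lfield z" "\<And>v. ad z v = 0" using Y by blast
    have "ad w z = 0" using ad_skew[of w z] z(2) by simp
    then show ?thesis by (simp add: w z(1) lie_bracket_lfield linear_0[OF lfield_linear])
  qed
  have sub: "?I \<subseteq> lie_algebra G" using lfield_lie_algebra by blast
  have sI: "subspace ?I" by (rule linear_subspace_image[OF lfield_linear subZ])
  have "lie_ideal ?I (lie_algebra G)"
    unfolding lie_ideal_def using sub sI zero subspace_0[OF sI] by auto
  moreover have "solvable_lie_algebra ?I"
  proof -
    have z0: "{lie_bracket X Y |X Y. X \<in> ?I \<and> Y \<in> ?I} \<subseteq> {0}" using zero sub by blast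
    have "derived_algebra ?I \<subseteq> {0}"
      unfolding derived_algebra_def by (rule span_minimal[OF z0 subspace_single_0])
    moreover have "0 \<in> derived_algebra ?I" unfolding derived_algebra_def by (rule span_zero)
    ultimately have "(derived_algebra ^^ 1) ?I = {0}" by auto
    then show ?thesis unfolding solvable_lie_algebra_def by (rule exI)
  qed
  ultimately have "?I = {0}" using assms(1) unfolding semisimple_def by blast
  moreover have "lfield u \<in> ?I" using u by blast
  ultimately have "lfield u = lfield 0" by (simp add: linear_0[OF lfield_linear])
  then show ?thesis by (simp add: lfield_eq_iff)
qed

section \<open>The flow of a linear vector field\<close>

context
  fixes X :: "'a vector_field" and \<phi> :: "real \<Rightarrow> 'a \<Rightarrow> 'a"
  assumes lvf: "linear_vector_field G X \<phi>"
begin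

lemma
  shows flow_joint_smooth:
      "smooth_map (prod_topology euclidean T) (prod_atlas {(UNIV, id)} A) T A (\<lambda>(t, p). \<phi> t p)"
    and flow_zero: "\<And>p. p \<in> carrier G \<Longrightarrow> \<phi> 0 p = p"
    and flow_add: "\<And>s t p. p \<in> carrier G \<Longrightarrow> \<phi> (s + t) p = \<phi> s (\<phi> t p)"
    and flow_derivative: "\<And>p t f. p \<in> carrier G \<Longrightarrow> smooth_fun T A f \<Longrightarrow>
       ((\<lambda>s. f (\<phi> s p)) has_real_derivative X (\<phi> t p) f) (at t)"
    and flow_smooth: "\<And>t. smooth_map T A T A (\<phi> t)"
    and flow_hom: "\<And>t. \<phi> t \<in> hom G G"
    and X_vector_field: "X \<in> vector_fields T A"
  using lvf unfolding linear_vector_field_def is_flow_of_def lie_automorphism_def iso_def real_atlas_def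
  by (auto simp: topspace_eq smooth_functions_iff)

lemma flow_closed: "p \<in> carrier G \<Longrightarrow> \<phi> t p \<in> carrier G"
  using flow_hom[of t] by (auto simp: hom_def)

lemma flow_one: "\<phi> t \<one> = \<one>"
proof -
  interpret F: group_hom G G "\<phi> t" using flow_hom by unfold_locales
  show ?thesis by (rule F.hom_one)
qed

lemma flow_mult: "p \<in> carrier G \<Longrightarrow> q \<in> carrier G \<Longrightarrow> \<phi> t (p \<otimes> q) = \<phi> t p \<otimes> \<phi> t q"
  using flow_hom[of t] by (simp add: hom_def)

definition dflow :: "real \<Rightarrow> 'e \<Rightarrow> 'e"
  where "dflow t = diff (\<phi> t)"

lemma atlas_R: "smooth_atlas euclidean {(UNIV, id :: real \<Rightarrow> real)}"
  by (rule smooth_atlas_euclidean)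

interpretation RG: two_pointed_charts euclidean "{(UNIV, id :: real \<Rightarrow> real)}" UNIV id 0 T A U c "\<one>"
  by unfold_locales (auto simp: atlas_R)

text \<open>Time is treated as a one-dimensional manifold with chart \<open>id\<close>, so that the
  calculus with parameters applies to it; this translates back to ordinary vector
  derivatives.\<close>

lemma R_deriv:
  assumes "smooth_fun euclidean {(UNIV, id :: real \<Rightarrow> real)} f"
  shows "(f has_vector_derivative RG.P.deriv f 1) (at 0)"
proof -
  have scale: "RG.P.deriv f = (\<lambda>x. x *\<^sub>R RG.P.deriv f 1)"
  proof
    show "RG.P.deriv f x = x *\<^sub>R RG.P.deriv f 1" for x
      using linear_cmul[OF RG.P.deriv_linear[OF assms], of x 1] by simp
  qed
  have "(f has_derivative RG.P.deriv f) (at 0)"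
    using RG.P.has_deriv[OF assms] by simp
  from has_derivative_eq_rhs[OF this scale] show ?thesis unfolding has_vector_derivative_def .
qed

lemma R_deriv_eqI:
  "smooth_fun euclidean {(UNIV, id :: real \<Rightarrow> real)} f \<Longrightarrow> (f has_vector_derivative D) (at 0) \<Longrightarrow> RG.P.deriv f 1 = D"
  using R_deriv vector_derivative_unique_at by blast

lemma smooth_flow_map:
  assumes B: "smooth_atlas T' B" and s: "smooth_fun T' B s" and F: "smooth_map T' B T A F"
  shows "smooth_map T' B T A (\<lambda>m. \<phi> (s m) (F m))"
  using smooth_map_compose[OF B smooth_atlas_prod[OF atlas_R atlas] atlas
      smooth_map_Pair[OF B atlas_R atlas s F] flow_joint_smooth] by simp

lemma dflow_smooth: "smooth_fun euclidean {(UNIV, id)} (\<lambda>t. dflow t u)"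
proof -
  note P = smooth_atlas_prod[OF atlas_R atlas]
  have "smooth_fun (prod_topology euclidean T) (prod_atlas {(UNIV, id)} A) (\<lambda>z. coord (\<phi> (fst z) (snd z)))"
    by (rule smooth_fun_compose[OF P smooth_flow_map[OF P smooth_map_fst_snd[OF atlas_R atlas]] coord(1)])
  from smooth_fun_param_deriv[OF this atlas_R, of u] show ?thesis by (simp add: dflow_def diff_def)
qed

definition generator :: "'e \<Rightarrow> 'e"
  where "generator u = RG.P.deriv (\<lambda>t. dflow t u) 1"

lemma dflow_derivative: "((\<lambda>t. dflow t u) has_vector_derivative generator u) (at 0)"
  unfolding generator_def by (rule R_deriv[OF dflow_smooth])

lemma dflow_linear: "linear (dflow t)"
  unfolding dflow_def by (rule diff_linear[OF flow_smooth])

lemma dflow_zero: "dflow 0 u = u"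
proof -
  have "diff (\<phi> 0) = diff (\<lambda>q. q)" by (rule diff_cong[OF flow_smooth flow_zero])
  then show ?thesis by (simp add: dflow_def diff_ident)
qed

lemma dflow_add: "dflow (s + t) u = dflow s (dflow t u)"
proof -
  have "diff (\<phi> (s + t)) = diff (\<lambda>q. \<phi> s (\<phi> t q))" by (rule diff_cong[OF flow_smooth flow_add])
  then show ?thesis
    unfolding dflow_def using diff_compose[OF flow_smooth flow_one flow_smooth, of s t u] by simp
qed

text \<open>Along the orbit of \<open>p\<close> the left invariant field can be pulled back to
  \<open>p\<close>, with its vector replaced by \<open>dflow (- t) u\<close>. Differentiating at
  time 0 yields the product of \<open>X\<close> and the field in the opposite order and a
  contribution of \<open>- generator u\<close>; the minus sign in \<open>derivation_of\<close>
  cancels this one.\<close>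

lemma derivation_of_lfield: "derivation_of X (lfield u) = lfield (generator u)"
proof (intro ext)
  fix p f
  show "derivation_of X (lfield u) p f = lfield (generator u) p f"
  proof (cases "p \<in> carrier G \<and> smooth_fun T A f")
    case True
    then have p: "p \<in> carrier G" and f: "smooth_fun T A f" by auto
    note P = smooth_atlas_prod[OF atlas_R atlas]
    note s = smooth_map_fst_snd[OF atlas_R atlas]
    let ?F = "\<lambda>z. f (\<phi> (fst z) (p \<otimes> snd z))"
    have F: "smooth_fun (prod_topology euclidean T) (prod_atlas {(UNIV, id)} A) ?F"
      by (rule smooth_fun_compose[OF P smooth_flow_map[OF P s(1) smooth_mult_maps[OF P smooth_const_map[OF p] s(2)]] f])
    have Xf: "smooth_fun T A (\<lambda>q. X q f)"
      using X_vector_field f by (auto simp: vector_fields_def smooth_functions_iff)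
    have neg: "smooth_fun euclidean {(UNIV, id)} (uminus :: real \<Rightarrow> real)"
      using smooth_on_linear[OF bounded_linear_minus[OF bounded_linear_ident], where S=UNIV]
      by (intro smooth_funI[OF atlas_R]) simp
    have v: "smooth_fun euclidean {(UNIV, id)} (\<lambda>t. dflow (- t) u)"
      by (rule smooth_map_compose[OF atlas_R atlas_R smooth_atlas_euclidean neg dflow_smooth])
    have dv: "((\<lambda>t. dflow (- t) u) has_vector_derivative - generator u) (at 0)"
    proof -
      have "(uminus has_vector_derivative - 1) (at (0 :: real))" by (auto intro!: derivative_eq_intros)
      from vector_diff_chain_at[OF this, of "\<lambda>t. dflow t u" "generator u"] dflow_derivative[of u]
      show ?thesis by (simp add: o_def)
    qed
    \<comment> \<open>Rests on \<open>\<phi> t p \<otimes> q = \<phi> t (p \<otimes> \<phi> (- t)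
      q)\<close>, by which the direction at the identity becomes
      \<open>dflow (- t) u\<close>.\<close>
    have orbit: "lfield u (\<phi> t p) f = deriv (\<lambda>q. ?F (t, q)) (dflow (- t) u)" for t
    proof -
      have sF: "smooth_fun T A (\<lambda>q. ?F (t, q))" by (rule smooth_fun_slice[OF F atlas_R]) simp
      have eq: "\<phi> t (\<phi> (- t) q) = q" if "q \<in> carrier G" for q
        using flow_add[OF that, of t "- t"] flow_zero[OF that] by simp
      have "deriv (\<lambda>q. f (\<phi> t p \<otimes> q)) = deriv (\<lambda>q. ?F (t, \<phi> (- t) q))"
        by (rule deriv_cong[OF smooth_left_translate[OF flow_closed[OF p] f]])
          (simp add: flow_mult p flow_closed U_carrier eq)
      then show ?thesis
        using deriv_compose[OF flow_smooth flow_one sF, of "- t" u] f flow_closed[OF p]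
        by (simp add: lfield_def dflow_def)
    qed
    have smo: "smooth_fun euclidean {(UNIV, id)} (\<lambda>t. lfield u (\<phi> t p) f)"
      by (rule smooth_fun_compose[OF atlas_R smooth_flow_map[OF atlas_R smooth_map_ident[OF atlas_R]
              smooth_const_map[OF p]] lfield_smooth[OF f]])
    have "((\<lambda>t. lfield u (\<phi> t p) f) has_vector_derivative X p (\<lambda>q. lfield u q f)) (at 0)"
      using flow_derivative[OF p lfield_smooth[OF f], of u 0]
      by (simp add: flow_zero p has_real_derivative_iff_has_vector_derivative)
    from R_deriv_eqI[OF smo this]
    have "X p (\<lambda>q. lfield u q f) = RG.P.deriv (\<lambda>t. deriv (\<lambda>q. ?F (t, q)) (dflow (- t) u)) 1"
      by (simp only: orbit)
    also have "\<dots> = deriv (\<lambda>q. RG.P.deriv (\<lambda>t. ?F (t, q)) 1) (dflow (- 0) u) +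
        deriv (\<lambda>q. ?F (0, q)) (RG.P.deriv (\<lambda>t. dflow (- t) u) 1)"
      by (rule RG.deriv_moving_vector[OF F v])
    also have "RG.P.deriv (\<lambda>t. dflow (- t) u) 1 = - generator u" by (rule R_deriv_eqI[OF v dv])
    also have "deriv (\<lambda>q. ?F (0, q)) = deriv (\<lambda>q. f (p \<otimes> q))"
      by (rule deriv_cong[symmetric, OF smooth_left_translate[OF p f]]) (simp add: flow_zero p U_carrier)
    also have "\<dots> (- generator u) = - lfield (generator u) p f"
      using p f by (simp add: lfield_def linear_neg[OF deriv_linear[OF smooth_left_translate[OF p f]]])
    also have "deriv (\<lambda>q. RG.P.deriv (\<lambda>t. ?F (t, q)) 1) = deriv (\<lambda>q. X (p \<otimes> q) f)"
    proof (rule deriv_cong[symmetric, OF smooth_left_translate[OF p Xf]])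
      fix q assume "q \<in> U"
      then have pq: "p \<otimes> q \<in> carrier G" using p U_carrier by simp
      have sm: "smooth_fun euclidean {(UNIV, id)} (\<lambda>t. f (\<phi> t (p \<otimes> q)))"
        by (rule smooth_fun_compose[OF atlas_R smooth_flow_map[OF atlas_R smooth_map_ident[OF atlas_R]
                smooth_const_map[OF pq]] f])
      have "((\<lambda>t. f (\<phi> t (p \<otimes> q))) has_vector_derivative X (p \<otimes> q) f) (at 0)"
        using flow_derivative[OF pq f, of 0]
        by (simp add: flow_zero pq has_real_derivative_iff_has_vector_derivative)
      from R_deriv_eqI[OF sm this] show "X (p \<otimes> q) f = RG.P.deriv (\<lambda>t. ?F (t, q)) 1" by simp
    qed
    also have "\<dots> (dflow (- 0) u) = lfield u p (\<lambda>q. X q f)"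
      using p Xf by (simp add: lfield_def dflow_zero)
    finally show ?thesis by (simp add: derivation_of_def lie_bracket_def)
  next
    case False
    \<comment> \<open>For non-smooth \<open>f\<close> the bracket still evaluates \<open>X\<close>
      at the constant function 0, so homogeneity of tangent vectors is needed besides the
      normalisations.\<close>
    have X0: "X p (\<lambda>q. 0) = 0"
    proof (cases "p \<in> carrier G")
      case True
      then have "X p \<in> tangent_space T A p"
        using X_vector_field by (auto simp: vector_fields_def topspace_eq)
      then have "\<forall>a. \<forall>f\<in>smooth_functions T A. X p (a *\<^sub>R f) = a * X p f"
        by (simp add: tangent_space_def)
      from this[rule_format, of "\<lambda>q. 0" 0] have "X p ((0 :: real) *\<^sub>R (\<lambda>q. 0)) = 0 * X p (\<lambda>q. 0)"
        by (simp add: smooth_functions_iff smooth_fun_const)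
      then show ?thesis by (simp add: scaleR_fun_def)
    next
      case False
      then show ?thesis using X_vector_field by (simp add: vector_fields_def topspace_eq)
    qed
    have Xns: "X q f = 0" if "\<not> smooth_fun T A f" for q
      using X_vector_field that
      by (cases "q \<in> carrier G") (auto simp: vector_fields_def topspace_eq tangent_space_def smooth_functions_iff)
    show ?thesis
    proof (cases "p \<in> carrier G")
      case True
      then have "\<not> smooth_fun T A f" using False by simp
      then show ?thesis using X0 Xns by (simp add: derivation_of_def lie_bracket_def lfield_def)
    next
      case False
      then show ?thesis using X_vector_field
        by (simp add: derivation_of_def lie_bracket_def lfield_def vector_fields_def topspace_eq)
    qed
  qed
qed

end

end

text \<open>An injective derivative has a linear left inverse, and a map whose derivative stays
  close to it in operator norm is injective. Smoothness gives closeness direction by direction;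
  summing over the basis bounds the operator norm.\<close>

lemma smooth_on_locally_injective:
  fixes f :: "'a::euclidean_space \<Rightarrow> 'b::euclidean_space"
  assumes f: "smooth_on S f" and S: "open S" "a \<in> S" and inj: "inj (frechet_derivative f (at a))"
  obtains r where "r > 0" "ball a r \<subseteq> S" "inj_on f (ball a r)"
proof -
  let ?D = "\<lambda>x. frechet_derivative f (at x)"
  obtain g where g: "linear g" "g \<circ> ?D a = id"
    using linear_injective_left_inverse[OF smooth_on_linear_derivative[OF f S(2)] inj] by blast
  have cont: "\<exists>d>0. \<forall>x. dist a x < d \<longrightarrow> onorm (\<lambda>v. ?D x v - ?D a v) < e" if e: "e > 0" for e
  proof -
    define s where "s = (\<lambda>x. \<Sum>b\<in>Basis. norm (?D x b - ?D a b))"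
    have "isCont s a"
      unfolding s_def using S smooth_on_continuous_on[OF smooth_on_derivative[OF f]]
      by (intro continuous_intros) (simp add: continuous_on_eq_continuous_at)
    then have "(s \<longlongrightarrow> s a) (nhds a)" by (simp only: isCont_def tendsto_at_iff_tendsto_nhds)
    moreover have "s a = 0" by (simp add: s_def)
    ultimately have "\<forall>\<^sub>F x in nhds a. s x < e" using e by (simp add: order_tendstoD(2))
    moreover have "\<forall>\<^sub>F x in nhds a. x \<in> S" using S by (rule eventually_nhds_in_open)
    ultimately have "\<forall>\<^sub>F x in nhds a. s x < e \<and> x \<in> S" by eventually_elim simp
    then obtain d where d: "d > 0" "\<And>x. dist x a < d \<Longrightarrow> s x < e \<and> x \<in> S"
      by (auto simp: eventually_nhds_metric)
    have "onorm (\<lambda>v. ?D x v - ?D a v) < e" if "dist a x < d" for x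
    proof -
      have x: "s x < e" "x \<in> S" using d(2)[of x] that by (auto simp: dist_commute)
      have "bounded_linear (\<lambda>v. ?D x v - ?D a v)"
        by (intro bounded_linear_sub has_derivative_bounded_linear[OF smooth_on_has_derivative[OF f]] x S)
      from onorm_componentwise[OF this] x(1) show ?thesis by (simp add: s_def)
    qed
    then show ?thesis using d(1) by blast
  qed
  show ?thesis
    by (rule has_derivative_locally_injective[OF S(2,1) _ g(2) smooth_on_has_derivative[OF f] cont])
      (use g(1) that in \<open>simp_all add: linear_conv_bounded_linear\<close>)
qed

context lie_group_chart
begin

section \<open>The Killing form of a compact group\<close>

text \<open>Compactness bounds \<open>Ad p b\<close> over the whole group for each basis vector
  \<open>b\<close>; summing over the basis bounds the operators. The extra 1 keeps the constant
  positive.\<close>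

lemma Ad_bounded_linear_group:
  assumes cpt: "compact_space T"
  obtains C where "bounded_linear_group (Ad ` carrier G) C"
proof -
  have "\<exists>k. \<forall>p\<in>carrier G. norm (Ad p b) \<le> k" for b
  proof -
    have "compactin euclidean ((\<lambda>p. Ad p b) ` topspace T)"
      by (rule image_compactin[OF _ smooth_mapD(1)[OF Ad_smooth]]) (use cpt in \<open>simp add: compact_space_def\<close>)
    then have "bounded ((\<lambda>p. Ad p b) ` carrier G)"
      by (simp add: topspace_eq compact_imp_bounded)
    then show ?thesis by (auto simp: bounded_iff)
  qed
  then obtain k where k: "\<And>b p. p \<in> carrier G \<Longrightarrow> norm (Ad p b) \<le> k b" by metis
  define C where "C = (\<Sum>b\<in>Basis. \<bar>k b\<bar>) + 1"
  have "bounded_linear_group (Ad ` carrier G) C"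
  proof (rule bounded_linear_group.intro)
    show "linear h" if "h \<in> Ad ` carrier G" for h using that Ad_linear by blast
    have "Ad \<one> \<in> Ad ` carrier G" by (rule imageI[OF one_closed])
    then show "(\<lambda>x. x) \<in> Ad ` carrier G" by (simp only: Ad_one)
    show "(\<lambda>x. h (h' x)) \<in> Ad ` carrier G" if h: "h \<in> Ad ` carrier G" "h' \<in> Ad ` carrier G" for h h'
    proof -
      obtain p q where "h = Ad p" "h' = Ad q" "p \<in> carrier G" "q \<in> carrier G" using h by blast
      then show ?thesis by (intro image_eqI[of _ _ "p \<otimes> q"]) (auto simp: Ad_mult)
    qed
    show "\<exists>h'\<in>Ad ` carrier G. \<forall>x. h (h' x) = x \<and> h' (h x) = x" if h: "h \<in> Ad ` carrier G" for h
    proof -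
      obtain p where "h = Ad p" "p \<in> carrier G" using h by blast
      then show ?thesis by (intro bexI[of _ "Ad (inv p)"]) (auto simp: Ad_inv)
    qed
    show "norm (h x) \<le> C * norm x" if h: "h \<in> Ad ` carrier G" for h x
    proof -
      obtain p where p: "h = Ad p" "p \<in> carrier G" using h by blast
      have "norm (h x) = norm (\<Sum>b\<in>Basis. (x \<bullet> b) *\<^sub>R Ad p b)"
        unfolding p(1) by (rule arg_cong[where f=norm, OF linear_basis_expansion[OF Ad_linear[OF p(2)]]])
      also have "\<dots> \<le> (\<Sum>b\<in>Basis. norm x * \<bar>k b\<bar>)"
      proof (rule sum_norm_le)
        fix b :: 'e assume "b \<in> Basis"
        then show "norm ((x \<bullet> b) *\<^sub>R Ad p b) \<le> norm x * \<bar>k b\<bar>"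
          using k[OF p(2), of b] by (auto intro!: mult_mono simp: Basis_le_norm)
      qed
      also have "\<dots> \<le> C * norm x" by (simp add: C_def sum_distrib_left[symmetric] algebra_simps)
      finally show ?thesis .
    qed
    show "C > 0" by (simp add: C_def sum_nonneg add_nonneg_pos)
  qed
  then show ?thesis by (rule that)
qed

text \<open>Differentiate the constant function \<open>Q (Ad p x) (Ad p y)\<close> of
  \<open>p\<close> at the identity.\<close>

lemma ad_skew_invariant_form:
  assumes Q: "inner_form Q" and inv: "\<And>p x y. p \<in> carrier G \<Longrightarrow> Q (Ad p x) (Ad p y) = Q x y"
  shows "Q (ad u x) y = - Q x (ad u y)"
proof -
  have bil: "bounded_bilinear Q"
    unfolding bilinear_conv_bounded_bilinear[symmetric] bilinear_def
    using inner_form_linear[OF Q] by simp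
  have "deriv (\<lambda>p. Q x y) = deriv (\<lambda>p. Q (Ad p x) (Ad p y))"
    by (rule deriv_cong[OF smooth_fun_const]) (simp add: inv U_carrier)
  from fun_cong[OF this, of u] have "0 = deriv (\<lambda>p. Q (Ad p x) (Ad p y)) u" by simp
  also have "\<dots> = Q x (ad u y) + Q (ad u x) y"
    using fun_cong[OF deriv_bilinear[OF bil Ad_smooth[of x] Ad_smooth[of y]], of u] by (simp add: Ad_one ad_def)
  finally show ?thesis by simp
qed

definition killing :: "'e \<Rightarrow> 'e \<Rightarrow> real"
  where "killing u v = trace_of (\<lambda>x. ad u (ad v x))"

text \<open>The invariant form \<open>Q\<close> is auxiliary: it makes \<open>ad u\<close> skew, so
  the trace of its square is negative unless \<open>ad u = 0\<close>, which semisimplicity excludes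
  for nonzero \<open>u\<close>.\<close>

lemma killing_inner_form:
  assumes cpt: "compact_space T" and ss: "semisimple G"
  shows "inner_form (\<lambda>u v. - killing u v)"
proof -
  obtain C where C: "bounded_linear_group (Ad ` carrier G) C" by (rule Ad_bounded_linear_group[OF cpt])
  obtain Q where Q: "inner_form Q" "\<And>h x y. h \<in> Ad ` carrier G \<Longrightarrow> Q (h x) (h y) = Q x y"
    by (rule bounded_linear_group.invariant_inner_form[OF C]) (rule that, assumption+)
  have skew: "Q (ad u x) y = - Q x (ad u y)" for u x y
    by (rule ad_skew_invariant_form[OF Q(1) Q(2)[OF imageI]])
  show ?thesis
    unfolding inner_form_def
  proof (intro conjI allI impI)
    show "linear (\<lambda>v. - killing u v)" for u
      by (rule linearI) (simp_all add: killing_def trace_of_def linear_add[OF ad_linear_left]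
          linear_cmul[OF ad_linear_left] linear_add[OF ad_linear_right] linear_cmul[OF ad_linear_right]
          inner_add_left sum.distrib sum_distrib_left)
    show "- killing u v = - killing v u" for u v
      unfolding killing_def
      by (rule arg_cong[where f=uminus, OF trace_of_commute[OF ad_linear_right[of u] ad_linear_right[of v]]])
    show "0 < - killing u u" if "u \<noteq> 0" for u
    proof -
      have "killing u u \<le> 0"
        using skew_trace_square(1)[where Q=Q and A="ad u", OF Q(1) ad_linear_right skew] by (simp only: killing_def)
      moreover have "killing u u \<noteq> 0"
      proof
        assume "killing u u = 0"
        then have "trace_of (\<lambda>x. ad u (ad u x)) = 0" by (simp only: killing_def)
        from skew_trace_square(2)[where Q=Q and A="ad u", OF Q(1) ad_linear_right skew this] have "ad u v = 0" for v .
        from semisimple_ad_injective[OF ss this] that show False by simp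
      qed
      ultimately show ?thesis by simp
    qed
  qed
qed

text \<open>The differential \<open>diff F\<close>, with inverse \<open>H\<close>, conjugates
  \<open>ad u\<close> to \<open>ad (diff F u)\<close>, and traces are invariant under
  conjugation.\<close>

lemma killing_endomorphism:
  assumes F: "smooth_map T A T A F" "F \<in> hom G G"
    and H: "linear H" "\<And>x. diff F (H x) = x" "\<And>x. H (diff F x) = x"
  shows "killing (diff F u) (diff F v) = killing u v"
proof -
  have ad: "ad (diff F u) x = diff F (ad u (H x))" for u x
    using endomorphism_ad[OF F, of u "H x"] by (simp add: H(2))
  have lin: "linear (\<lambda>x. ad u (ad v (H x)))"
    using linear_compose[OF linear_compose[OF H(1) ad_linear_right] ad_linear_right] by (simp add: o_def)
  have "killing (diff F u) (diff F v) = trace_of (\<lambda>x. diff F (ad u (ad v (H x))))"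
    by (simp add: killing_def ad H(3))
  also have "\<dots> = trace_of (\<lambda>x. ad u (ad v (H (diff F x))))"
    by (rule trace_of_commute[OF diff_linear[OF F(1)] lin])
  finally show ?thesis by (simp add: H(3) killing_def)
qed

text \<open>Contracting \<open>Ad\<close> with the Killing form gives a smooth function whose differential at the
  identity is the (nondegenerate) Killing form itself.\<close>

lemma Ad_locally_injective:
  assumes cpt: "compact_space T" and ss: "semisimple G"
  obtains N where "openin T N" "\<one> \<in> N" "\<And>p q. p \<in> N \<Longrightarrow> q \<in> N \<Longrightarrow> Ad p = Ad q \<Longrightarrow> p = q"
proof -
  note B = killing_inner_form[OF cpt ss]
  \<comment> \<open>Only \<open>Ad p\<close> enters, so \<open>Ad p = Ad q\<close> forces equal
    values; the minus sign matches the positive definite form \<open>- killing\<close>.\<close>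
  define \<kappa> where "\<kappa> p = (\<Sum>b\<in>Basis. - trace_of (\<lambda>x. ad b (Ad p x)) *\<^sub>R b)" for p
  have bl: "bounded_linear (\<lambda>v. ad b v \<bullet> i)" for b i
    using linear_compose[OF ad_linear_right[of b], of "\<lambda>v. v \<bullet> i"]
    by (simp add: o_def linear_conv_bounded_linear bounded_linear_inner_left)
  have sm1: "smooth_fun T A (\<lambda>p. ad b (Ad p i) \<bullet> i)" for b i
    by (rule smooth_fun_linear[OF atlas bl Ad_smooth])
  have sm2: "smooth_fun T A (\<lambda>p. trace_of (\<lambda>x. ad b (Ad p x)))" for b
    unfolding trace_of_def by (rule smooth_fun_sum[OF atlas sm1])
  have bm: "bounded_linear (\<lambda>r :: real. - r *\<^sub>R b)" for b :: 'e
    by (intro bounded_linear_compose[OF bounded_linear_scaleR_left] bounded_linear_minus bounded_linear_ident)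
  have sm3: "smooth_fun T A (\<lambda>p. - trace_of (\<lambda>x. ad b (Ad p x)) *\<^sub>R b)" for b
    by (rule smooth_fun_linear[OF atlas bm sm2])
  have \<kappa>: "smooth_fun T A \<kappa>" unfolding \<kappa>_def by (rule smooth_fun_sum[OF atlas sm3])
  have d2: "deriv (\<lambda>p. trace_of (\<lambda>x. ad b (Ad p x))) u = killing b u" for b u
  proof -
    have "deriv (\<lambda>p. trace_of (\<lambda>x. ad b (Ad p x))) u = (\<Sum>i\<in>Basis. deriv (\<lambda>p. ad b (Ad p i) \<bullet> i) u)"
      unfolding trace_of_def by (rule fun_cong[OF deriv_sum[OF sm1]])
    also have "\<dots> = (\<Sum>i\<in>Basis. ad b (ad u i) \<bullet> i)"
      by (rule sum.cong[OF refl]) (simp add: deriv_linear_compose[OF Ad_smooth bl] ad_def[of u])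
    finally show ?thesis by (simp add: killing_def trace_of_def)
  qed
  have d\<kappa>: "deriv \<kappa> u = (\<Sum>b\<in>Basis. - killing b u *\<^sub>R b)" for u
  proof -
    have "deriv \<kappa> u = (\<Sum>b\<in>Basis. deriv (\<lambda>p. - trace_of (\<lambda>x. ad b (Ad p x)) *\<^sub>R b) u)"
      unfolding \<kappa>_def by (rule fun_cong[OF deriv_sum[OF sm3]])
    also have "\<dots> = (\<Sum>b\<in>Basis. - killing b u *\<^sub>R b)"
      by (rule sum.cong[OF refl]) (simp only: deriv_linear_compose[OF sm2 bm] d2)
    finally show ?thesis .
  qed
  have "inj (deriv \<kappa>)"
    unfolding linear_injective_0[OF deriv_linear[OF \<kappa>]]
  proof (intro allI impI)
    fix u assume "deriv \<kappa> u = 0"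
    \<comment> \<open>Pairing the derivative with \<open>u\<close> itself collapses the basis sum to
      \<open>- killing u u\<close>.\<close>
    then have "0 = (\<Sum>b\<in>Basis. - killing b u *\<^sub>R b) \<bullet> u" by (simp add: d\<kappa>)
    also have "\<dots> = (\<Sum>b\<in>Basis. (u \<bullet> b) *\<^sub>R (- killing b u))"
      unfolding inner_sum_left by (rule sum.cong[OF refl]) (simp add: inner_commute)
    also have "\<dots> = - killing u u"
      by (rule linear_basis_expansion[OF inner_form_linear(2)[OF B], symmetric])
    finally show "u = 0" using B unfolding inner_form_def by (metis less_irrefl)
  qed
  then have inj: "inj (frechet_derivative (\<lambda>x. \<kappa> (inv_into U c x)) (at (c \<one>)))"
    by (simp add: deriv_def[abs_def])
  obtain r where r: "r > 0" "ball (c \<one>) r \<subseteq> c ` U" "inj_on (\<lambda>x. \<kappa> (inv_into U c x)) (ball (c \<one>) r)"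
    by (rule smooth_on_locally_injective[OF smooth_funD[OF \<kappa> chart] chartD(2) imageI[OF base] inj])
  show ?thesis
  proof (rule that)
    let ?N = "U \<inter> c -` ball (c \<one>) r"
    show "openin T ?N" by (rule chart_open_vimage[OF smooth_atlas_chart[OF atlas chart] open_ball])
    show "\<one> \<in> ?N" using base r(1) by simp
    fix p q assume p: "p \<in> ?N" and q: "q \<in> ?N" and eq: "Ad p = Ad q"
    have "\<kappa> p = \<kappa> q" by (simp add: \<kappa>_def eq)
    then have "\<kappa> (inv_into U c (c p)) = \<kappa> (inv_into U c (c q))"
      using p q chartD(3) by (simp add: inv_into_f_f)
    from inj_onD[OF r(3) this] have "c p = c q" using p q by simp
    then show "p = q" using p q inj_onD[OF chartD(3)] by simp
  qed
qed

text \<open>The fixed points and the moved points are both unions of left translates of a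
  neighbourhood of the identity on which \<open>F\<close> is the identity map. Both sets are
  therefore open, and connectedness leaves no moved point.\<close>

lemma endomorphism_trivial:
  assumes cpt: "compact_space T" and ss: "semisimple G" and conn: "connected_space T"
    and F: "smooth_map T A T A F" "F \<in> hom G G" and dF: "\<And>u. diff F u = u"
    and p: "p \<in> carrier G"
  shows "F p = p"
proof -
  interpret F: group_hom G G F using F(2) by unfold_locales
  obtain N where N: "openin T N" "\<one> \<in> N" "\<And>p q. p \<in> N \<Longrightarrow> q \<in> N \<Longrightarrow> Ad p = Ad q \<Longrightarrow> p = q"
    by (rule Ad_locally_injective[OF cpt ss]) (rule that, assumption+)
  \<comment> \<open>Local injectivity of \<open>Ad\<close> compares \<open>F q\<close> with
    \<open>q\<close> only if both lie in \<open>N\<close>.\<close>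
  define N' where "N' = N \<inter> F -` N"
  have N': "openin T N'" unfolding N'_def by (rule openin_Int_vimage[OF smooth_mapD(1)[OF F(1)] N(1) N(1)])
  have one: "\<one> \<in> N'" using N(2) by (simp add: N'_def)
  have sub: "N' \<subseteq> carrier G" using openin_subset[OF N'] topspace_eq by simp
  have fixN: "F q = q" if q: "q \<in> N'" for q
  proof -
    have qc: "q \<in> carrier G" using q sub by blast
    have "Ad (F q) = Ad q"
      using endomorphism_Ad[OF F qc] by (simp add: dF fun_eq_iff)
    then show ?thesis using N(3)[of "F q" q] q by (simp add: N'_def)
  qed
  let ?V = "\<lambda>q. carrier G \<inter> (\<lambda>r. inv q \<otimes> r) -` N'"
  define S where "S = {q \<in> carrier G. F q = q}"
  have nbhd: "openin T (?V q)" if "q \<in> carrier G" for q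
  proof -
    have "smooth_map T A T A (\<lambda>r. inv q \<otimes> r)"
      by (rule smooth_mult_maps[OF atlas smooth_const_map smooth_map_ident[OF atlas]]) (use that in simp)
    from openin_Int_vimage[OF smooth_mapD(1)[OF this] N' openin_topspace] show ?thesis
      by (simp add: topspace_eq)
  qed
  have self: "q \<in> ?V q" if "q \<in> carrier G" for q
    using that one by simp
  \<comment> \<open>As \<open>F r = F q \<otimes> (inv q \<otimes> r)\<close> when
    \<open>inv q \<otimes> r\<close> lies in \<open>N'\<close>, the points \<open>q\<close> and
    \<open>r\<close> are fixed or moved together.\<close>
  have coset: "F r = r \<longleftrightarrow> F q = q"
    if q: "q \<in> carrier G" and r: "r \<in> ?V q" for q r
  proof -
    have rc: "r \<in> carrier G" and n: "inv q \<otimes> r \<in> N'" using r by auto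
    have "F (inv q \<otimes> r) = inv q \<otimes> r" by (rule fixN[OF n])
    then have eq: "inv (F q) \<otimes> F r = inv q \<otimes> r" using q rc by simp
    show ?thesis
    proof
      assume "F r = r"
      with eq have "inv (F q) = inv q" using q rc by simp
      then have "inv (inv (F q)) = inv (inv q)" by simp
      then show "F q = q" using q by simp
    next
      assume "F q = q"
      with eq show "F r = r" using q rc by simp
    qed
  qed
  \<comment> \<open>A set that contains the translate \<open>?V q\<close> for each of its points
    \<open>q\<close> is the union of these open translates.\<close>
  have saturated: "openin T Y"
    if Y: "Y \<subseteq> carrier G"
      "\<And>q r. q \<in> Y \<Longrightarrow> r \<in> ?V q \<Longrightarrow> r \<in> Y" for Y
  proof -
    have "Y = (\<Union>q\<in>Y. ?V q)"
    proof (intro subset_antisym subsetI)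
      show "q \<in> (\<Union>q\<in>Y. ?V q)" if "q \<in> Y" for q
        by (rule UN_I[OF that self]) (use that Y(1) in blast)
      show "r \<in> Y" if r: "r \<in> (\<Union>q\<in>Y. ?V q)" for r
        using r by (rule UN_E) (rule Y(2))
    qed
    moreover have "openin T (\<Union>q\<in>Y. ?V q)"
    proof (rule openin_Union)
      fix W assume "W \<in> ?V ` Y"
      then obtain q where "q \<in> Y" "W = ?V q" by (rule imageE)
      then show "openin T W" using nbhd[of q] Y(1) by auto
    qed
    ultimately show ?thesis by (rule ssubst)
  qed
  have "openin T S"
  proof (rule saturated)
    show "S \<subseteq> carrier G" by (auto simp: S_def)
    fix q r assume "q \<in> S" and r: "r \<in> ?V q"
    then have "q \<in> carrier G" "F q = q" by (simp_all add: S_def)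
    with coset[OF _ r] r show "r \<in> S" by (simp add: S_def)
  qed
  moreover have "openin T (carrier G - S)"
  proof (rule saturated)
    show "carrier G - S \<subseteq> carrier G" by blast
    fix q r assume "q \<in> carrier G - S" and r: "r \<in> ?V q"
    then have "q \<in> carrier G" "F q \<noteq> q" by (simp_all add: S_def)
    with coset[OF _ r] r show "r \<in> carrier G - S" by (simp add: S_def)
  qed
  then have "closedin T S" by (simp add: closedin_def S_def topspace_eq)
  moreover have "\<one> \<in> S" by (simp add: S_def)
  ultimately have "S = topspace T" using conn by (auto simp: connected_space_clopen_in)
  then show ?thesis using p by (auto simp: S_def topspace_eq)
qed

section \<open>Periodicity\<close>

text \<open>Linear algebra yields a common period of the differentials at the identity, and the
  rigidity of endomorphisms with trivial differential lifts it to the group.\<close>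

lemma linear_flow_periodic:
  assumes cpt: "compact_space T" and ss: "semisimple G" and conn: "connected_space T"
    and lvf: "linear_vector_field G X \<phi>"
    and ev: "eigenvalues_on (lie_algebra G) (derivation_of X) \<subseteq> {0, \<i> * of_real \<alpha>, - (\<i> * of_real \<alpha>)}"
  obtains P where "P > 0" "\<And>p. p \<in> carrier G \<Longrightarrow> \<phi> P p = p"
proof -
  let ?M = "generator \<phi>" and ?E = "dflow \<phi>"
  note [simp] = dflow_zero[OF lvf]
  have "\<exists>P>0. \<forall>u. ?E P u = u"
  proof (rule isometric_flow_periodic[OF killing_inner_form[OF cpt ss], where M="?M" and \<alpha>=\<alpha>])
    show "linear (?E t)" for t by (rule dflow_linear[OF lvf])
    show "?E (s + t) u = ?E s (?E t u)" for s t u by (rule dflow_add[OF lvf])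
    show "?E 0 u = u" for u by simp
    show "((\<lambda>t. ?E t u) has_vector_derivative ?M u) (at 0)" for u by (rule dflow_derivative[OF lvf])
    have inverse: "?E t (?E (- t) u) = u" "?E (- t) (?E t u) = u" for t u
      using dflow_add[OF lvf, of t "- t" u] dflow_add[OF lvf, of "- t" t u] by simp_all
    show "- killing (?E t u) (?E t v) = - killing u v" for t u v
    proof -
      have E: "diff (\<phi> s) = ?E s" for s by (simp add: dflow_def[OF lvf])
      show ?thesis
        using killing_endomorphism[where F="\<phi> t" and H="?E (- t)" and u=u and v=v,
            OF flow_smooth[OF lvf] flow_hom[OF lvf] dflow_linear[OF lvf], unfolded E, OF inverse]
        by simp
    qed
  next
    fix x y \<beta> assume x: "x \<noteq> 0" "\<beta> > (0 :: real)" and M: "?M x = - \<beta> *\<^sub>R y" "?M y = \<beta> *\<^sub>R x"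
    have lx: "lfield x \<noteq> 0" using x(1) lfield_eq_iff[of x 0] by (simp add: linear_0[OF lfield_linear])
    let ?W = "(lfield x, lfield y)"
    have "map_prod (derivation_of X) (derivation_of X) ?W = complexified_scale (\<i> * of_real \<beta>) ?W"
      by (simp add: derivation_of_lfield[OF lvf] M complexified_scale_def linear_cmul[OF lfield_linear]
          linear_neg[OF lfield_linear])
    then have "\<i> * of_real \<beta> \<in> eigenvalues_on (lie_algebra G) (derivation_of X)"
      unfolding eigenvalues_on_def using lx lfield_lie_algebra
      by (intro CollectI bexI[of _ ?W]) auto
    then have "\<i> * complex_of_real \<beta> \<in> {0, \<i> * of_real \<alpha>, - (\<i> * of_real \<alpha>)}" using ev by blast
    then have "\<beta> = 0 \<or> \<beta> = \<alpha> \<or> \<beta> = - \<alpha>" by (auto simp: complex_eq_iff)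
    then show "\<beta> = \<bar>\<alpha>\<bar>" using x(2) by auto
  qed
  then obtain P where P: "P > 0" "\<And>u. ?E P u = u" by blast
  show ?thesis
  proof (rule that[OF P(1)])
    fix p assume "p \<in> carrier G"
    then show "\<phi> P p = p"
      by (rule endomorphism_trivial[OF cpt ss conn flow_smooth[OF lvf] flow_hom[OF lvf]
            P(2)[unfolded dflow_def[OF lvf]]])
  qed
qed

text \<open>The orbit is the continuous image of one period, hence compact and closed in a Hausdorff
  space, so no limit leaves it. Conversely each orbit point is revisited at the times
  \<open>s + real n * P\<close>.\<close>

lemma periodic_flow_omega_limit:
  assumes lvf: "linear_vector_field G X \<phi>" and P: "P > 0" "\<And>p. p \<in> carrier G \<Longrightarrow> \<phi> P p = p"
    and g: "g \<in> carrier G"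
  shows "periodic_orbit T \<phi> (omega_limit T \<phi> g)"
proof -
  have add: "\<phi> (s + t) g = \<phi> s (\<phi> t g)" for s t by (rule flow_add[OF lvf g])
  have closed: "\<phi> t g \<in> carrier G" for t by (rule flow_closed[OF lvf g])
  have step: "\<phi> (t + P) g = \<phi> t g" for t using add[of t P] P(2)[OF g] by simp
  have nat: "\<phi> (t + real n * P) g = \<phi> t g" for n t
  proof (induction n)
    case (Suc n)
    then show ?case using step[of "t + real n * P"] by (simp add: algebra_simps)
  qed simp
  have cont: "continuous_map euclidean T (\<lambda>t. \<phi> t g)"
    by (rule smooth_mapD(1)[OF smooth_flow_map[OF lvf smooth_atlas_euclidean
            smooth_map_ident[OF smooth_atlas_euclidean] smooth_const_map[OF g]]])
  let ?K = "(\<lambda>t. \<phi> t g) ` {0..P}"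
  have "compactin T ?K" by (rule image_compactin[OF _ cont]) simp
  then have K: "closedin T ?K" by (rule compactin_imp_closedin[OF Hausdorff])
  have inK: "\<phi> t g \<in> ?K" if "t \<ge> 0" for t
  proof -
    define n where "n = nat \<lfloor>t / P\<rfloor>"
    have "real n \<le> t / P" "t / P < real n + 1"
      using that P(1) by (auto simp: n_def of_nat_nat)
    then have "t - real n * P \<in> {0..P}" using P(1) by (auto simp: field_simps)
    moreover have "\<phi> t g = \<phi> (t - real n * P) g" using nat[of "t - real n * P" n] by simp
    ultimately show ?thesis by blast
  qed
  have "omega_limit T \<phi> g = range (\<lambda>t. \<phi> t g)"
  proof (intro subset_antisym subsetI)
    fix x assume "x \<in> omega_limit T \<phi> g"
    then obtain t :: "nat \<Rightarrow> real" where t: "filterlim t at_top sequentially" "limitin T (\<lambda>n. \<phi> (t n) g) x sequentially"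
      by (auto simp: omega_limit_def)
    have "\<forall>\<^sub>F n in sequentially. t n \<ge> 0" using t(1) by (simp add: filterlim_at_top)
    then have "\<forall>\<^sub>F n in sequentially. \<phi> (t n) g \<in> ?K" by eventually_elim (rule inK)
    from limitin_closedin[OF t(2) K this] have "x \<in> ?K" by simp
    then show "x \<in> range (\<lambda>t. \<phi> t g)" by blast
  next
    fix x assume "x \<in> range (\<lambda>t. \<phi> t g)"
    then obtain s where s: "x = \<phi> s g" by blast
    have "filterlim (\<lambda>n. s + real n * P) at_top sequentially"
      using P(1) by (intro filterlim_tendsto_add_at_top[OF tendsto_const]
          filterlim_at_top_mult_tendsto_pos[OF tendsto_const _ filterlim_real_sequentially])
    moreover have "limitin T (\<lambda>n. \<phi> (s + real n * P) g) x sequentially"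
      by (simp add: nat s limitin_const_iff topspace_eq closed)
    ultimately show "x \<in> omega_limit T \<phi> g"
      unfolding omega_limit_def by (intro CollectI exI[of _ "\<lambda>n. s + real n * P"] conjI)
  qed
  then show ?thesis
    unfolding periodic_orbit_def using g P(1) step topspace_eq by auto
qed

end

theorem theorem4p4:
  fixes G :: "('a, 'e::euclidean_space) lie_struct"
    and X :: "'a vector_field"
    and \<phi> :: "real \<Rightarrow> 'a \<Rightarrow> 'a"
    and \<alpha> :: real
    and g :: 'a
    and \<Omega> :: "'a set"
  assumes "lie_group G"
    and "connected_space (gtop G)"
    and "compact_space (gtop G)"
    and "semisimple G"
    and "linear_vector_field G X \<phi>"
    and "eigenvalues_on (lie_algebra G) (derivation_of X) \<subseteq> {0, \<i> * of_real \<alpha>, - (\<i> * of_real \<alpha>)}"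
    and "g \<in> carrier G"
    and "\<Omega> = omega_limit (gtop G) \<phi> g"
    and "\<Omega> \<noteq> {}"
    and "compactin (gtop G) \<Omega>"
    and "\<forall>x\<in>\<Omega>. \<not> fixed_point \<phi> x"
  shows "periodic_orbit (gtop G) \<phi> \<Omega>"
proof -
  interpret L: lie_group G by (rule assms(1))
  have "\<one>\<^bsub>G\<^esub> \<in> topspace (gtop G)" by (simp add: L.topspace_eq)
  \<comment> \<open>Any chart around the identity serves to identify the Lie algebra with the model
    space.\<close>
  then obtain U c where "(U, c) \<in> charts G" "\<one>\<^bsub>G\<^esub> \<in> U"
    by (rule smooth_atlas_cover[OF smooth_manifold_atlas[OF L.manifold]])
  then interpret lie_group_chart G U c by unfold_locales
  obtain P where P: "P > 0" "\<And>p. p \<in> carrier G \<Longrightarrow> \<phi> P p = p"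
    by (rule linear_flow_periodic[OF assms(3,4,2,5,6)]) (rule that, assumption+)
  show ?thesis
    unfolding assms(8) by (rule periodic_flow_omega_limit[OF assms(5) P assms(7)])
qed

end
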